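(* Let $\mu$ be a measure on $\mathbb{R}^n$ of the form $\mu=\sum_{\lambda\in\Lambda}\mu(\lambda)\delta_\lambda$ with $\mu(\lambda)\neq 0$ for all $\lambda\in\Lambda$, where $\Lambda\subset\mathbb{R}^n$ is a Meyer set. Assume that $\hat\mu$ is a slowly increasing measure which is purely atomic, $\hat\mu=\sum_{s\in S}\hat\mu(s)\delta_s$ with $S$ countable and $\hat\mu(s)\neq 0$ for all $s\in S$. Then, either (i) $S$ is uniformly discrete; or (ii) the set of accumulation points of $S$ in $\mathbb{R}^n$ is relatively dense.
   Context: A "measure" on $\mathbb{R}^n$ means a complex, locally finite measure $\mu$ that is slowly increasing: there is $N$ with $|\mu|(\{|x|<R\})=O(R^N)$ as $R\to\infty$. Such a measure is a temperate distribution, and $\hat\mu$ denotes its distributional Fourier transform, $\langle\hat\mu,\varphi\rangle=\langle\mu,\hat\varphi\rangle$ for Schwartz $\varphi$, with $\hat\varphi(t)=\int\varphi(x)e^{-2\pi i\langle t,x\rangle}dx$. $\delta_x$ is the unit point mass at $x$. A set $A\subset\mathbb{R}^n$ is uniformly discrete if $\inf\{|x-y|:x,y\in A,\ x\neq y\}>0$, relatively dense if there is $R>0$ such that every ball of radius $R$ intersects $A$, and a Delone set if it is both. A Meyer set is a Delone set $\Lambda$ for which there is a finite set $F\subset\mathbb{R}^n$ with $\Lambda-\Lambda\subset\Lambda+F$; equivalently (Lagarias), a Delone set $\Lambda$ such that $\Lambda-\Lambda$ is uniformly discrete. *)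

theory Defs
  imports "HOL-Analysis.Analysis"
begin

section \<open>Complex locally finite measures\<close>

definition bounded_borel :: "'a::euclidean_space set set" where
  "bounded_borel = {A. A \<in> sets borel \<and> bounded A}"

text \<open>A complex locally finite measure is a set function on the bounded Borel sets: on an unbounded
  set it need not have a value, so the values of \<open>\<mu>\<close> outside \<open>bounded_borel\<close> are never used.\<close>

text \<open>\<open>|\<mu>|(A)\<close>\<close>
definition total_variation :: "('a::euclidean_space set \<Rightarrow> complex) \<Rightarrow> 'a set \<Rightarrow> ennreal" where
  "total_variation \<mu> A =
    (SUP P \<in> {P. finite P \<and> disjoint P \<and> P \<subseteq> bounded_borel \<and> \<Union>P \<subseteq> A}.
       \<Sum>B\<in>P. ennreal (cmod (\<mu> B)))"

definition complex_loc_finite_measure :: "('a::euclidean_space set \<Rightarrow> complex) \<Rightarrow> bool" where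
  "complex_loc_finite_measure \<mu> \<longleftrightarrow>
    (\<forall>A :: nat \<Rightarrow> 'a set. range A \<subseteq> bounded_borel \<and> disjoint_family A \<and> bounded (\<Union>i. A i) \<longrightarrow>
        (\<lambda>i. \<mu> (A i)) sums \<mu> (\<Union>i. A i)) \<and>
    (\<forall>A \<in> bounded_borel. total_variation \<mu> A < \<infinity>)"

definition slowly_increasing :: "('a::euclidean_space set \<Rightarrow> complex) \<Rightarrow> bool" where
  "slowly_increasing \<mu> \<longleftrightarrow>
    (\<exists>(N::nat) (C::real). \<forall>\<^sub>F R in at_top. total_variation \<mu> (ball 0 R) \<le> ennreal (C * R ^ N))"

definition slowly_increasing_measure :: "('a::euclidean_space set \<Rightarrow> complex) \<Rightarrow> bool" where
  "slowly_increasing_measure \<mu> \<longleftrightarrow> complex_loc_finite_measure \<mu> \<and> slowly_increasing \<mu>"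

text \<open>The positive part in the Jordan decomposition of a real-valued (signed) locally finite
  measure \<open>\<sigma>\<close>, as a measure on all Borel sets; \<open>ennreal\<close> maps negative reals to \<open>0\<close>.
  The negative part is the positive part of \<open>-\<sigma>\<close>.\<close>
definition positive_part :: "('a::euclidean_space set \<Rightarrow> real) \<Rightarrow> 'a measure" where
  "positive_part \<sigma> =
    measure_of UNIV (sets borel) (\<lambda>A. SUP B \<in> {B \<in> bounded_borel. B \<subseteq> A}. ennreal (\<sigma> B))"

text \<open>\<open>\<integral> f d\<mu>\<close>, through the Jordan decompositions of the real and imaginary parts of \<open>\<mu>\<close>\<close>
definition integral_wrt ::
    "('a::euclidean_space set \<Rightarrow> complex) \<Rightarrow> ('a \<Rightarrow> complex) \<Rightarrow> complex" where
  "integral_wrt \<mu> f =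
    (integral\<^sup>L (positive_part (\<lambda>A. Re (\<mu> A))) f - integral\<^sup>L (positive_part (\<lambda>A. - Re (\<mu> A))) f) +
    \<i> * (integral\<^sup>L (positive_part (\<lambda>A. Im (\<mu> A))) f - integral\<^sup>L (positive_part (\<lambda>A. - Im (\<mu> A))) f)"

text \<open>\<open>\<mu> = (\<Sum>s\<in>S. \<mu>(s) \<delta>\<^sub>s)\<close>, where \<open>\<mu>(s) = \<mu> {s}\<close>\<close>
definition atomic_on :: "('a::euclidean_space set \<Rightarrow> complex) \<Rightarrow> 'a set \<Rightarrow> bool" where
  "atomic_on \<mu> S \<longleftrightarrow> (\<forall>A \<in> bounded_borel. ((\<lambda>s. \<mu> {s}) has_sum \<mu> A) (S \<inter> A))"


section \<open>Schwartz functions and the Fourier transform\<close>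

definition partial_deriv :: "'n \<Rightarrow> (real ^ 'n \<Rightarrow> complex) \<Rightarrow> real ^ 'n \<Rightarrow> complex" where
  "partial_deriv i f x = frechet_derivative f (at x) (axis i 1)"

text \<open>Mixed partial derivatives are indexed by lists of coordinates instead of multi-indices.
  If all of them are differentiable everywhere, then all of them are continuous, so this is
  \<open>C\<^sup>\<infinity>\<close>-smoothness.\<close>
definition schwartz :: "(real ^ 'n \<Rightarrow> complex) \<Rightarrow> bool" where
  "schwartz f \<longleftrightarrow>
    (\<forall>is. (\<forall>x. foldr partial_deriv is f differentiable (at x)) \<and>
          (\<forall>k::nat. \<exists>C. \<forall>x. norm x ^ k * cmod (foldr partial_deriv is f x) \<le> C))"

definition fourier :: "(real ^ 'n \<Rightarrow> complex) \<Rightarrow> real ^ 'n \<Rightarrow> complex" where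
  "fourier f t = (LINT x|lborel. f x * exp (- 2 * of_real pi * \<i> * of_real (t \<bullet> x)))"

text \<open>The distributional Fourier transform of \<open>\<mu>\<close> is the measure \<open>\<nu>\<close>.\<close>
definition has_fourier_transform ::
    "((real ^ 'n) set \<Rightarrow> complex) \<Rightarrow> ((real ^ 'n) set \<Rightarrow> complex) \<Rightarrow> bool" where
  "has_fourier_transform \<mu> \<nu> \<longleftrightarrow>
    (\<forall>\<phi>. schwartz \<phi> \<longrightarrow> integral_wrt \<nu> \<phi> = integral_wrt \<mu> (fourier \<phi>))"


section \<open>Delone and Meyer sets\<close>

definition relatively_dense :: "'a::euclidean_space set \<Rightarrow> bool" where
  "relatively_dense A \<longleftrightarrow> (\<exists>R>0. \<forall>x. ball x R \<inter> A \<noteq> {})"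

definition delone :: "'a::euclidean_space set \<Rightarrow> bool" where
  "delone A \<longleftrightarrow> uniform_discrete A \<and> relatively_dense A"

definition meyer_set :: "'a::euclidean_space set \<Rightarrow> bool" where
  "meyer_set L \<longleftrightarrow> delone L \<and>
    (\<exists>F. finite F \<and> {x - y |x y. x \<in> L \<and> y \<in> L} \<subseteq> {z + f |z f. z \<in> L \<and> f \<in> F})"

end

theory Submission
  imports Defs "HOL-Complex_Analysis.Complex_Analysis" "HOL-Probability.Probability" "HOL-Real_Asymp.Real_Asymp"
begin

text \<open>
  By Lagarias, a Meyer set \<open>\<Lambda>\<close> lies in the integer span of finitely many rationally independent
  vectors \<open>b \<in> B\<close>, and the coordinates of \<open>\<lambda> \<in> \<Lambda>\<close> are \<open>\<alpha>\<^sub>b \<bullet> \<lambda>\<close> up to bounded errors \<open>\<lambda>\<^sup>*\<^sub>b\<close>.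
  For an integer vector \<open>\<theta>\<close> the character with frequency \<open>\<Sum>\<^sub>b \<theta>\<^sub>b \<alpha>\<^sub>b\<close> depends on
  \<open>\<lambda>\<close> only through \<open>\<theta> \<bullet> \<lambda>\<^sup>*\<close>. Testing the Fourier relation with Gaussians shows that the atoms
  of \<open>\<mu>\<close> are bounded and that an atom \<open>\<nu>(s)\<close> is a Gaussian mean of \<open>\<mu>(\<lambda>) exp (- 2 \<pi> \<i> s \<bullet> \<lambda>)\<close>.
  Hence \<open>\<nu>(s - \<Sum>\<^sub>b \<theta>\<^sub>b \<alpha>\<^sub>b)\<close> is the value at \<open>\<theta>\<close> of a limit of exponential sums with
  frequencies in a fixed ball: a bounded function of exponential type on the internal space.

  By Kronecker, the \<open>\<theta>\<close> for which \<open>s - \<Sum>\<^sub>b \<theta>\<^sub>b \<alpha>\<^sub>b\<close> falls into a given ball of large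
  radius form a fine net in the internal space. A nonzero function of the above kind cannot vanish on
  the part of a fine net in a half space: a Gaussian weight and the three lines theorem give exponential
  decay on a cone, and the product of finitely many rotated copies contradicts the maximum principle.
  So if some large ball contains only finitely many points of \<open>S\<close>, then \<open>S\<close> lies in finitely many
  cosets of the group of all \<open>\<Sum>\<^sub>b \<theta>\<^sub>b \<alpha>\<^sub>b\<close>, and this group is discrete, because otherwise some
  internal direction is orthogonal to all \<open>\<theta>\<close> with \<open>\<Sum>\<^sub>b \<theta>\<^sub>b \<alpha>\<^sub>b = 0\<close>, and the finitely many
  points in the ball only account for \<open>\<theta>\<close> outside a half space.
\<close>

section \<open>Fourier transforms of Gaussians\<close>

text \<open>Uniformity shapes the proof. The functions on the internal space are never formed: they
  enter as finite exponential sums that reproduce \<open>\<nu>\<close> up to an error on finitely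
  many lattice points, and every estimate depends only on the total mass \<open>M\<close> and the
  frequency bound \<open>\<sigma>\<close>. Hence the radius \<open>R\<close> of a ball that must
  meet the spectrum is fixed before the point s and the hole in the set of accumulation points are
  chosen. The half space argument works because a nonzero function of exponential type cannot decay
  in a sector at a rate far above its type, whereas a finer net forces a faster decay and the mesh
  is free. A half space rather than the whole space has to be treated because, when the group is not
  discrete, infinitely many lattice points may carry s to the same point of the ball. These differ
  by lattice points with physical part 0, so in the orthogonal direction they all have the same
  component.\<close>

definition gaussian :: "real \<Rightarrow> 'a::euclidean_space \<Rightarrow> 'a \<Rightarrow> 'a \<Rightarrow> complex" where
  "gaussian a s l x = exp (of_real (- pi * a * (norm (x - s))\<^sup>2) + 2 * of_real pi * \<i> * of_real (l \<bullet> x))"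

lemma norm_gaussian: "cmod (gaussian a s l x) = exp (- pi * a * (norm (x - s))\<^sup>2)"
  by (simp add: gaussian_def)

lemma gaussian_measurable [measurable]: "gaussian a s l \<in> borel_measurable borel"
  unfolding gaussian_def by measurable

text \<open>The substitution of \<open>s + c * x\<close> for the variable, with
  \<open>c = 1 / sqrt (2 * pi * a)\<close>, turns the integral into the characteristic function of
  the standard normal distribution.\<close>

lemma gaussian_integral_1d:
  fixes a s u :: real
  assumes a: "a > 0"
  shows "integrable lborel (gaussian a s u)"
    and "(LINT x|lborel. gaussian a s u x) = of_real (1 / sqrt a) * gaussian (1 / a) 0 s u"
proof -
  define f where "f = gaussian a s u"
  define c where "c = 1 / sqrt (2 * pi * a)"
  have c0: "c \<noteq> 0" "c > 0" using a by (auto simp: c_def)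
  have c2: "c\<^sup>2 = 1 / (2 * pi * a)" using a by (simp add: c_def power_divide)
  define g where "g = (\<lambda>x. std_normal_density x *\<^sub>R iexp (2 * pi * u * c * x))"
  define K where "K = complex_of_real (sqrt (2 * pi)) * exp (2 * of_real pi * \<i> * of_real (u * s))"
  have fg: "f (s + c * x) = K * g x" for x
  proof -
    have 1: "- pi * a * (norm (s + c * x - s))\<^sup>2 = - (x\<^sup>2) / 2" using a by (simp add: power_mult_distrib c2)
    have 2: "2 * of_real pi * \<i> * of_real (u \<bullet> (s + c * x)) = 2 * of_real pi * \<i> * of_real (u * s) + \<i> * of_real (2 * pi * u * c * x)"
      by (simp add: algebra_simps)
    have "f (s + c * x) = exp (of_real (- (x\<^sup>2) / 2)) * exp (2 * of_real pi * \<i> * of_real (u * s)) * iexp (2 * pi * u * c * x)"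
      unfolding f_def gaussian_def 1 2 by (simp only: exp_add mult.assoc)
    moreover have "exp (of_real (- (x\<^sup>2) / 2)) = complex_of_real (sqrt (2 * pi)) * of_real (std_normal_density x)"
      by (simp add: std_normal_density_def exp_of_real[symmetric] del: exp_of_real)
    ultimately show ?thesis by (simp add: K_def g_def scaleR_conv_of_real)
  qed
  have ig: "integrable lborel g"
    unfolding g_def
    by (rule Bochner_Integration.integrable_bound[OF integrable_normal_density[of 1 0]])
      (auto simp: norm_mult)
  have eg: "integral\<^sup>L lborel g = of_real (exp (- ((2 * pi * u * c)\<^sup>2) / 2))"
  proof -
    have "char std_normal_distribution (2 * pi * u * c) = integral\<^sup>L lborel g"
      unfolding char_def g_def by (subst integral_density) auto
    then show ?thesis by (simp add: char_std_normal_distribution)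
  qed
  have "integrable lborel (\<lambda>x. f (s + c * x))" unfolding fg using ig by simp
  then have "integrable lborel f" by (simp add: lborel_integrable_real_affine_iff c0)
  then show "integrable lborel (gaussian a s u)" by (simp add: f_def)
  have "integral\<^sup>L lborel f = \<bar>c\<bar> *\<^sub>R (LINT x|lborel. f (s + c * x))"
    by (rule lborel_integral_real_affine[OF c0(1)])
  also have "(LINT x|lborel. f (s + c * x)) = K * of_real (exp (- ((2 * pi * u * c)\<^sup>2) / 2))"
    unfolding fg by (simp add: eg)
  also have "- ((2 * pi * u * c)\<^sup>2) / 2 = - pi * u\<^sup>2 / a"
  proof -
    have "(2 * pi * u * c)\<^sup>2 = (2 * pi * u)\<^sup>2 * (1 / (2 * pi * a))" by (simp only: power_mult_distrib c2)
    then show ?thesis using a by (simp add: field_simps power2_eq_square)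
  qed
  also have "\<bar>c\<bar> *\<^sub>R (K * of_real (exp (- pi * u\<^sup>2 / a))) = of_real (1 / sqrt a) * gaussian (1 / a) 0 s u"
  proof -
    have "\<bar>c\<bar> * sqrt (2 * pi) = 1 / sqrt a" using a c0 by (simp add: c_def real_sqrt_mult)
    then have "complex_of_real \<bar>c\<bar> * complex_of_real (sqrt (2 * pi)) = of_real (1 / sqrt a)"
      by (simp only: of_real_mult[symmetric])
    moreover have "\<bar>c\<bar> *\<^sub>R (K * of_real (exp (- pi * u\<^sup>2 / a))) = (complex_of_real \<bar>c\<bar> * complex_of_real (sqrt (2 * pi))) *
        (exp (of_real (- pi * u\<^sup>2 / a)) * exp (2 * of_real pi * \<i> * of_real (u * s)))"
      by (simp only: K_def scaleR_conv_of_real exp_of_real mult_ac)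
    moreover have "gaussian (1 / a) 0 s u = exp (of_real (- pi * u\<^sup>2 / a)) * exp (2 * of_real pi * \<i> * of_real (u * s))"
      by (simp add: gaussian_def exp_add[symmetric] mult.commute)
    ultimately show ?thesis by (simp only:)
  qed
  finally show "(LINT x|lborel. gaussian a s u x) = of_real (1 / sqrt a) * gaussian (1 / a) 0 s u"
    by (simp add: f_def)
qed

text \<open>Fubini: \<open>lborel\<close> is the image of the product measure over the
  coordinates.\<close>

lemma lborel_integral_prod_Basis:
  fixes f :: "'a::euclidean_space \<Rightarrow> real \<Rightarrow> complex"
  assumes int: "\<And>b. b \<in> Basis \<Longrightarrow> integrable lborel (f b)"
  shows "integrable lborel (\<lambda>x. \<Prod>b\<in>Basis. f b (x \<bullet> b))"
    and "(LINT x|lborel. (\<Prod>b\<in>Basis. f b (x \<bullet> b))) = (\<Prod>b\<in>Basis. integral\<^sup>L lborel (f b))"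
proof -
  interpret product_sigma_finite "\<lambda>_::'a. lborel :: real measure" ..
  have [measurable]: "f b \<in> borel_measurable borel" if "b \<in> Basis" for b
    using borel_measurable_integrable[OF int[OF that]] by simp
  have eq: "(\<Prod>b\<in>Basis. f b ((\<Sum>b'\<in>Basis. g b' *\<^sub>R b') \<bullet> b)) = (\<Prod>b\<in>Basis. f b (g b))" for g :: "'a \<Rightarrow> real"
    by (intro prod.cong) (auto simp: inner_sum_left_Basis)
  have m: "(\<lambda>x. \<Prod>b\<in>Basis. f b (x \<bullet> b)) \<in> borel_measurable borel" by measurable
  show "integrable lborel (\<lambda>x. \<Prod>b\<in>Basis. f b (x \<bullet> b))"
    unfolding lborel_eq[where 'a='a]
    by (subst integrable_distr_eq) (use m in \<open>auto simp: eq int intro!: product_integrable_prod\<close>)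
  show "(LINT x|lborel. (\<Prod>b\<in>Basis. f b (x \<bullet> b))) = (\<Prod>b\<in>Basis. integral\<^sup>L lborel (f b))"
    unfolding lborel_eq[where 'a='a]
    by (subst integral_distr) (use m in \<open>auto simp: eq int product_integral_prod\<close>)
qed

lemma gaussian_prod_Basis: "gaussian a s l x = (\<Prod>b\<in>Basis. gaussian a (s \<bullet> b) (l \<bullet> b) (x \<bullet> b))"
proof -
  have "(norm (x - s))\<^sup>2 = (\<Sum>b\<in>Basis. ((x - s) \<bullet> b)\<^sup>2)"
    unfolding power2_norm_eq_inner by (subst euclidean_inner) (simp add: power2_eq_square)
  moreover have "l \<bullet> x = (\<Sum>b\<in>Basis. (l \<bullet> b) * (x \<bullet> b))" by (rule euclidean_inner)
  ultimately show ?thesis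
    by (simp add: gaussian_def exp_sum[symmetric] sum.distrib sum_distrib_left inner_diff_left sum_negf sum_subtractf)
qed

lemma gaussian_integral:
  fixes s u :: "'a::euclidean_space"
  assumes a: "a > 0"
  shows "integrable lborel (gaussian a s u)"
    and "(LINT x|lborel. gaussian a s u x) = of_real ((1 / sqrt a) ^ DIM('a)) * gaussian (1 / a) 0 s u"
proof -
  define f where "f = (\<lambda>b. gaussian a (s \<bullet> b) (u \<bullet> b))"
  have gf: "gaussian a s u = (\<lambda>x. \<Prod>b\<in>Basis. f b (x \<bullet> b))"
    unfolding f_def by (rule ext) (rule gaussian_prod_Basis)
  have "integrable lborel (f b)" for b unfolding f_def by (rule gaussian_integral_1d(1)[OF a])
  note * = lborel_integral_prod_Basis[of f, OF this]
  show "integrable lborel (gaussian a s u)" unfolding gf by (rule *)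
  have "(LINT x|lborel. gaussian a s u x) = (\<Prod>b\<in>Basis. of_real (1 / sqrt a) * gaussian (1 / a) 0 (s \<bullet> b) (u \<bullet> b))"
    unfolding gf *(2) unfolding f_def gaussian_integral_1d(2)[OF a] ..
  also have "\<dots> = of_real ((1 / sqrt a) ^ DIM('a)) * gaussian (1 / a) 0 s u"
    by (simp only: prod.distrib prod_constant of_real_power gaussian_prod_Basis[of "1 / a" 0 s u] inner_zero_left)
  finally show "(LINT x|lborel. gaussian a s u x) = of_real ((1 / sqrt a) ^ DIM('a)) * gaussian (1 / a) 0 s u" .
qed

lemma gaussian_integral_real:
  fixes s :: "'a::euclidean_space"
  assumes a: "a > 0"
  shows "integrable lborel (\<lambda>x. exp (- pi * a * (norm (x - s))\<^sup>2))"
    and "(LINT x|lborel. exp (- pi * a * (norm (x - s))\<^sup>2)) = (1 / sqrt a) ^ DIM('a)"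
proof -
  have eq: "gaussian a s 0 = (\<lambda>x. complex_of_real (exp (- pi * a * (norm (x - s))\<^sup>2)))"
    by (rule ext) (simp add: gaussian_def exp_of_real[symmetric] del: exp_of_real)
  show "integrable lborel (\<lambda>x. exp (- pi * a * (norm (x - s))\<^sup>2))"
    using gaussian_integral(1)[OF a, of s 0] unfolding eq complex_of_real_integrable_eq .
  have "complex_of_real (LINT x|lborel. exp (- pi * a * (norm (x - s))\<^sup>2)) = of_real ((1 / sqrt a) ^ DIM('a))"
    using gaussian_integral(2)[OF a, of s 0] unfolding eq integral_complex_of_real by (simp add: gaussian_def)
  then show "(LINT x|lborel. exp (- pi * a * (norm (x - s))\<^sup>2)) = (1 / sqrt a) ^ DIM('a)"
    using of_real_eq_iff by blast
qed

text \<open>Up to constants the transform inverts \<open>a\<close> and exchanges centre and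
  frequency, so a test function centred at a point on one side is a modulated one on the other. This
  is why the family carries both \<open>s\<close> and \<open>l\<close>.\<close>

lemma fourier_gaussian:
  fixes s l t :: "real ^ 'n"
  assumes a: "a > 0"
  shows "fourier (gaussian a s l) t = of_real ((1 / sqrt a) ^ CARD('n)) * gaussian (1 / a) l (- s) t * exp (2 * of_real pi * \<i> * of_real (s \<bullet> l))"
proof -
  have "fourier (gaussian a s l) t = (LINT x|lborel. gaussian a s (l - t) x)"
    unfolding fourier_def gaussian_def
    by (intro Bochner_Integration.integral_cong) (auto simp: exp_add[symmetric] algebra_simps inner_diff_left)
  also have "\<dots> = of_real ((1 / sqrt a) ^ CARD('n)) * gaussian (1 / a) 0 s (l - t)"
    by (subst gaussian_integral(2)[OF a]) simp
  also have "\<dots> = of_real ((1 / sqrt a) ^ CARD('n)) * gaussian (1 / a) l (- s) t * exp (2 * of_real pi * \<i> * of_real (s \<bullet> l))"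
    by (simp add: gaussian_def norm_minus_commute inner_diff_left exp_add[symmetric] mult.assoc algebra_simps inner_commute)
  finally show ?thesis .
qed

section \<open>Gaussians are Schwartz functions\<close>

inductive_set polynomials :: "(real ^ 'n \<Rightarrow> complex) set" where
  const: "(\<lambda>x. c) \<in> polynomials"
| coord: "(\<lambda>x. of_real (x $ i)) \<in> polynomials"
| add: "\<lbrakk>p \<in> polynomials; q \<in> polynomials\<rbrakk> \<Longrightarrow> (\<lambda>x. p x + q x) \<in> polynomials"
| mult: "\<lbrakk>p \<in> polynomials; q \<in> polynomials\<rbrakk> \<Longrightarrow> (\<lambda>x. p x * q x) \<in> polynomials"

lemma polynomials_derivative:
  fixes p :: "real ^ 'n \<Rightarrow> complex"
  assumes "p \<in> polynomials"
  shows "\<exists>p'. (\<forall>x. (p has_derivative p' x) (at x)) \<and> (\<forall>i. (\<lambda>x. p' x (axis i 1)) \<in> polynomials)"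
  using assms
proof induction
  case (const c)
  show ?case by (rule exI[of _ "\<lambda>x h. 0"]) (auto intro: polynomials.const)
next
  case (coord j)
  have "((\<lambda>x. of_real (x $ j)) has_derivative (\<lambda>h. complex_of_real (h $ j))) (at x)" for x :: "real ^ 'n"
    by (intro derivative_intros bounded_linear_imp_has_derivative bounded_linear_vec_nth)
  then show ?case by (intro exI[of _ "\<lambda>x h. of_real (h $ j)"]) (auto intro: polynomials.const)
next
  case (add p q)
  then obtain p' q' where "\<And>x. (p has_derivative p' x) (at x)" "\<And>i. (\<lambda>x. p' x (axis i 1)) \<in> polynomials"
    "\<And>x. (q has_derivative q' x) (at x)" "\<And>i. (\<lambda>x. q' x (axis i 1)) \<in> polynomials" by blast
  then show ?case by (intro exI[of _ "\<lambda>x h. p' x h + q' x h"]) (auto intro: polynomials.add has_derivative_add)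
next
  case (mult p q)
  then obtain p' q' where *: "\<And>x. (p has_derivative p' x) (at x)" "\<And>i. (\<lambda>x. p' x (axis i 1)) \<in> polynomials"
    "\<And>x. (q has_derivative q' x) (at x)" "\<And>i. (\<lambda>x. q' x (axis i 1)) \<in> polynomials" by blast
  then have "((\<lambda>x. p x * q x) has_derivative (\<lambda>h. p x * q' x h + p' x h * q x)) (at x)" for x
    by (intro has_derivative_mult) auto
  moreover have "(\<lambda>x. p x * q' x (axis i 1) + p' x (axis i 1) * q x) \<in> polynomials" for i
    using * mult.hyps by (intro polynomials.add polynomials.mult) auto
  ultimately show ?case by (intro exI[of _ "\<lambda>x h. p x * q' x h + p' x h * q x"]) auto
qed

lemma polynomials_growth:
  fixes p :: "real ^ 'n \<Rightarrow> complex"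
  assumes "p \<in> polynomials"
  shows "\<exists>C k. \<forall>x. cmod (p x) \<le> C * (1 + norm x) ^ k"
  using assms
proof induction
  case (const c)
  show ?case by (rule exI[of _ "cmod c"], rule exI[of _ 0]) auto
next
  case (coord j)
  show ?case
    by (rule exI[of _ 1], rule exI[of _ 1]) (auto intro: order_trans[OF component_le_norm_cart])
next
  case (add p q)
  then obtain C k C' k' where *: "\<And>x. cmod (p x) \<le> C * (1 + norm x) ^ k" "\<And>x. cmod (q x) \<le> C' * (1 + norm x) ^ k'"
    by blast
  have C: "C \<ge> 0" "C' \<ge> 0" using order_trans[OF norm_ge_zero *(1)[of 0]] order_trans[OF norm_ge_zero *(2)[of 0]] by simp_all
  show ?case
  proof (intro exI allI)
    fix x :: "real ^ 'n"
    have "C * (1 + norm x) ^ k \<le> C * (1 + norm x) ^ (k + k')" "C' * (1 + norm x) ^ k' \<le> C' * (1 + norm x) ^ (k + k')"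
      using C by (auto intro!: mult_left_mono power_increasing)
    then show "cmod (p x + q x) \<le> (C + C') * (1 + norm x) ^ (k + k')"
      using *[of x] norm_triangle_ineq[of "p x" "q x"] by (simp add: algebra_simps)
  qed
next
  case (mult p q)
  then obtain C k C' k' where *: "\<And>x. cmod (p x) \<le> C * (1 + norm x) ^ k" "\<And>x. cmod (q x) \<le> C' * (1 + norm x) ^ k'"
    by blast
  show ?case
  proof (intro exI allI)
    fix x :: "real ^ 'n"
    show "cmod (p x * q x) \<le> (C * C') * (1 + norm x) ^ (k + k')"
      using mult_mono'[OF *[of x] norm_ge_zero norm_ge_zero] by (simp add: norm_mult power_add mult_ac)
  qed
qed

lemma gaussian_has_derivative:
  fixes s l :: "real ^ 'n"
  shows "(gaussian a s l has_derivative
    (\<lambda>h. (of_real (- 2 * pi * a * ((x - s) \<bullet> h)) + 2 * of_real pi * \<i> * of_real (l \<bullet> h)) * gaussian a s l x)) (at x)"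
proof -
  have "((\<lambda>x. of_real (- pi * a * ((x - s) \<bullet> (x - s))) + 2 * of_real pi * \<i> * of_real (l \<bullet> x)) has_derivative
    (\<lambda>h. of_real (- 2 * pi * a * ((x - s) \<bullet> h)) + 2 * of_real pi * \<i> * of_real (l \<bullet> h))) (at x)"
    by (auto intro!: derivative_eq_intros simp: inner_commute algebra_simps)
  from has_derivative_compose[OF this, of exp "\<lambda>h. h * exp (of_real (- pi * a * ((x - s) \<bullet> (x - s))) + 2 * of_real pi * \<i> * of_real (l \<bullet> x))"]
  show ?thesis
    unfolding gaussian_def power2_norm_eq_inner
    using DERIV_exp[of "of_real (- pi * a * ((x - s) \<bullet> (x - s))) + 2 * of_real pi * \<i> * of_real (l \<bullet> x)"]
    by (simp add: has_field_derivative_def mult_commute_abs)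
qed

text \<open>The logarithmic derivative of a Gaussian is a polynomial, so the polynomial multiples of
  a fixed Gaussian are closed under partial derivatives. Iteration describes all mixed derivatives
  at once.\<close>

lemma partial_deriv_gaussian:
  fixes s l :: "real ^ 'n"
  assumes "p \<in> polynomials"
  shows "(\<lambda>x. p x * gaussian a s l x) differentiable (at x)"
    and "\<exists>q\<in>polynomials. partial_deriv i (\<lambda>x. p x * gaussian a s l x) = (\<lambda>x. q x * gaussian a s l x)"
proof -
  obtain p' where p': "\<And>x. (p has_derivative p' x) (at x)" "\<And>i. (\<lambda>x. p' x (axis i 1)) \<in> polynomials"
    using polynomials_derivative[OF assms] by blast
  define e where "e = (\<lambda>x h. complex_of_real (- 2 * pi * a * ((x - s) \<bullet> h)) + 2 * of_real pi * \<i> * of_real (l \<bullet> h))"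
  have der: "((\<lambda>x. p x * gaussian a s l x) has_derivative (\<lambda>h. p x * (e x h * gaussian a s l x) + p' x h * gaussian a s l x)) (at x)" for x
    unfolding e_def by (intro has_derivative_mult p' gaussian_has_derivative)
  then show "(\<lambda>x. p x * gaussian a s l x) differentiable (at x)" unfolding differentiable_def by blast
  have e: "e x (axis i 1) = of_real (- 2 * pi * a) * (of_real (x $ i) + of_real (- s $ i)) + 2 * of_real pi * \<i> * of_real (l $ i)" for x
    by (simp add: e_def inner_axis algebra_simps)
  have "(\<lambda>x. e x (axis i 1)) \<in> polynomials"
    unfolding e by (intro polynomials.intros)
  then have "(\<lambda>x. p x * e x (axis i 1) + p' x (axis i 1)) \<in> polynomials"
    using assms p' by (intro polynomials.add polynomials.mult) auto
  moreover have "partial_deriv i (\<lambda>x. p x * gaussian a s l x) = (\<lambda>x. (p x * e x (axis i 1) + p' x (axis i 1)) * gaussian a s l x)"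
    unfolding partial_deriv_def frechet_derivative_at[OF der, symmetric] by (simp add: algebra_simps)
  ultimately show "\<exists>q\<in>polynomials. partial_deriv i (\<lambda>x. p x * gaussian a s l x) = (\<lambda>x. q x * gaussian a s l x)"
    by (intro bexI)
qed

lemma bounded_above_of_tendsto_0:
  fixes f :: "real \<Rightarrow> real"
  assumes f: "(f \<longlongrightarrow> 0) at_top" and cont: "continuous_on UNIV f"
  obtains D where "\<And>t. t \<ge> 0 \<Longrightarrow> f t \<le> D"
proof -
  have "\<forall>\<^sub>F t in at_top. f t < 1" using f by (rule order_tendstoD) simp
  then obtain T where T: "\<And>t. t \<ge> T \<Longrightarrow> f t < 1" by (auto simp: eventually_at_top_linorder)
  have "compact (f ` {0..T})"
    using continuous_on_subset[OF cont] by (intro compact_continuous_image) auto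
  then have "bounded (f ` {0..T})" by (rule compact_imp_bounded)
  then obtain K where K: "\<forall>t\<in>{0..T}. \<bar>f t\<bar> \<le> K" unfolding bounded_iff by auto
  have "f t \<le> max 1 K" if "t \<ge> 0" for t
  proof (cases "t \<ge> T")
    case True
    then show ?thesis by (intro max.coboundedI1 less_imp_le[OF T])
  next
    case False
    then show ?thesis using bspec[OF K, of t] that by simp
  qed
  then show ?thesis by (rule that)
qed

lemma schwartz_gaussian:
  fixes s l :: "real ^ 'n"
  assumes a: "a > 0"
  shows "schwartz (gaussian a s l)"
  unfolding schwartz_def
proof (intro allI conjI)
  have ex: "\<exists>q\<in>polynomials. foldr partial_deriv is (gaussian a s l) = (\<lambda>x. q x * gaussian a s l x)" for "is"
  proof (induction "is")
    case Nil
    show ?case by (intro bexI[OF _ polynomials.const[of 1]]) auto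
  next
    case (Cons i "is")
    then obtain q where "q \<in> polynomials" "foldr partial_deriv is (gaussian a s l) = (\<lambda>x. q x * gaussian a s l x)" by blast
    then show ?case using partial_deriv_gaussian(2)[of q i a s l] by simp
  qed
  fix "is" :: "'n list"
  obtain q where q: "q \<in> polynomials" "foldr partial_deriv is (gaussian a s l) = (\<lambda>x. q x * gaussian a s l x)" using ex by blast
  show "foldr partial_deriv is (gaussian a s l) differentiable at x" for x
    unfolding q(2) by (rule partial_deriv_gaussian[OF q(1)])
  fix k :: nat
  obtain C j where C: "\<And>x. cmod (q x) \<le> C * (1 + norm x) ^ j" using polynomials_growth[OF q(1)] by blast
  have C0: "C \<ge> 0" using C[of 0] norm_ge_zero[of "q 0"] by (simp del: norm_ge_zero)
  \<comment> \<open>With \<open>1 + norm x \<le> A + t\<close> all factors are bounded by a function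
    of the single real variable \<open>t\<close>.\<close>
  define A where "A = 1 + norm s"
  have A: "A \<ge> 1" by (simp add: A_def)
  obtain D where D: "\<And>t. t \<ge> 0 \<Longrightarrow> (A + t) ^ (k + j) * exp (- pi * a * t\<^sup>2) \<le> D"
  proof (rule bounded_above_of_tendsto_0)
    show "((\<lambda>t. (A + t) ^ (k + j) * exp (- pi * a * t\<^sup>2)) \<longlongrightarrow> 0) at_top" using a by real_asymp
  qed (auto intro!: continuous_intros)
  show "\<exists>C. \<forall>x. norm x ^ k * cmod (foldr partial_deriv is (gaussian a s l) x) \<le> C"
  proof (intro exI allI)
    fix x
    define t where "t = norm (x - s)"
    have nx: "1 + norm x \<le> A + t" using norm_triangle_ineq[of "x - s" s] by (simp add: A_def t_def)
    have "norm x ^ k * cmod (foldr partial_deriv is (gaussian a s l) x) = norm x ^ k * cmod (q x) * exp (- pi * a * t\<^sup>2)"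
      unfolding q(2) norm_mult norm_gaussian t_def by simp
    also have "\<dots> \<le> (A + t) ^ k * (C * (A + t) ^ j) * exp (- pi * a * t\<^sup>2)"
    proof (intro mult_right_mono mult_mono)
      show "norm x ^ k \<le> (A + t) ^ k" using nx norm_ge_zero[of x] by (intro power_mono) linarith+
      have "(1 + norm x) ^ j \<le> (A + t) ^ j" using nx by (intro power_mono) auto
      then show "cmod (q x) \<le> C * (A + t) ^ j" using C[of x] C0 by (meson mult_left_mono order_trans)
    qed (use A in \<open>auto simp: t_def\<close>)
    also have "\<dots> = C * ((A + t) ^ (k + j) * exp (- pi * a * t\<^sup>2))" by (simp add: power_add mult_ac)
    also have "\<dots> \<le> C * D" using C0 D[of t] by (intro mult_left_mono) (auto simp: t_def)
    finally show "norm x ^ k * cmod (foldr partial_deriv is (gaussian a s l) x) \<le> C * D" .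
  qed
qed

section \<open>Purely atomic measures\<close>

lemma count_space_restrict:
  fixes f :: "'a \<Rightarrow> ennreal"
  shows "A \<subseteq> S \<Longrightarrow> (\<integral>\<^sup>+x. f x * indicator A x \<partial>count_space S) = (\<integral>\<^sup>+x. f x \<partial>count_space A)"
  by (simp add: nn_integral_restrict_space[symmetric] restrict_count_space Int_absorb1 Int_absorb2)

text \<open>Countability gives an increasing exhaustion by finite sets, to which monotone
  convergence applies.\<close>

lemma nn_integral_count_space_le:
  fixes f :: "'a \<Rightarrow> ennreal"
  assumes S: "countable S" and le: "\<And>F. \<lbrakk>finite F; F \<subseteq> S\<rbrakk> \<Longrightarrow> sum f F \<le> c"
  shows "(\<integral>\<^sup>+x. f x \<partial>count_space S) \<le> c"
proof (cases "S = {}")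
  case True
  then show ?thesis by (simp add: nn_integral_count_space_finite)
next
  case False
  define F where "F = (\<lambda>k::nat. from_nat_into S ` {..<k})"
  have F: "finite (F k)" "F k \<subseteq> S" for k using from_nat_into[OF False] by (auto simp: F_def)
  have SF: "S = (\<Union>k. F k)"
  proof
    show "S \<subseteq> (\<Union>k. F k)"
    proof
      fix x assume "x \<in> S"
      then have "x = from_nat_into S (to_nat_on S x)" using S by simp
      then have "x \<in> F (Suc (to_nat_on S x))" unfolding F_def by blast
      then show "x \<in> (\<Union>k. F k)" by blast
    qed
  qed (use F in blast)
  have mono: "incseq (\<lambda>k x. f x * indicator (F k) x)"
    by (auto simp: incseq_def le_fun_def F_def split: split_indicator)
  have sup: "f x * indicator S x = (SUP k. f x * indicator (F k) x)" for x
  proof (rule antisym)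
    show "f x * indicator S x \<le> (SUP k. f x * indicator (F k) x)"
    proof (cases "x \<in> S")
      case True
      then obtain k where "x \<in> F k" using SF by blast
      then have "f x * indicator S x = f x * indicator (F k) x" using True by simp
      then show ?thesis by (metis SUP_upper UNIV_I)
    qed simp
    show "(SUP k. f x * indicator (F k) x) \<le> f x * indicator S x"
      using F by (intro SUP_least) (auto split: split_indicator)
  qed
  have "(\<integral>\<^sup>+x. f x \<partial>count_space S) = (\<integral>\<^sup>+x. f x * indicator S x \<partial>count_space UNIV)"
    by (simp add: count_space_restrict)
  also have "\<dots> = (SUP k. \<integral>\<^sup>+x. f x * indicator (F k) x \<partial>count_space UNIV)"
    unfolding sup by (rule nn_integral_monotone_convergence_SUP[OF mono]) simp
  also have "\<dots> \<le> c"
    using F le[OF F] by (intro SUP_least) (simp add: count_space_restrict nn_integral_count_space_finite)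
  finally show ?thesis .
qed

text \<open>\<open>distr\<close> along the identity replaces the sigma-algebra of all subsets of
  \<open>S\<close> by the Borel sets of the whole space, the form in which
  \<open>positive_part\<close> is given.\<close>

definition point_masses :: "'a::euclidean_space set \<Rightarrow> ('a \<Rightarrow> real) \<Rightarrow> 'a measure" where
  "point_masses S w = distr (density (count_space S) (\<lambda>s. ennreal (w s))) borel (\<lambda>s. s)"

lemma emeasure_point_masses:
  assumes A: "A \<in> sets borel"
  shows "emeasure (point_masses S w) A = (\<integral>\<^sup>+s. ennreal (w s) \<partial>count_space (S \<inter> A))"
proof -
  have "emeasure (point_masses S w) A = emeasure (density (count_space S) (\<lambda>s. ennreal (w s))) (S \<inter> A)"
    unfolding point_masses_def using A by (subst emeasure_distr) (auto simp: Int_commute)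
  also have "\<dots> = (\<integral>\<^sup>+s. ennreal (w s) * indicator (S \<inter> A) s \<partial>count_space S)"
    by (subst emeasure_density) auto
  also have "\<dots> = (\<integral>\<^sup>+s. ennreal (w s) \<partial>count_space (S \<inter> A))"
    by (rule count_space_restrict) simp
  finally show ?thesis .
qed

text \<open>\<open>measure_of\<close> yields the intended measure only for a countably additive set
  function; agreement with an existing measure settles this. One inequality compares partial sums,
  the other tests with a finite set of atoms of positive mass, which is a bounded Borel set.\<close>

lemma positive_part_atomic:
  fixes \<sigma> :: "'a::euclidean_space set \<Rightarrow> real"
  assumes S: "countable S"
    and at: "\<And>A. A \<in> bounded_borel \<Longrightarrow> ((\<lambda>s. \<sigma> {s}) has_sum \<sigma> A) (S \<inter> A)"
  shows "positive_part \<sigma> = point_masses S (\<lambda>s. max 0 (\<sigma> {s}))"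
proof -
  define w where "w = (\<lambda>s. max 0 (\<sigma> {s}))"
  have eq: "(SUP B \<in> {B \<in> bounded_borel. B \<subseteq> A}. ennreal (\<sigma> B)) = emeasure (point_masses S w) A"
    if A: "A \<in> sets borel" for A
  proof (rule antisym)
    show "(SUP B \<in> {B \<in> bounded_borel. B \<subseteq> A}. ennreal (\<sigma> B)) \<le> emeasure (point_masses S w) A"
      unfolding emeasure_point_masses[OF A]
    proof (rule SUP_least)
      fix B assume "B \<in> {B \<in> bounded_borel. B \<subseteq> A}"
      then have B: "B \<in> bounded_borel" "B \<subseteq> A" by auto
      have "((\<lambda>F. ennreal (\<Sum>s\<in>F. \<sigma> {s})) \<longlongrightarrow> ennreal (\<sigma> B)) (finite_subsets_at_top (S \<inter> B))"
        using at[OF B(1)] unfolding has_sum_def by (intro tendsto_ennrealI)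
      moreover have "\<forall>\<^sub>F F in finite_subsets_at_top (S \<inter> B). ennreal (\<Sum>s\<in>F. \<sigma> {s}) \<le> (\<integral>\<^sup>+s. ennreal (w s) \<partial>count_space (S \<inter> A))"
      proof (rule eventually_finite_subsets_at_top_weakI)
        fix F assume F: "finite F" "F \<subseteq> S \<inter> B"
        have "ennreal (\<Sum>s\<in>F. \<sigma> {s}) \<le> ennreal (\<Sum>s\<in>F. w s)"
          by (intro ennreal_leI sum_mono) (simp add: w_def)
        also have "\<dots> = (\<integral>\<^sup>+s. ennreal (w s) \<partial>count_space F)"
          unfolding nn_integral_count_space_finite[OF F(1)] by (rule sum_ennreal[symmetric]) (simp add: w_def)
        also have "\<dots> = (\<integral>\<^sup>+s. ennreal (w s) * indicator F s \<partial>count_space (S \<inter> A))"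
          using F B by (intro count_space_restrict[symmetric]) auto
        also have "\<dots> \<le> (\<integral>\<^sup>+s. ennreal (w s) \<partial>count_space (S \<inter> A))"
          by (intro nn_integral_mono) (auto split: split_indicator)
        finally show "ennreal (\<Sum>s\<in>F. \<sigma> {s}) \<le> (\<integral>\<^sup>+s. ennreal (w s) \<partial>count_space (S \<inter> A))" .
      qed
      ultimately show "ennreal (\<sigma> B) \<le> (\<integral>\<^sup>+s. ennreal (w s) \<partial>count_space (S \<inter> A))"
        by (rule tendsto_upperbound) simp
    qed
    show "emeasure (point_masses S w) A \<le> (SUP B \<in> {B \<in> bounded_borel. B \<subseteq> A}. ennreal (\<sigma> B))"
      unfolding emeasure_point_masses[OF A]
    proof (rule nn_integral_count_space_le)
      show "countable (S \<inter> A)" using S by blast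
      fix F assume F: "finite F" "F \<subseteq> S \<inter> A"
      define P where "P = {s\<in>F. \<sigma> {s} > 0}"
      have P: "finite P" "P \<subseteq> S \<inter> A" "P \<in> bounded_borel"
        using F by (auto simp: P_def bounded_borel_def finite_imp_bounded intro!: borel_closed finite_imp_closed)
      have "(\<Sum>s\<in>F. ennreal (w s)) = ennreal (\<Sum>s\<in>F. w s)" by (rule sum_ennreal) (simp add: w_def)
      also have "(\<Sum>s\<in>F. w s) = (\<Sum>s\<in>P. \<sigma> {s})"
        using F by (intro sum.mono_neutral_cong_right) (auto simp: P_def w_def)
      also have "\<dots> = \<sigma> P"
      proof -
        have "((\<lambda>s. \<sigma> {s}) has_sum \<sigma> P) P" using at[OF P(3)] P(2) by (simp add: Int_absorb1)
        then show ?thesis using P(1) by (metis has_sum_finite_iff)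
      qed
      also have "ennreal (\<sigma> P) \<le> (SUP B \<in> {B \<in> bounded_borel. B \<subseteq> A}. ennreal (\<sigma> B))"
        using P by (intro SUP_upper) auto
      finally show "(\<Sum>s\<in>F. ennreal (w s)) \<le> (SUP B \<in> {B \<in> bounded_borel. B \<subseteq> A}. ennreal (\<sigma> B))" .
    qed
  qed
  have "positive_part \<sigma> = measure_of UNIV (sets borel) (emeasure (point_masses S w))"
    unfolding positive_part_def
    by (rule measure_of_eq) (auto simp: eq sets.sigma_sets_eq[of borel, simplified])
  also have "\<dots> = point_masses S w"
    using measure_of_of_measure[of "point_masses S w"] by (simp add: point_masses_def)
  finally show ?thesis by (simp add: w_def)
qed

lemma integral_point_masses:
  fixes f :: "'a::euclidean_space \<Rightarrow> complex"
  assumes f [measurable]: "f \<in> borel_measurable borel" and w: "\<And>s. w s \<ge> 0"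
    and sum: "(\<lambda>s. w s * cmod (f s)) summable_on S"
  shows "((\<lambda>s. of_real (w s) * f s) has_sum integral\<^sup>L (point_masses S w) f) S"
proof -
  have abs: "Infinite_Sum.abs_summable_on (\<lambda>s. of_real (w s) * f s) S"
    using sum w by (simp add: norm_mult)
  have "integral\<^sup>L (point_masses S w) f = (LINT s|count_space S. of_real (w s) * f s)"
    unfolding point_masses_def
    by (subst integral_distr) (auto simp: integral_density w scaleR_conv_of_real)
  also have "\<dots> = infsum (\<lambda>s. of_real (w s) * f s) S"
    using infsetsum_infsum[of "\<lambda>s. of_real (w s) * f s" S] abs abs_summable_equivalent
    by (auto simp: infsetsum_def)
  finally show ?thesis using abs_summable_summable[OF abs] by simp
qed

lemma atomic_on_outside:
  assumes "atomic_on \<nu> S" "x \<notin> S"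
  shows "\<nu> {x} = 0"
proof -
  have "{x} \<in> bounded_borel" by (simp add: bounded_borel_def)
  then have "((\<lambda>s. \<nu> {s}) has_sum \<nu> {x}) {}" using assms unfolding atomic_on_def by fastforce
  then show ?thesis by (simp add: has_sum_finite_iff)
qed

text \<open>The weights of the four Jordan parts are all dominated by
  \<open>cmod (\<nu> {s})\<close>, so one summability assumption serves for each of them.\<close>

lemma integral_wrt_atomic:
  fixes \<nu> :: "'a::euclidean_space set \<Rightarrow> complex"
  assumes S: "countable S" and at: "atomic_on \<nu> S"
    and f: "f \<in> borel_measurable borel"
    and sum: "(\<lambda>s. cmod (\<nu> {s}) * cmod (f s)) summable_on S"
  shows "((\<lambda>s. \<nu> {s} * f s) has_sum integral_wrt \<nu> f) S"
proof -
  have *: "((\<lambda>s. of_real (max 0 (g (\<nu> {s}))) * f s) has_sum integral\<^sup>L (positive_part (\<lambda>A. g (\<nu> A))) f) S"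
    if g: "\<And>A. A \<in> bounded_borel \<Longrightarrow> ((\<lambda>s. g (\<nu> {s})) has_sum g (\<nu> A)) (S \<inter> A)" "\<And>z. \<bar>g z\<bar> \<le> cmod z" for g :: "complex \<Rightarrow> real"
  proof -
    have "(\<lambda>s. max 0 (g (\<nu> {s})) * cmod (f s)) summable_on S"
    proof (rule summable_on_comparison_test[OF sum])
      show "max 0 (g (\<nu> {s})) * cmod (f s) \<le> cmod (\<nu> {s}) * cmod (f s)" for s
        using g(2)[of "\<nu> {s}"] by (intro mult_right_mono) auto
    qed simp
    then show ?thesis
      unfolding positive_part_atomic[of S "\<lambda>A. g (\<nu> A)", OF S g(1), simplified]
      by (intro integral_point_masses f) auto
  qed
  have diff: "((\<lambda>s. g s - h s) has_sum a - b) S" if "(g has_sum a) S" "(h has_sum b) S" for g h :: "'a \<Rightarrow> complex" and a b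
    using has_sum_add[OF that(1), of "\<lambda>s. - h s" "- b"] that(2) by (simp add: has_sum_uminus)
  have "((\<lambda>s. (of_real (max 0 (Re (\<nu> {s}))) * f s - of_real (max 0 (- Re (\<nu> {s}))) * f s) +
      \<i> * (of_real (max 0 (Im (\<nu> {s}))) * f s - of_real (max 0 (- Im (\<nu> {s}))) * f s)) has_sum integral_wrt \<nu> f) S"
    unfolding integral_wrt_def using at unfolding atomic_on_def
    by (intro has_sum_add diff has_sum_cmult_right *)
      (auto intro!: has_sum_Re has_sum_Im simp: has_sum_uminus abs_Re_le_cmod abs_Im_le_cmod)
  moreover have "(of_real (max 0 (Re z)) * y - of_real (max 0 (- Re z)) * y) +
      \<i> * (of_real (max 0 (Im z)) * y - of_real (max 0 (- Im z)) * y) = z * y" for z y :: complex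
    by (auto simp: complex_eq_iff max_def)
  ultimately show ?thesis by simp
qed

section \<open>Growth and summability of atoms\<close>

lemma slowly_increasing_atoms:
  fixes \<nu> :: "'a::euclidean_space set \<Rightarrow> complex"
  assumes "slowly_increasing \<nu>"
  obtains C :: real and N :: nat where "C \<ge> 0"
    "\<And>F R. \<lbrakk>finite F; F \<subseteq> ball 0 R; R \<ge> 1\<rbrakk> \<Longrightarrow> (\<Sum>s\<in>F. cmod (\<nu> {s})) \<le> C * R ^ N"
proof -
  obtain N :: nat and C :: real and R0 where R0: "\<And>R. R \<ge> R0 \<Longrightarrow> total_variation \<nu> (ball 0 R) \<le> ennreal (C * R ^ N)"
    using assms unfolding slowly_increasing_def eventually_at_top_linorder by blast
  \<comment> \<open>The growth bound is known only from \<open>R0\<close> on. Enlarging every radius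
    by the factor \<open>max 1 R0\<close> makes it valid from radius 1, at the cost of a
    constant.\<close>
  define D where "D = \<bar>C\<bar> * (max 1 R0) ^ N"
  show ?thesis
  proof
    show "D \<ge> 0" by (simp add: D_def)
    fix F :: "'a set" and R :: real assume F: "finite F" "F \<subseteq> ball 0 R" and R: "R \<ge> 1"
    define R' where "R' = max 1 R0 * R"
    have R': "R' \<ge> R" "R' \<ge> R0" "R' \<ge> 0"
      using mult_right_mono[of 1 "max 1 R0" R] mult_left_mono[of 1 R "max 1 R0"] R by (auto simp: R'_def)
    have "ennreal (\<Sum>s\<in>F. cmod (\<nu> {s})) = (\<Sum>B\<in>(\<lambda>s. {s}) ` F. ennreal (cmod (\<nu> B)))"
      by (subst sum.reindex) (auto simp: sum_ennreal)
    also have "\<dots> \<le> total_variation \<nu> (ball 0 R')"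
      unfolding total_variation_def
    proof (rule SUP_upper, clarsimp, intro conjI)
      show "disjoint ((\<lambda>s. {s}) ` F)" by (auto simp: disjoint_def)
      show "(\<lambda>s. {s}) ` F \<subseteq> bounded_borel" by (auto simp: bounded_borel_def)
      show "F \<subseteq> ball 0 R'" using F R' by force
    qed (use F in auto)
    also have "\<dots> \<le> ennreal (C * R' ^ N)" by (rule R0[OF R'(2)])
    also have "\<dots> \<le> ennreal (D * R ^ N)"
    proof (rule ennreal_leI)
      have "C * R' ^ N \<le> \<bar>C\<bar> * R' ^ N" using R' by (intro mult_right_mono) auto
      then show "C * R' ^ N \<le> D * R ^ N" by (simp add: D_def R'_def power_mult_distrib mult.assoc)
    qed
    finally show "(\<Sum>s\<in>F. cmod (\<nu> {s})) \<le> D * R ^ N"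
      using R by (subst (asm) ennreal_le_iff) (auto simp: D_def)
  qed
qed

text \<open>The atoms in the shell between the radii k and k + 1 have total mass of polynomial order
  in k, which the exponential beats.\<close>

lemma summable_exp_norm_atoms:
  fixes \<nu> :: "'a::euclidean_space set \<Rightarrow> complex"
  assumes "slowly_increasing \<nu>"
  shows "(\<lambda>s. cmod (\<nu> {s}) * exp (- norm s)) summable_on S"
proof -
  obtain C N where C: "C \<ge> 0"
    "\<And>F R. \<lbrakk>finite F; F \<subseteq> ball 0 R; R \<ge> 1\<rbrakk> \<Longrightarrow> (\<Sum>s\<in>F. cmod (\<nu> {s})) \<le> C * R ^ N"
    using slowly_increasing_atoms[OF assms] by blast
  define t where "t = (\<lambda>k::nat. C * (real k + 1) ^ N * exp (- real k))"
  have "summable (\<lambda>k::nat. (real k + 1) ^ N * exp (- real k))"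
  proof (rule summable_comparison_test_bigo)
    show "summable (\<lambda>k. norm (1 / real k ^ 2))" using inverse_power_summable[of 2, where 'a=real] by (simp add: field_simps)
    show "(\<lambda>k. (real k + 1) ^ N * exp (- real k)) \<in> O(\<lambda>k. 1 / real k ^ 2)" by real_asymp
  qed
  then have t: "summable t" unfolding t_def using summable_mult by (simp add: mult.assoc)
  have t0: "t k \<ge> 0" for k using C(1) by (simp add: t_def)
  have bnd: "(\<Sum>s\<in>F. cmod (\<nu> {s}) * exp (- norm s)) \<le> suminf t" if F: "finite F" for F
  proof -
    define h where "h = (\<lambda>s::'a. nat \<lfloor>norm s\<rfloor>)"
    have h: "real (h s) \<le> norm s" "norm s < real (h s) + 1" for s by (auto simp: h_def)
    have "(\<Sum>s\<in>F. cmod (\<nu> {s}) * exp (- norm s)) = (\<Sum>k\<in>h ` F. \<Sum>s\<in>{s\<in>F. h s = k}. cmod (\<nu> {s}) * exp (- norm s))"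
      by (rule sum.image_gen[OF F])
    also have "\<dots> \<le> (\<Sum>k\<in>h ` F. t k)"
    proof (rule sum_mono)
      fix k
      have "(\<Sum>s\<in>{s\<in>F. h s = k}. cmod (\<nu> {s}) * exp (- norm s)) \<le> (\<Sum>s\<in>{s\<in>F. h s = k}. cmod (\<nu> {s}) * exp (- real k))"
        using h by (intro sum_mono mult_left_mono) auto
      also have "\<dots> = (\<Sum>s\<in>{s\<in>F. h s = k}. cmod (\<nu> {s})) * exp (- real k)" by (simp add: sum_distrib_right)
      also have "\<dots> \<le> C * (real k + 1) ^ N * exp (- real k)"
        using F h by (intro mult_right_mono C(2)) auto
      finally show "(\<Sum>s\<in>{s\<in>F. h s = k}. cmod (\<nu> {s}) * exp (- norm s)) \<le> t k" by (simp add: t_def)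
    qed
    also have "\<dots> \<le> suminf t" using F t t0 by (intro sum_le_suminf) auto
    finally show ?thesis .
  qed
  show ?thesis
    by (rule nonneg_bounded_partial_sums_imp_summable_on[where C = "suminf t"])
      (auto intro!: eventually_finite_subsets_at_top_weakI bnd)
qed

lemma summable_gaussian_atoms:
  fixes \<nu> :: "'a::euclidean_space set \<Rightarrow> complex"
  assumes "slowly_increasing \<nu>" and a: "a > 0"
  shows "(\<lambda>s. cmod (\<nu> {s}) * cmod (gaussian a x l s)) summable_on S"
proof (rule summable_on_comparison_test)
  \<comment> \<open>The constant comes from completing the square:
    \<open>pi * a * u\<^sup>2 - u + 1 / (4 * pi * a)\<close> is a square.\<close>
  define K where "K = exp (norm x + 1 / (4 * pi * a))"
  show "(\<lambda>s. K * (cmod (\<nu> {s}) * exp (- norm s))) summable_on S"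
    by (intro summable_on_cmult_right summable_exp_norm_atoms assms)
  show "cmod (\<nu> {s}) * cmod (gaussian a x l s) \<le> K * (cmod (\<nu> {s}) * exp (- norm s))" for s
  proof -
    define u where "u = norm (s - x)"
    have "0 \<le> (sqrt (pi * a) * u - 1 / (2 * sqrt (pi * a)))\<^sup>2" by simp
    also have "\<dots> = pi * a * u\<^sup>2 - u + 1 / (4 * pi * a)"
      using a by (simp add: power2_diff power_mult_distrib power_divide)
    finally have "- pi * a * u\<^sup>2 \<le> - u + 1 / (4 * pi * a)" by simp
    moreover have "norm s \<le> u + norm x" using norm_triangle_ineq[of "s - x" x] by (simp add: u_def)
    ultimately have "- pi * a * u\<^sup>2 \<le> (norm x + 1 / (4 * pi * a)) + - norm s" by linarith
    then have "cmod (gaussian a x l s) \<le> K * exp (- norm s)"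
      unfolding norm_gaussian K_def exp_add[symmetric] u_def by simp
    then have "cmod (\<nu> {s}) * cmod (gaussian a x l s) \<le> cmod (\<nu> {s}) * (K * exp (- norm s))"
      by (intro mult_left_mono) auto
    then show ?thesis by (simp add: mult_ac)
  qed
qed simp

lemma gaussian_has_sum:
  fixes \<nu> :: "'a::euclidean_space set \<Rightarrow> complex"
  assumes "slowly_increasing \<nu>" "countable S" "atomic_on \<nu> S" "a > 0"
  shows "((\<lambda>s. \<nu> {s} * gaussian a x l s) has_sum integral_wrt \<nu> (gaussian a x l)) S"
  by (rule integral_wrt_atomic) (use assms summable_gaussian_atoms in auto)

text \<open>Comparison with an integral: on each of the disjoint balls \<open>ball l r\<close> the
  wider Gaussian \<open>G\<close> with parameter \<open>a / 2\<close> is at least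
  \<open>exp (- pi)\<close> times the value of the original Gaussian at the centre. The bound is
  uniform in \<open>x\<close>, and its order in \<open>a\<close> is the one that the normalisation
  of the Fourier transform cancels later.\<close>

lemma gaussian_sum_separated:
  fixes \<Lambda> :: "'a::euclidean_space set"
  assumes d: "d > 0" "\<And>x y. \<lbrakk>x \<in> \<Lambda>; y \<in> \<Lambda>; x \<noteq> y\<rbrakk> \<Longrightarrow> dist x y \<ge> d"
  obtains C where "C > 0"
    "\<And>F a x. \<lbrakk>finite F; F \<subseteq> \<Lambda>; 0 < a; a \<le> 1\<rbrakk> \<Longrightarrow> (\<Sum>l\<in>F. exp (- pi * a * (norm (l - x))\<^sup>2)) \<le> C * (1 / sqrt a) ^ DIM('a)"
proof -
  \<comment> \<open>Half of \<open>d\<close> makes the balls disjoint; the cap bounds the loss in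
    the exponent.\<close>
  define r where "r = min d 1 / 2"
  have r: "r > 0" "r \<le> 1" "2 * r \<le> d" using d by (auto simp: r_def)
  define v where "v = measure lborel (ball (0::'a) r)"
  have vball: "measure lborel (ball x r) = v" for x :: 'a
    unfolding v_def using content_ball_conv_unit_ball[of r x] content_ball_conv_unit_ball[of r "0::'a"] r
    by simp
  have v: "v > 0" unfolding v_def using content_ball_pos[OF r(1), of "0::'a"] .
  define C where "C = exp pi * sqrt 2 ^ DIM('a) / v"
  show ?thesis
  proof
    show "C > 0" using v by (simp add: C_def)
    fix F a and x :: 'a assume F: "finite F" "F \<subseteq> \<Lambda>" and a: "0 < a" "a \<le> (1::real)"
    define G where "G = (\<lambda>y. exp (- pi * (a / 2) * (norm (y - x))\<^sup>2))"
    have a2: "a / 2 > 0" using a by simp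
    note G = gaussian_integral_real[OF a2, of x, folded G_def]
    have Gs: "set_integrable lborel A G" if "A \<in> sets borel" for A
      unfolding set_integrable_def using G(1) that by (intro integrable_mult_indicator) auto
    have one: "v * exp (- pi * a * (norm (l - x))\<^sup>2) \<le> exp pi * (LINT y:ball l r|lborel. G y)" for l
    proof -
      have "exp (- pi * a * (norm (l - x))\<^sup>2) \<le> exp pi * G y" if "y \<in> ball l r" for y
      proof -
        have "norm (y - x) \<le> r + norm (l - x)"
          using that norm_triangle_ineq[of "y - l" "l - x"] by (simp add: dist_norm norm_minus_commute)
        then have "(norm (y - x))\<^sup>2 \<le> (r + norm (l - x))\<^sup>2" by (intro power_mono) auto
        also have "\<dots> \<le> 2 * r\<^sup>2 + 2 * (norm (l - x))\<^sup>2"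
          using zero_le_power2[of "r - norm (l - x)"] by (simp add: power2_eq_square algebra_simps)
        also have "r\<^sup>2 \<le> 1" using r by (simp add: power_le_one)
        finally have "(norm (y - x))\<^sup>2 \<le> 2 + 2 * (norm (l - x))\<^sup>2" by simp
        then have "pi * (a / 2) * (norm (y - x))\<^sup>2 \<le> pi * (a / 2) * (2 + 2 * (norm (l - x))\<^sup>2)"
          using a by (intro mult_left_mono) auto
        also have "\<dots> = pi * a + pi * a * (norm (l - x))\<^sup>2" by (simp add: algebra_simps)
        finally have "pi * (a / 2) * (norm (y - x))\<^sup>2 \<le> pi * a + pi * a * (norm (l - x))\<^sup>2" .
        moreover have "pi * a \<le> pi * 1" using a by (intro mult_left_mono) auto
        ultimately have "- (pi * a * (norm (l - x))\<^sup>2) \<le> pi + - (pi * (a / 2) * (norm (y - x))\<^sup>2)" by linarith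
        then have "- pi * a * (norm (l - x))\<^sup>2 \<le> pi + - pi * (a / 2) * (norm (y - x))\<^sup>2"
          by (simp only: minus_mult_left)
        then show ?thesis unfolding G_def exp_add[symmetric] by (simp only: exp_le_cancel_iff)
      qed
      then have "(LINT y:ball l r|lborel. exp (- pi * a * (norm (l - x))\<^sup>2)) \<le> (LINT y:ball l r|lborel. exp pi * G y)"
        by (intro set_integral_mono set_integrable_mult_right Gs)
          (auto simp: set_integrable_def integrable_indicator_iff emeasure_lborel_ball_finite[unfolded infinity_ennreal_def])
      moreover have "(LINT y:ball l r|lborel. exp (- pi * a * (norm (l - x))\<^sup>2)) = v * exp (- pi * a * (norm (l - x))\<^sup>2)"
        by (simp add: set_lebesgue_integral_def vball[of l])
      moreover have "(LINT y:ball l r|lborel. exp pi * G y) = exp pi * (LINT y:ball l r|lborel. G y)" by simp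
      ultimately show ?thesis by (simp only:)
    qed
    have "v * (\<Sum>l\<in>F. exp (- pi * a * (norm (l - x))\<^sup>2)) \<le> exp pi * (\<Sum>l\<in>F. LINT y:ball l r|lborel. G y)"
      unfolding sum_distrib_left by (intro sum_mono one)
    also have "(\<Sum>l\<in>F. LINT y:ball l r|lborel. G y) = (LINT y:(\<Union>l\<in>F. ball l r)|lborel. G y)"
    proof (rule set_integral_finite_Union[symmetric])
      show "disjoint_family_on (\<lambda>l. ball l r) F"
        unfolding disjoint_family_on_def
      proof (intro ballI impI)
        fix l m assume lm: "l \<in> F" "m \<in> F" "l \<noteq> m"
        then have "2 * r \<le> dist l m" using d(2) F r by fastforce
        then show "ball l r \<inter> ball m r = {}" using disjoint_ballI[of r r l m] by simp
      qed
    qed (use F Gs in auto)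
    also have "\<dots> \<le> integral\<^sup>L lborel G"
      unfolding set_lebesgue_integral_def
      by (intro integral_mono G integrable_mult_indicator) (auto simp: G_def indicator_def intro!: borel_open open_UN)
    also have "\<dots> = sqrt 2 ^ DIM('a) * (1 / sqrt a) ^ DIM('a)"
      unfolding G using a by (simp add: real_sqrt_divide power_divide)
    finally have "v * (\<Sum>l\<in>F. exp (- pi * a * (norm (l - x))\<^sup>2)) \<le> exp pi * (sqrt 2 ^ DIM('a) * (1 / sqrt a) ^ DIM('a))"
      by simp
    then show "(\<Sum>l\<in>F. exp (- pi * a * (norm (l - x))\<^sup>2)) \<le> C * (1 / sqrt a) ^ DIM('a)"
      using v by (simp only: C_def times_divide_eq_left pos_le_divide_eq mult.assoc mult.commute[of v])
  qed
qed

section \<open>Bounds for the atoms of a Fourier pair\<close>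

locale atomic_fourier_pair =
  fixes \<mu> \<nu> :: "(real ^ 'n) set \<Rightarrow> complex" and \<Lambda> S :: "(real ^ 'n) set" and d :: real
  assumes \<mu>: "slowly_increasing \<mu>" "countable \<Lambda>" "atomic_on \<mu> \<Lambda>"
    and \<nu>: "slowly_increasing \<nu>" "countable S" "atomic_on \<nu> S"
    and ft: "has_fourier_transform \<mu> \<nu>"
    and d: "d > 0" "\<And>x y. \<lbrakk>x \<in> \<Lambda>; y \<in> \<Lambda>; x \<noteq> y\<rbrakk> \<Longrightarrow> dist x y \<ge> d"
begin

lemma gaussian_fourier_sums:
  assumes a: "a > 0"
  obtains T where "((\<lambda>x. \<nu> {x} * gaussian a s l x) has_sum T) S"
    "((\<lambda>x. \<mu> {x} * fourier (gaussian a s l) x) has_sum T) \<Lambda>"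
proof
  define \<kappa> where "\<kappa> = of_real ((1 / sqrt a) ^ CARD('n)) * exp (2 * of_real pi * \<i> * of_real (s \<bullet> l))"
  have fg: "fourier (gaussian a s l) = (\<lambda>t. \<kappa> * gaussian (1 / a) l (- s) t)"
    by (rule ext) (simp only: fourier_gaussian[OF a] \<kappa>_def mult_ac)
  show "((\<lambda>x. \<nu> {x} * gaussian a s l x) has_sum integral_wrt \<nu> (gaussian a s l)) S"
    by (rule gaussian_has_sum[OF \<nu> a])
  have "((\<lambda>x. \<mu> {x} * (\<kappa> * gaussian (1 / a) l (- s) x)) has_sum integral_wrt \<mu> (\<lambda>x. \<kappa> * gaussian (1 / a) l (- s) x)) \<Lambda>"
  proof (rule integral_wrt_atomic[OF \<mu>(2,3)])
    have "(\<lambda>x. cmod \<kappa> * (cmod (\<mu> {x}) * cmod (gaussian (1 / a) l (- s) x))) summable_on \<Lambda>"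
      using a by (intro summable_on_cmult_right summable_gaussian_atoms \<mu>) auto
    then show "(\<lambda>x. cmod (\<mu> {x}) * cmod (\<kappa> * gaussian (1 / a) l (- s) x)) summable_on \<Lambda>"
      by (simp add: norm_mult mult_ac)
  qed measurable
  also have "integral_wrt \<mu> (\<lambda>x. \<kappa> * gaussian (1 / a) l (- s) x) = integral_wrt \<nu> (gaussian a s l)"
    using ft schwartz_gaussian[OF a, of s l] unfolding has_fourier_transform_def fg[symmetric] by simp
  finally show "((\<lambda>x. \<mu> {x} * fourier (gaussian a s l) x) has_sum integral_wrt \<nu> (gaussian a s l)) \<Lambda>"
    by (simp only: fg)
qed

text \<open>Pairing \<open>\<mu>\<close> with a Gaussian centred at \<open>l\<close> amounts to
  pairing \<open>\<nu>\<close> with a Gaussian of fixed centre that is only modulated by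
  \<open>l\<close>. Its absolute value does not depend on \<open>l\<close>, whence the uniform bound
  \<open>D\<close>. If the Gaussian is narrow, separation makes the atom at \<open>l\<close>
  dominate the others up to half of the supremum, and this half is absorbed.\<close>

lemma atoms_bounded:
  obtains M where "\<And>l. l \<in> \<Lambda> \<Longrightarrow> cmod (\<mu> {l}) \<le> M"
proof -
  obtain C where C: "C > 0"
    "\<And>F a x. \<lbrakk>finite F; F \<subseteq> \<Lambda>; 0 < a; a \<le> 1\<rbrakk> \<Longrightarrow> (\<Sum>l\<in>F. exp (- pi * a * (norm (l - x))\<^sup>2)) \<le> C * (1 / sqrt a) ^ CARD('n)"
    using gaussian_sum_separated[OF d] by auto
  \<comment> \<open>\<open>exp (- L)\<close> is the factor that brings the contribution of all other
    atoms below one half.\<close>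
  define L where "L = max 0 (ln (2 * C))"
  \<comment> \<open>Chosen such that \<open>pi * (\<beta> - 1) * u\<^sup>2 - u \<ge> L\<close> for
    all \<open>u \<ge> d\<close>: the surplus over the parameter 1 pays for \<open>exp u\<close> and
    still leaves \<open>exp (- L)\<close>.\<close>
  define \<beta> where "\<beta> = 1 + (1 + L / d) / (pi * d)"
  have L: "exp (- L) * C \<le> 1 / 2"
  proof -
    have "2 * C = exp (ln (2 * C))" using C by simp
    also have "\<dots> \<le> exp L" by (simp add: L_def)
    finally show ?thesis by (simp add: exp_minus field_simps)
  qed
  have \<beta>: "\<beta> \<ge> 1" "pi * (\<beta> - 1) * d - 1 = L / d" "\<beta> > 0"
    using d by (auto simp: \<beta>_def L_def add_pos_nonneg)
  \<comment> \<open>The factor \<open>exp (norm (m - l))\<close> bounds the change of the weight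
    \<open>exp (- e * norm l)\<close> between the two points as long as
    \<open>e \<le> 1\<close>.\<close>
  have near: "exp (- pi * \<beta> * (norm (m - l))\<^sup>2) * exp (norm (m - l)) \<le> exp (- L) * exp (- pi * 1 * (norm (m - l))\<^sup>2)"
    if "l \<in> \<Lambda>" "m \<in> \<Lambda>" "m \<noteq> l" for l m
  proof -
    define u where "u = norm (m - l)"
    have u: "u \<ge> d" using d(2)[OF that(2,1,3)] by (simp add: u_def dist_norm)
    have "L = d * (pi * (\<beta> - 1) * d - 1)" using \<beta> d by simp
    also have "\<dots> \<le> u * (pi * (\<beta> - 1) * u - 1)"
    proof (rule mult_mono[OF u])
      have "pi * (\<beta> - 1) * d \<le> pi * (\<beta> - 1) * u" using u \<beta> by (intro mult_left_mono) auto
      then show "pi * (\<beta> - 1) * d - 1 \<le> pi * (\<beta> - 1) * u - 1" by simp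
      show "0 \<le> pi * (\<beta> - 1) * d - 1" using \<beta> d by (simp add: L_def)
    qed (use u d in auto)
    finally have "- pi * \<beta> * u\<^sup>2 + u \<le> - L + - pi * 1 * u\<^sup>2"
      by (simp add: power2_eq_square algebra_simps)
    then show ?thesis unfolding u_def exp_add[symmetric] by (simp only: exp_le_cancel_iff)
  qed
  define a where "a = 1 / \<beta>"
  have a: "a > 0" "1 / a = \<beta>" using \<beta> by (auto simp: a_def)
  define \<kappa> where "\<kappa> = (1 / sqrt a) ^ CARD('n)"
  have \<kappa>: "\<kappa> > 0" using a by (simp add: \<kappa>_def)
  define D where "D = (\<Sum>\<^sub>\<infinity>x\<in>S. cmod (\<nu> {x}) * exp (- pi * a * (norm x)\<^sup>2)) / \<kappa>"
  have D0: "D \<ge> 0" unfolding D_def using \<kappa> by (intro divide_nonneg_pos infsum_nonneg) auto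
  have convolution: "cmod z \<le> D" if "((\<lambda>x. \<mu> {x} * gaussian \<beta> l 0 x) has_sum z) \<Lambda>" for l z
  proof -
    obtain T where T: "((\<lambda>x. \<nu> {x} * gaussian a 0 l x) has_sum T) S"
      "((\<lambda>x. \<mu> {x} * fourier (gaussian a 0 l) x) has_sum T) \<Lambda>"
      using gaussian_fourier_sums[OF a(1)] by blast
    have "((\<lambda>x. of_real \<kappa> * (\<mu> {x} * gaussian \<beta> l 0 x)) has_sum T) \<Lambda>"
      using T(2) unfolding fourier_gaussian[OF a(1)] by (simp add: a(2) \<kappa>_def mult_ac)
    moreover have "((\<lambda>x. of_real \<kappa> * (\<mu> {x} * gaussian \<beta> l 0 x)) has_sum of_real \<kappa> * z) \<Lambda>"
      by (rule has_sum_cmult_right[OF that])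
    ultimately have Tz: "T = of_real \<kappa> * z" using has_sum_unique by blast
    have n: "cmod (\<nu> {x} * gaussian a 0 l x) = cmod (\<nu> {x}) * exp (- pi * a * (norm x)\<^sup>2)" for x
      by (simp add: norm_mult norm_gaussian)
    have "Infinite_Sum.abs_summable_on (\<lambda>x. \<nu> {x} * gaussian a 0 l x) S"
      using summable_gaussian_atoms[OF \<nu>(1) a(1), of 0 l S] by (simp add: norm_mult)
    then have "cmod (infsum (\<lambda>x. \<nu> {x} * gaussian a 0 l x) S) \<le> (\<Sum>\<^sub>\<infinity>x\<in>S. cmod (\<nu> {x} * gaussian a 0 l x))"
      by (rule norm_infsum_bound)
    then have "cmod T \<le> D * \<kappa>" unfolding n using infsumI[OF T(1)] \<kappa> by (simp add: D_def)
    then show ?thesis using \<kappa> unfolding Tz by (simp add: norm_mult mult.commute)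
  qed
  obtain C' N where C': "C' \<ge> 0"
    "\<And>F R. \<lbrakk>finite F; F \<subseteq> ball 0 R; R \<ge> 1\<rbrakk> \<Longrightarrow> (\<Sum>s\<in>F. cmod (\<mu> {s})) \<le> C' * R ^ N"
    using slowly_increasing_atoms[OF \<mu>(1)] by blast
  have growth: "cmod (\<mu> {l}) \<le> C' * (1 + norm l) ^ N" for l
    using C'(2)[of "{l}" "1 + norm l"] by simp
  \<comment> \<open>The weight only makes the supremum finite: the bound is uniform in \<open>e\<close>, which then tends to \<open>0\<close>.\<close>
  have weighted: "cmod (\<mu> {l}) * exp (- e * norm l) \<le> 2 * D" if e: "0 < e" "e \<le> 1" and l: "l \<in> \<Lambda>" for e l
  proof -
    define W where "W = (\<lambda>l. cmod (\<mu> {l}) * exp (- e * norm l))"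
    obtain P where P: "\<And>t. t \<ge> 0 \<Longrightarrow> (1 + t) ^ N * exp (- e * t) \<le> P"
    proof (rule bounded_above_of_tendsto_0)
      show "((\<lambda>t. (1 + t) ^ N * exp (- e * t)) \<longlongrightarrow> 0) at_top" using e by real_asymp
    qed (auto intro!: continuous_intros)
    have "W l \<le> C' * P" for l
    proof -
      have "W l \<le> C' * (1 + norm l) ^ N * exp (- e * norm l)"
        unfolding W_def by (intro mult_right_mono growth) auto
      also have "\<dots> \<le> C' * P"
        unfolding mult.assoc using C'(1) P[of "norm l"] by (intro mult_left_mono) auto
      finally show ?thesis .
    qed
    then have bdd: "bdd_above (W ` \<Lambda>)" by (auto intro!: bdd_aboveI)
    define m where "m = Sup (W ` \<Lambda>)"
    have Wm: "W l \<le> m" if "l \<in> \<Lambda>" for l unfolding m_def using bdd that by (auto intro: cSup_upper)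
    have m0: "m \<ge> 0" using Wm[OF l] by (simp add: W_def order_trans[rotated])
    have step: "W k \<le> D + m / 2" if k: "k \<in> \<Lambda>" for k
    proof -
      define E where "E = (\<lambda>a x. exp (- pi * a * (norm (x - k))\<^sup>2))"
      let ?f = "\<lambda>x. \<mu> {x} * gaussian \<beta> k 0 x"
      have hs: "(?f has_sum integral_wrt \<mu> (gaussian \<beta> k 0)) \<Lambda>"
        by (rule gaussian_has_sum[OF \<mu> \<beta>(3)])
      have low: "cmod (sum ?f F) \<ge> cmod (\<mu> {k}) - m / 2 * exp (e * norm k)" if F: "finite F" "F \<subseteq> \<Lambda>" "k \<in> F" for F
      proof -
        have "sum ?f F = \<mu> {k} + sum ?f (F - {k})" using F by (simp add: sum.remove gaussian_def)
        moreover have "cmod (sum ?f (F - {k})) \<le> m / 2 * exp (e * norm k)"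
        proof -
          have "cmod (sum ?f (F - {k})) \<le> (\<Sum>x\<in>F - {k}. m * exp (e * norm k) * exp (- L) * E 1 x)"
          proof (rule sum_norm_le)
            fix x assume x: "x \<in> F - {k}"
            have "cmod (\<mu> {x}) \<le> m * exp (e * norm x)"
              using Wm[of x] x F by (auto simp: W_def exp_minus field_simps)
            also have "\<dots> \<le> m * (exp (e * norm k) * exp (norm (x - k)))"
            proof -
              have "norm x \<le> norm k + norm (x - k)" using norm_triangle_ineq[of k "x - k"] by simp
              then have "e * norm x \<le> e * (norm k + norm (x - k))" using e by (intro mult_left_mono) auto
              moreover have "e * norm (x - k) \<le> 1 * norm (x - k)" using e by (intro mult_right_mono) auto
              ultimately have "e * norm x \<le> e * norm k + norm (x - k)" by (simp add: algebra_simps)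
              then show ?thesis using m0 unfolding exp_add[symmetric] by (intro mult_left_mono) auto
            qed
            finally have "cmod (\<mu> {x}) * E \<beta> x
              \<le> m * (exp (e * norm k) * exp (norm (x - k))) * E \<beta> x"
              by (intro mult_right_mono) (auto simp: E_def)
            also have "\<dots> = m * exp (e * norm k) * (E \<beta> x * exp (norm (x - k)))" by simp
            also have "\<dots> \<le> m * exp (e * norm k) * (exp (- L) * E 1 x)"
              using near[OF k, of x] x F m0 unfolding E_def by (intro mult_left_mono) auto
            finally show "cmod (?f x) \<le> m * exp (e * norm k) * exp (- L) * E 1 x"
              by (simp add: norm_mult norm_gaussian E_def mult.assoc)
          qed
          also have "\<dots> = m * exp (e * norm k) * exp (- L) * (\<Sum>x\<in>F - {k}. E 1 x)"
            by (simp add: sum_distrib_left)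
          also have "\<dots> \<le> m * exp (e * norm k) * exp (- L) * (C * (1 / sqrt 1) ^ CARD('n))"
            unfolding E_def using m0 F by (intro mult_left_mono C(2)) auto
          also have "\<dots> = m * exp (e * norm k) * (exp (- L) * C)" by simp
          also have "\<dots> \<le> m * exp (e * norm k) * (1 / 2)" using L m0 by (intro mult_left_mono) auto
          finally show ?thesis by simp
        qed
        ultimately show ?thesis using norm_diff_ineq[of "\<mu> {k}" "sum ?f (F - {k})"] by simp
      qed
      have "cmod (\<mu> {k}) - m / 2 * exp (e * norm k) \<le> cmod (integral_wrt \<mu> (gaussian \<beta> k 0))"
      proof (rule tendsto_lowerbound)
        show "((\<lambda>F. cmod (sum ?f F)) \<longlongrightarrow> cmod (integral_wrt \<mu> (gaussian \<beta> k 0))) (finite_subsets_at_top \<Lambda>)"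
          using hs unfolding has_sum_def by (rule tendsto_norm)
        show "\<forall>\<^sub>F F in finite_subsets_at_top \<Lambda>. cmod (\<mu> {k}) - m / 2 * exp (e * norm k) \<le> cmod (sum ?f F)"
          unfolding eventually_finite_subsets_at_top
          by (rule exI[of _ "{k}"]) (use k low in auto)
      qed simp
      also have "\<dots> \<le> D" by (rule convolution[OF hs])
      finally have "cmod (\<mu> {k}) \<le> D + m / 2 * exp (e * norm k)" by simp
      then have "W k \<le> (D + m / 2 * exp (e * norm k)) * exp (- e * norm k)"
        unfolding W_def by (intro mult_right_mono) auto
      also have "\<dots> = D * exp (- e * norm k) + m / 2" by (simp add: algebra_simps exp_add[symmetric] flip: exp_minus)
      also have "D * exp (- e * norm k) \<le> D * 1" using D0 e by (intro mult_left_mono) auto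
      finally show ?thesis by simp
    qed
    \<comment> \<open>Since \<open>m\<close> is finite, this gives \<open>m \<le> 2 * D\<close>, a
      bound without \<open>e\<close>.\<close>
    have "m \<le> D + m / 2" unfolding m_def
      by (rule cSup_least) (use l step in \<open>auto simp: m_def\<close>)
    then show ?thesis using Wm[OF l] by (simp add: W_def)
  qed
  show ?thesis
  proof
    fix l assume l: "l \<in> \<Lambda>"
    have "((\<lambda>e. cmod (\<mu> {l}) * exp (- e * norm l)) \<longlongrightarrow> cmod (\<mu> {l}) * exp (- 0 * norm l)) (at_right 0)"
      by (intro tendsto_intros)
    moreover have "\<forall>\<^sub>F e in at_right 0. cmod (\<mu> {l}) * exp (- e * norm l) \<le> 2 * D"
      using eventually_at_right_real[of 0 1, simplified] by eventually_elim (use weighted l in auto)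
    ultimately have "cmod (\<mu> {l}) * exp (- 0 * norm l) \<le> 2 * D"
      by (rule tendsto_upperbound) simp
    then show "cmod (\<mu> {l}) \<le> 2 * D" by simp
  qed
qed

end

text \<open>The Gaussians shrink to the indicator of \<open>x\<close>. The index
  \<open>Suc k\<close> keeps their parameter at least 1, so the Gaussian with parameter 1 is a
  summable majorant.\<close>

lemma gaussian_sums_tendsto_atom:
  fixes \<nu> :: "'a::euclidean_space set \<Rightarrow> complex"
  assumes \<nu>: "slowly_increasing \<nu>" "atomic_on \<nu> S"
  shows "(\<lambda>k. \<Sum>\<^sub>\<infinity>s\<in>S. \<nu> {s} * gaussian (real (Suc k)) x 0 s) \<longlonglongrightarrow> \<nu> {x}"
proof -
  define f where "f = (\<lambda>k s. \<nu> {s} * gaussian (real (Suc k)) x 0 s)"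
  define g where "g = (\<lambda>s. if s = x then \<nu> {x} else 0)"
  define w where "w = (\<lambda>s. cmod (\<nu> {s}) * cmod (gaussian 1 x 0 s))"
  have abs: "Infinite_Sum.abs_summable_on (f k) S" for k
    using summable_gaussian_atoms[OF \<nu>(1), of "real (Suc k)" x 0 S] by (simp add: f_def norm_mult)
  have conv: "(LINT s|count_space S. h s) = infsum h S" if "Infinite_Sum.abs_summable_on h S" for h :: "'a \<Rightarrow> complex"
    using infsetsum_infsum[of h S] that abs_summable_equivalent by (auto simp: infsetsum_def)
  have w: "integrable (count_space S) w"
  proof -
    have "Infinite_Sum.abs_summable_on w S"
      using summable_gaussian_atoms[OF \<nu>(1), of 1 x 0 S] by (simp add: w_def)
    then have "Infinite_Set_Sum.abs_summable_on w S" using abs_summable_equivalent by blast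
    then show ?thesis by (simp add: abs_summable_on_def)
  qed
  have gabs: "Infinite_Sum.abs_summable_on g S"
  proof (rule summable_on_comparison_test[where f = w])
    show "w summable_on S" using summable_gaussian_atoms[OF \<nu>(1), of 1 x 0 S] by (simp add: w_def)
  qed (auto simp: g_def w_def norm_gaussian)
  have "(\<lambda>k. LINT s|count_space S. f k s) \<longlonglongrightarrow> (LINT s|count_space S. g s)"
  proof (rule integral_dominated_convergence[where w = w])
    show "AE s in count_space S. (\<lambda>k. f k s) \<longlonglongrightarrow> g s"
    proof (rule AE_I2)
      fix s
      show "(\<lambda>k. f k s) \<longlonglongrightarrow> g s"
      proof (cases "s = x")
        case True
        then show ?thesis by (simp add: f_def g_def gaussian_def)
      next
        case False
        define u where "u = pi * (norm (s - x))\<^sup>2"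
        have "u > 0" using False by (simp add: u_def)
        then have "(\<lambda>k. exp (- u) ^ Suc k) \<longlonglongrightarrow> 0"
          by (intro LIMSEQ_Suc LIMSEQ_power_zero) simp
        moreover have "exp (- u) ^ Suc k = cmod (gaussian (real (Suc k)) x 0 s)" for k
          unfolding norm_gaussian u_def exp_of_nat_mult[symmetric] by (rule arg_cong[where f = exp]) simp
        ultimately have "(\<lambda>k. cmod (gaussian (real (Suc k)) x 0 s)) \<longlonglongrightarrow> 0"
          by (simp only:)
        then have "(\<lambda>k. gaussian (real (Suc k)) x 0 s) \<longlonglongrightarrow> 0"
          by (rule tendsto_norm_zero_cancel)
        from tendsto_mult_left[OF this, of "\<nu> {s}"] show ?thesis
          using False by (simp only: f_def g_def if_False mult_zero_right)
      qed
    qed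
    show "AE s in count_space S. norm (f k s) \<le> w s" for k
    proof (rule AE_I2)
      fix s
      have "pi * 1 * (norm (s - x))\<^sup>2 \<le> pi * real (Suc k) * (norm (s - x))\<^sup>2"
        by (intro mult_right_mono mult_left_mono) auto
      then show "norm (f k s) \<le> w s"
        unfolding f_def w_def norm_mult norm_gaussian by (intro mult_left_mono) auto
    qed
  qed (use w in auto)
  then have "(\<lambda>k. infsum (f k) S) \<longlonglongrightarrow> infsum g S" by (simp add: conv abs gabs)
  moreover have "infsum g S = \<nu> {x}"
  proof (cases "x \<in> S")
    case True
    then have "infsum g S = infsum g {x}" by (intro infsum_cong_neutral) (auto simp: g_def)
    then show ?thesis by (simp add: g_def)
  next
    case False
    then have "\<nu> {x} = 0" by (rule atomic_on_outside[OF \<nu>(2)])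
    moreover have "infsum g S = 0" using False by (intro infsum_0) (auto simp: g_def)
    ultimately show ?thesis by simp
  qed
  ultimately show ?thesis by (simp add: f_def)
qed

section \<open>Atoms as limits of exponential sums\<close>

definition wave :: "'a::real_inner \<Rightarrow> 'a \<Rightarrow> complex" where
  "wave x l = exp (- 2 * of_real pi * \<i> * of_real (x \<bullet> l))"

context atomic_fourier_pair
begin

text \<open>A narrow Gaussian around x isolates the atom of \<open>\<nu>\<close> at x; its transform
  is a wide Gaussian with total mass of order 1 over \<open>\<Lambda>\<close>, and the atoms of
  \<open>\<mu>\<close> are bounded. This gives \<open>M\<close>, independent of width, x and
  precision. Finiteness of \<open>X\<close> allows one width and one finite set \<open>F\<close> to
  serve for all points together.\<close>

lemma atoms_approx_exponential_sums:
  obtains M where "M > 0"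
    "\<And>X \<epsilon>. \<lbrakk>finite X; \<epsilon> > 0\<rbrakk> \<Longrightarrow> \<exists>F c. finite F \<and> F \<subseteq> \<Lambda> \<and> (\<Sum>l\<in>F. cmod (c l)) \<le> M \<and>
      (\<forall>x\<in>X. cmod ((\<Sum>l\<in>F. c l * wave x l) - \<nu> {x}) \<le> \<epsilon>)"
proof -
  obtain C where C: "C > 0"
    "\<And>F a x. \<lbrakk>finite F; F \<subseteq> \<Lambda>; 0 < a; a \<le> 1\<rbrakk> \<Longrightarrow> (\<Sum>l\<in>F. exp (- pi * a * (norm (l - x))\<^sup>2)) \<le> C * (1 / sqrt a) ^ CARD('n)"
    using gaussian_sum_separated[OF d] by auto
  obtain M0 where M0: "\<And>l. l \<in> \<Lambda> \<Longrightarrow> cmod (\<mu> {l}) \<le> M0" using atoms_bounded by blast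
  define M1 where "M1 = max 1 M0"
  have M1: "M1 > 0" "\<And>l. l \<in> \<Lambda> \<Longrightarrow> cmod (\<mu> {l}) \<le> M1" using M0 by (auto simp: M1_def intro: max.coboundedI2)
  define T where "T = (\<lambda>k x. \<Sum>\<^sub>\<infinity>s\<in>S. \<nu> {s} * gaussian (real (Suc k)) x 0 s)"
  have T_lim: "(\<lambda>k. T k x) \<longlonglongrightarrow> \<nu> {x}" for x
    unfolding T_def by (rule gaussian_sums_tendsto_atom[OF \<nu>(1,3)])
  \<comment> \<open>The coefficients are independent of x: on the side of \<open>\<mu>\<close> the
    centre x survives only in \<open>wave x l\<close>.\<close>
  define c where "c = (\<lambda>k l. \<mu> {l} * of_real ((1 / sqrt (real (Suc k))) ^ CARD('n) * exp (- pi * (1 / real (Suc k)) * (norm l)\<^sup>2)))"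
  have csum: "(\<Sum>l\<in>F. cmod (c k l)) \<le> M1 * C" if F: "finite F" "F \<subseteq> \<Lambda>" for F k
  proof -
    have "(\<Sum>l\<in>F. cmod (c k l)) \<le> (\<Sum>l\<in>F. M1 * ((1 / sqrt (real (Suc k))) ^ CARD('n) * exp (- pi * (1 / real (Suc k)) * (norm (l - 0))\<^sup>2)))"
      unfolding c_def norm_mult norm_of_real using F M1 by (intro sum_mono mult_mono) auto
    also have "\<dots> = M1 * ((1 / sqrt (real (Suc k))) ^ CARD('n) * (\<Sum>l\<in>F. exp (- pi * (1 / real (Suc k)) * (norm (l - 0))\<^sup>2)))"
      by (simp only: sum_distrib_left)
    also have "\<dots> \<le> M1 * ((1 / sqrt (real (Suc k))) ^ CARD('n) * (C * (1 / sqrt (1 / real (Suc k))) ^ CARD('n)))"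
      using F M1 by (intro mult_left_mono C(2)) auto
    also have "\<dots> = M1 * C * ((1 / sqrt (real (Suc k))) * (1 / sqrt (1 / real (Suc k)))) ^ CARD('n)"
      by (simp only: power_mult_distrib mult_ac)
    also have "(1 / sqrt (real (Suc k))) * (1 / sqrt (1 / real (Suc k))) = 1"
      by (simp add: real_sqrt_divide)
    finally show ?thesis by simp
  qed
  have hs: "((\<lambda>l. c k l * wave x l) has_sum (T k x)) \<Lambda>" for k x
  proof -
    have k: "real (Suc k) > 0" by simp
    obtain z where z: "((\<lambda>s. \<nu> {s} * gaussian (real (Suc k)) x 0 s) has_sum z) S"
      "((\<lambda>l. \<mu> {l} * fourier (gaussian (real (Suc k)) x 0) l) has_sum z) \<Lambda>"
      using gaussian_fourier_sums[OF k] by blast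
    have "gaussian (1 / real (Suc k)) 0 (- x) l = of_real (exp (- pi * (1 / real (Suc k)) * (norm l)\<^sup>2)) * wave x l" for l
      unfolding gaussian_def wave_def exp_of_real[symmetric] exp_add[symmetric] by simp
    then have "\<mu> {l} * fourier (gaussian (real (Suc k)) x 0) l
      = c k l * wave x l" for l
      unfolding c_def of_real_mult fourier_gaussian[OF k] by (simp only: mult_ac inner_zero_right of_real_0 mult_zero_right mult_zero_left exp_zero mult_1_right mult_1_left)
    then show ?thesis using z infsumI[OF z(1)] by (simp add: T_def)
  qed
  show ?thesis
  proof
    show "M1 * C > 0" using M1 C by simp
    fix X :: "(real ^ 'n) set" and \<epsilon> :: real assume X: "finite X" and e: "\<epsilon> > 0"
    have ev: "\<forall>\<^sub>F k in sequentially. \<forall>x\<in>X. dist (T k x) (\<nu> {x}) < \<epsilon> / 2"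
      by (intro eventually_ball_finite[OF X] ballI tendstoD[OF T_lim]) (use e in simp)
    obtain k where k: "\<And>x. x \<in> X \<Longrightarrow> dist (T k x) (\<nu> {x}) < \<epsilon> / 2"
      using eventually_happens'[OF sequentially_bot ev] by blast
    define P where "P = (\<lambda>F. \<forall>x\<in>X. dist (\<Sum>l\<in>F. c k l * wave x l) (T k x) < \<epsilon> / 2)"
    have "eventually P (finite_subsets_at_top \<Lambda>)"
      unfolding P_def
      by (intro eventually_ball_finite[OF X] ballI tendstoD[OF hs[unfolded has_sum_def]]) (use e in simp)
    then obtain F where F: "finite F" "F \<subseteq> \<Lambda>" "P F"
      unfolding eventually_finite_subsets_at_top by blast
    have "cmod ((\<Sum>l\<in>F. c k l * wave x l) - \<nu> {x}) \<le> \<epsilon>" if "x \<in> X" for x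
      using dist_triangle_half_l[OF F(3)[unfolded P_def, rule_format, OF that], of "\<nu> {x}"] k[OF that]
      by (simp add: dist_norm norm_minus_commute)
    then show "\<exists>F c. finite F \<and> F \<subseteq> \<Lambda> \<and> (\<Sum>l\<in>F. cmod (c l)) \<le> M1 * C \<and>
      (\<forall>x\<in>X. cmod ((\<Sum>l\<in>F. c l * wave x l) - \<nu> {x}) \<le> \<epsilon>)"
      using F(1,2) csum[OF F(1,2), of k] by (intro exI[of _ F] exI[of _ "c k"]) blast
  qed
qed

end

section \<open>Exponential sums that are small on a net\<close>

text \<open>Maximum modulus on a long rectangle. The factor with exponent
  \<open>\<i> * k * w\<close> levels the two horizontal sides; the factor with exponent
  \<open>- e * w\<^sup>2\<close> makes the vertical sides harmless and disappears as
  \<open>e\<close> tends to 0.\<close>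

lemma three_lines_upper:
  fixes g :: "complex \<Rightarrow> complex" and k m Y :: real
  assumes hol: "g holomorphic_on UNIV" and "Y > 0" "m \<ge> 0"
    and real: "\<And>x::real. cmod (g (of_real x)) \<le> m"
    and strip: "\<And>z. \<lbrakk>0 \<le> Im z; Im z \<le> Y\<rbrakk> \<Longrightarrow> cmod (g z) \<le> m * exp (k * Y)"
    and z: "0 \<le> Im z" "Im z \<le> Y"
  shows "cmod (g z) \<le> m * exp (k * Im z)"
proof -
  have main: "cmod (g z) * exp (- k * Im z - e * ((Re z)\<^sup>2 - (Im z)\<^sup>2)) \<le> m * exp (e * Y\<^sup>2)" if "e > 0" for e :: real
  proof -
    define h where "h = (\<lambda>w. g w * exp (\<i> * of_real k * w - of_real e * w\<^sup>2))"
    have hmod: "cmod (h w) = cmod (g w) * exp (- k * Im w - e * ((Re w)\<^sup>2 - (Im w)\<^sup>2))" for w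
      by (simp add: h_def norm_mult power2_eq_square)
    \<comment> \<open>On the vertical sides \<open>e * X\<^sup>2\<close> has to outweigh two terms
      of size at most \<open>\<bar>k\<bar> * Y\<close>.\<close>
    define X where "X = max (\<bar>Re z\<bar>) (sqrt (\<bar>2 * k\<bar> * Y / e)) + 1"
    have Xz: "\<bar>Re z\<bar> \<le> X" and X0: "X > 0" by (auto simp: X_def)
    have X2: "2 * \<bar>k\<bar> * Y \<le> e * X\<^sup>2"
    proof -
      have "sqrt (\<bar>2 * k\<bar> * Y / e) \<le> X" by (auto simp: X_def)
      then have "\<bar>2 * k\<bar> * Y / e \<le> X\<^sup>2" by (rule sqrt_le_D)
      then show ?thesis using \<open>e > 0\<close> by (simp add: field_simps abs_mult)
    qed
    let ?S = "cbox (Complex (-X) 0) (Complex X Y)"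
    have "cmod (h z) \<le> m * exp (e * Y\<^sup>2)"
    proof (rule maximum_modulus_frontier[of h ?S])
      have hh: "h holomorphic_on UNIV" unfolding h_def using hol by (intro holomorphic_intros) auto
      show "h holomorphic_on interior ?S" by (rule holomorphic_on_subset[OF hh]) auto
      show "continuous_on (closure ?S) h"
        by (rule holomorphic_on_imp_continuous_on[OF holomorphic_on_subset[OF hh]]) auto
      show "bounded ?S" by simp
      show "z \<in> ?S" using z Xz by (auto simp: in_cbox_complex_iff)
      fix w assume "w \<in> frontier ?S"
      then have w: "w \<in> ?S" "w \<notin> box (Complex (-X) 0) (Complex X Y)"
        by (auto simp: frontier_cbox)
      then have w1: "-X \<le> Re w" "Re w \<le> X" "0 \<le> Im w" "Im w \<le> Y"
        by (auto simp: in_cbox_complex_iff)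
      have hw: "cmod (h w) \<le> m * exp (k * Y) * exp (- k * Im w - e * ((Re w)\<^sup>2 - (Im w)\<^sup>2))" (is "_ \<le> ?b")
        unfolding hmod by (intro mult_right_mono strip w1) auto
      from w w1 consider "Im w = 0" | "Im w = Y" | "\<bar>Re w\<bar> = X"
        using X0 by (fastforce simp: in_box_complex_iff)
      then show "cmod (h w) \<le> m * exp (e * Y\<^sup>2)"
      proof cases
        case 1
        then have "w = of_real (Re w)" by (simp add: complex_eq_iff)
        then have "cmod (g w) \<le> m" using real by metis
        moreover have "- k * Im w - e * ((Re w)\<^sup>2 - (Im w)\<^sup>2) \<le> e * Y\<^sup>2"
        proof -
          have "0 \<le> e * (Re w)\<^sup>2" "0 \<le> e * Y\<^sup>2" using \<open>e > 0\<close> by auto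
          then show ?thesis using 1 by simp
        qed
        ultimately show ?thesis unfolding hmod using \<open>m \<ge> 0\<close> by (intro mult_mono) auto
      next
        case 2
        note hw
        also have "?b = m * exp (e * Y\<^sup>2 - e * (Re w)\<^sup>2)"
          unfolding 2 by (simp add: mult.assoc exp_add[symmetric] algebra_simps)
        also have "\<dots> \<le> m * exp (e * Y\<^sup>2)" using \<open>e > 0\<close> \<open>m \<ge> 0\<close> by (intro mult_left_mono) auto
        finally show ?thesis .
      next
        case 3
        note hw
        also have "?b = m * exp (k * Y - k * Im w + e * (Im w)\<^sup>2 - e * X\<^sup>2)"
          using 3 by (simp add: mult.assoc exp_add[symmetric] algebra_simps flip: power2_abs[of "Re w"])
        also have "\<dots> \<le> m * exp (e * Y\<^sup>2)"
        proof -
          have "\<bar>k * Y\<bar> \<le> \<bar>k\<bar> * Y" using \<open>Y > 0\<close> by (simp add: abs_mult)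
          moreover have "\<bar>k * Im w\<bar> \<le> \<bar>k\<bar> * Y" using w1 by (simp add: abs_mult mult_left_mono)
          moreover have "e * (Im w)\<^sup>2 \<le> e * Y\<^sup>2" using w1 \<open>e > 0\<close> by (simp add: power_mono)
          ultimately have "k * Y - k * Im w + e * (Im w)\<^sup>2 - e * X\<^sup>2 \<le> e * Y\<^sup>2" using X2 by linarith
          then show ?thesis using \<open>m \<ge> 0\<close> by (intro mult_left_mono) auto
        qed
        finally show ?thesis .
      qed
    qed
    then show ?thesis unfolding hmod .
  qed
  have "((\<lambda>e. cmod (g z) * exp (- k * Im z - e * ((Re z)\<^sup>2 - (Im z)\<^sup>2))) \<longlongrightarrow>
      cmod (g z) * exp (- k * Im z - 0 * ((Re z)\<^sup>2 - (Im z)\<^sup>2))) (at_right 0)"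
    by (intro tendsto_intros)
  moreover have "((\<lambda>e. m * exp (e * Y\<^sup>2)) \<longlongrightarrow> m * exp (0 * Y\<^sup>2)) (at_right 0)"
    by (intro tendsto_intros)
  moreover have "\<forall>\<^sub>F e in at_right 0. cmod (g z) * exp (- k * Im z - e * ((Re z)\<^sup>2 - (Im z)\<^sup>2)) \<le> m * exp (e * Y\<^sup>2)"
    using eventually_at_right_less[of 0] by eventually_elim (rule main)
  ultimately have "cmod (g z) * exp (- k * Im z - 0 * ((Re z)\<^sup>2 - (Im z)\<^sup>2)) \<le> m * exp (0 * Y\<^sup>2)"
    by (intro tendsto_le[OF trivial_limit_at_right_real])
  then have "cmod (g z) * exp (- k * Im z) \<le> m" by simp
  then show ?thesis by (simp add: exp_minus field_simps)
qed

lemma three_lines: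
  fixes g :: "complex \<Rightarrow> complex" and k m Y :: real
  assumes hol: "g holomorphic_on UNIV" and "Y > 0" "m \<ge> 0"
    and real: "\<And>x::real. cmod (g (of_real x)) \<le> m"
    and strip: "\<And>z. \<bar>Im z\<bar> \<le> Y \<Longrightarrow> cmod (g z) \<le> m * exp (k * Y)"
    and z: "\<bar>Im z\<bar> \<le> Y"
  shows "cmod (g z) \<le> m * exp (k * \<bar>Im z\<bar>)"
proof (cases "0 \<le> Im z")
  case True
  then show ?thesis using three_lines_upper[of g Y m k z] assms by auto
next
  case False
  have "(\<lambda>z. g (- z)) holomorphic_on UNIV"
    using holomorphic_on_compose[of uminus UNIV g] hol by (simp add: o_def holomorphic_on_minus)
  moreover have "cmod (g (- of_real x)) \<le> m" for x using real[of "-x"] by simp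
  ultimately have "cmod (g (- (- z))) \<le> m * exp (k * Im (- z))"
    using False z by (intro three_lines_upper[of "\<lambda>z. g (- z)" Y m k "- z"]) (use assms in auto)
  then show ?thesis using False by simp
qed

text \<open>Multiply \<open>K\<close> rotated copies of \<open>f\<close>. At each point of the
  circle one copy is evaluated inside the cone and contributes \<open>\<delta>\<close>, the others
  at most \<open>D\<close>; at 0 the product is the \<open>K\<close>-th power, and the maximum
  principle compares the two.\<close>

lemma power_at_0_le_rotated_sector_bound:
  fixes f :: "complex \<Rightarrow> complex"
  assumes hol: "f holomorphic_on UNIV" and "R > 0" "K \<ge> 64" "D \<ge> 0"
    and bnd: "\<And>z. cmod z = R \<Longrightarrow> cmod (f z) \<le> D"
    and cone: "\<And>z. \<lbrakk>cmod z = R; 8 * \<bar>Im z\<bar> \<le> Re z\<rbrakk> \<Longrightarrow> cmod (f z) \<le> \<delta>"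
  shows "cmod (f 0) ^ K \<le> \<delta> * D ^ (K - 1)"
proof -
  have Kpos: "K > 0" "real K \<ge> 64" using assms(3) by auto
  define w where "w = (\<lambda>k::nat. cis (- (2 * pi * real k / real K)))"
  define H where "H = (\<lambda>z. \<Prod>k<K. f (w k * z))"
  have Hh: "H holomorphic_on UNIV"
  proof -
    have "(\<lambda>z. f (w k * z)) holomorphic_on UNIV" for k
      using holomorphic_on_compose_gen[of "\<lambda>z. w k * z" UNIV f UNIV] hol
      by (simp add: o_def holomorphic_on_mult holomorphic_on_const holomorphic_on_ident)
    then show ?thesis unfolding H_def by (intro holomorphic_on_prod) auto
  qed
  have "cmod (H 0) \<le> \<delta> * D ^ (K - 1)"
  proof (rule maximum_modulus_frontier[of H "cball 0 R"])
    show "H holomorphic_on interior (cball 0 R)" by (rule holomorphic_on_subset[OF Hh]) auto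
    show "continuous_on (closure (cball 0 R)) H"
      by (rule holomorphic_on_imp_continuous_on[OF holomorphic_on_subset[OF Hh]]) auto
    show "bounded (cball (0::complex) R)" by simp
    show "0 \<in> cball (0::complex) R" using \<open>R > 0\<close> by simp
    fix z :: complex assume "z \<in> frontier (cball 0 R)"
    then have zR: "cmod z = R" using \<open>R > 0\<close> by (simp add: frontier_cball)
    have wz: "cmod (w k * z) = R" for k by (simp add: w_def norm_mult zR)
    obtain k where k: "k < K" and kc: "8 * \<bar>Im (w k * z)\<bar> \<le> Re (w k * z)"
    proof -
      define \<alpha> where "\<alpha> = Arg2pi z"
      have \<alpha>: "0 \<le> \<alpha>" "\<alpha> < 2 * pi" "z = of_real R * cis \<alpha>"
        using Arg2pi[of z] zR by (auto simp: \<alpha>_def cis_conv_exp is_Arg_def)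
      \<comment> \<open>The rotation that brings the argument of \<open>z\<close> between 0 and
        \<open>2 * pi / K\<close>.\<close>
      define j where "j = nat \<lfloor>\<alpha> * real K / (2 * pi)\<rfloor>"
      have j: "real j \<le> \<alpha> * real K / (2 * pi)" "\<alpha> * real K / (2 * pi) < real j + 1"
        using \<alpha> by (auto simp: j_def)
      have jK: "j < K"
      proof -
        have "\<alpha> * real K / (2 * pi) < real K" using \<alpha> Kpos by (simp add: field_simps)
        then show ?thesis using j by linarith
      qed
      define \<beta> where "\<beta> = \<alpha> - 2 * pi * real j / real K"
      have \<beta>: "0 \<le> \<beta>" "\<beta> \<le> 2 * pi / real K"
      proof -
        have "\<beta> = 2 * pi / real K * (\<alpha> * real K / (2 * pi) - real j)"
          using Kpos by (simp add: \<beta>_def field_simps)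
        moreover have "2 * pi / real K * (\<alpha> * real K / (2 * pi) - real j) \<le> 2 * pi / real K * 1"
          using j Kpos by (intro mult_left_mono) auto
        moreover have "0 \<le> 2 * pi / real K * (\<alpha> * real K / (2 * pi) - real j)"
          using j Kpos by (intro mult_nonneg_nonneg) auto
        ultimately show "0 \<le> \<beta>" "\<beta> \<le> 2 * pi / real K" by auto
      qed
      have "w j * z = of_real R * cis \<beta>"
        by (simp add: w_def \<alpha>(3) \<beta>_def cis_mult algebra_simps)
      \<comment> \<open>The origin of 64: \<open>2 * pi / 64 \<le> 0.1\<close>, and angles up to 0.1
        have sine at most 0.1 and cosine at least 0.8.\<close>
      moreover have "8 * \<bar>sin \<beta>\<bar> \<le> cos \<beta>"
      proof -
        have "\<beta> \<le> 2 * pi / 64"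
          using \<beta>(2) Kpos by (smt (verit) frac_le pi_gt_zero)
        moreover have "pi \<le> 3.2" using pi_approx(2) by simp
        ultimately have b: "\<beta> \<le> 0.1" by simp
        have "0 \<le> sin \<beta>" using \<beta> b pi_approx by (intro sin_ge_zero) auto
        moreover have "sin \<beta> \<le> 0.1" using sin_x_le_x[OF \<beta>(1)] b by linarith
        ultimately have s: "\<bar>sin \<beta>\<bar> \<le> 0.1" by simp
        then have "(sin \<beta>)\<^sup>2 \<le> 0.1\<^sup>2" by (simp only: abs_le_square_iff[symmetric])
        then have c2: "(cos \<beta>)\<^sup>2 \<ge> 0.8\<^sup>2" using sin_cos_squared_add[of \<beta>] by (simp add: power2_eq_square)
        have "0 \<le> cos \<beta>" using \<beta> b pi_approx by (intro cos_ge_zero) auto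
        then have "cos \<beta> \<ge> 0.8" using c2 power2_le_imp_le by blast
        then show ?thesis using s by simp
      qed
      ultimately have "8 * \<bar>Im (w j * z)\<bar> \<le> Re (w j * z)"
        using \<open>R > 0\<close> by (simp add: abs_mult)
      then show ?thesis using that jK by blast
    qed
    have "cmod (H z) = cmod (f (w k * z)) * (\<Prod>i\<in>{..<K}-{k}. cmod (f (w i * z)))"
      unfolding H_def using k by (simp add: prod_norm norm_mult prod.remove[of "{..<K}" k])
    also have "\<dots> \<le> \<delta> * (\<Prod>i\<in>{..<K}-{k}. D)"
      using cone[OF wz kc] bnd[OF wz] order_trans[OF norm_ge_zero cone[OF wz kc]] \<open>D \<ge> 0\<close>
      by (intro mult_mono prod_mono) (auto intro: prod_nonneg)
    also have "\<dots> = \<delta> * D ^ (K - 1)" using k by simp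
    finally show "cmod (H z) \<le> \<delta> * D ^ (K - 1)" .
  qed
  then show ?thesis by (simp add: H_def norm_power)
qed

section \<open>Exponential sums with bounded mass and bounded frequencies\<close>

abbreviation L2_dist :: "'b set \<Rightarrow> ('b \<Rightarrow> real) \<Rightarrow> ('b \<Rightarrow> real) \<Rightarrow> real" where
  "L2_dist B x y \<equiv> L2_set (\<lambda>b. x b - y b) B"

text \<open>The number of variables is known only once generators of the Meyer set are chosen, so
  points are functions of which only the values on \<open>B\<close> matter, and
  \<open>L2_set\<close> is their Euclidean norm. The estimates involve only \<open>M\<close> and
  \<open>\<sigma>\<close>, not the number of terms.\<close>

locale exponential_sum =
  fixes I :: "'i set" and B :: "'b set" and c :: "'i \<Rightarrow> complex" and y :: "'i \<Rightarrow> 'b \<Rightarrow> real"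
    and M \<sigma> :: real
  assumes finI: "finite I" and finB: "finite B"
    and M: "(\<Sum>i\<in>I. cmod (c i)) \<le> M" and M0: "M > 0"
    and freq: "\<And>i. i \<in> I \<Longrightarrow> L2_set (y i) B \<le> \<sigma>" and \<sigma>0: "\<sigma> > 0"
begin

definition val :: "('b \<Rightarrow> real) \<Rightarrow> complex" where
  "val x = (\<Sum>i\<in>I. c i * exp (\<i> * of_real (\<Sum>b\<in>B. x b * y i b)))"

text \<open>The entire extension of the sum restricted to a real line; it reduces all complex
  analysis to one variable.\<close>

definition line :: "('b \<Rightarrow> real) \<Rightarrow> ('b \<Rightarrow> real) \<Rightarrow> complex \<Rightarrow> complex" where
  "line x u z = (\<Sum>i\<in>I. c i * exp (\<i> * (of_real (\<Sum>b\<in>B. x b * y i b) + z * of_real (\<Sum>b\<in>B. u b * y i b))))"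

lemma line_of_real: "line x u (of_real t) = val (\<lambda>b. x b + t * u b)"
proof -
  have "(\<Sum>b\<in>B. (x b + t * u b) * y i b) = (\<Sum>b\<in>B. x b * y i b) + t * (\<Sum>b\<in>B. u b * y i b)" for i
    by (simp add: sum.distrib sum_distrib_left algebra_simps)
  then show ?thesis unfolding line_def val_def by (simp only: of_real_add of_real_mult)
qed

lemma line_shift: "line (\<lambda>b. x b + t * u b) u z = line x u (of_real t + z)"
proof -
  have "(\<Sum>b\<in>B. (x b + t * u b) * y i b) = (\<Sum>b\<in>B. x b * y i b) + t * (\<Sum>b\<in>B. u b * y i b)" for i
    by (simp add: sum.distrib sum_distrib_left algebra_simps)
  then show ?thesis unfolding line_def by (simp add: algebra_simps)
qed

lemma line_holomorphic: "line x u holomorphic_on A"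
  unfolding line_def by (intro holomorphic_intros)

lemma norm_line_le: "cmod (line x u z) \<le> M * exp (\<sigma> * L2_set u B * \<bar>Im z\<bar>)"
proof -
  have "cmod (line x u z) \<le> (\<Sum>i\<in>I. cmod (c i) * exp (\<sigma> * L2_set u B * \<bar>Im z\<bar>))"
    unfolding line_def
  proof (rule sum_norm_le)
    fix i assume i: "i \<in> I"
    define s where "s = (\<Sum>b\<in>B. u b * y i b)"
    have "\<bar>s\<bar> \<le> (\<Sum>b\<in>B. \<bar>u b\<bar> * \<bar>y i b\<bar>)"
      unfolding s_def by (rule order_trans[OF sum_abs]) (simp add: abs_mult)
    also have "\<dots> \<le> L2_set u B * L2_set (y i) B" by (rule L2_set_mult_ineq)
    also have "\<dots> \<le> L2_set u B * \<sigma>" using freq[OF i] by (intro mult_left_mono) auto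
    finally have s: "\<bar>s\<bar> \<le> \<sigma> * L2_set u B" by (simp add: mult.commute)
    have "- (Im z * s) \<le> \<bar>s\<bar> * \<bar>Im z\<bar>" by (metis abs_ge_minus_self abs_mult mult.commute)
    also have "\<dots> \<le> \<sigma> * L2_set u B * \<bar>Im z\<bar>" using s by (intro mult_right_mono) auto
    finally have "- (Im z * s) \<le> \<sigma> * L2_set u B * \<bar>Im z\<bar>" .
    then show "cmod (c i * exp (\<i> * (of_real (\<Sum>b\<in>B. x b * y i b) + z * of_real (\<Sum>b\<in>B. u b * y i b))))
        \<le> cmod (c i) * exp (\<sigma> * L2_set u B * \<bar>Im z\<bar>)"
      by (simp add: norm_mult s_def[symmetric] mult_left_mono)
  qed
  also have "\<dots> \<le> M * exp (\<sigma> * L2_set u B * \<bar>Im z\<bar>)"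
    unfolding sum_distrib_right[symmetric] using M by (intro mult_right_mono) auto
  finally show ?thesis .
qed

lemma norm_val_le: "cmod (val x) \<le> M"
  using norm_line_le[of x x 0] by (simp add: line_def val_def)

text \<open>Near a point where the weighted sum almost attains its supremum \<open>m\<close>, the three lines theorem bounds it
  by a multiple of \<open>m\<close> in a complex neighbourhood, so it varies too slowly to be small at a net point.\<close>
lemma gaussian_net_bound:
  fixes V :: "('b \<Rightarrow> real) set" and x\<^sub>0 :: "'b \<Rightarrow> real" and b r \<epsilon> :: real
  assumes affine: "\<And>x x' t. \<lbrakk>x \<in> V; x' \<in> V\<rbrakk> \<Longrightarrow> (\<lambda>b. x b + t * (x' b - x b)) \<in> V"
    and x\<^sub>0: "x\<^sub>0 \<in> V" and r: "r > 0" and b: "b > 0" "b * r \<ge> 1" and \<epsilon>: "\<epsilon> \<ge> 0"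
    and net: "\<And>x. \<lbrakk>x \<in> V; L2_dist B x x\<^sub>0 \<le> r\<rbrakk> \<Longrightarrow>
      \<exists>p\<in>V. L2_dist B p x \<le> 1 / (16 * (\<sigma> + 2 * b)) \<and> cmod (val p) \<le> \<epsilon>"
    and x: "x \<in> V"
  shows "cmod (val x) * exp (- (b / r) * (L2_dist B x x\<^sub>0)\<^sup>2) \<le> max (2 * M * exp (- b * r)) (2 * \<epsilon>)"
proof (rule ccontr)
  define G where "G = (\<lambda>x. cmod (val x) * exp (- (b / r) * (L2_dist B x x\<^sub>0)\<^sup>2))"
  define m where "m = Sup (G ` V)"
  \<comment> \<open>This mesh makes the growth constant \<open>k\<close> below equal to
    1/16.\<close>
  define \<rho> where "\<rho> = 1 / (16 * (\<sigma> + 2 * b))"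
  have \<rho>: "\<rho> > 0" using \<sigma>0 b by (simp add: \<rho>_def)
  have br: "b / r > 0" using b r by simp
  have Gval: "G x \<le> cmod (val x)" for x
  proof -
    have "0 \<le> b / r * (L2_dist B x x\<^sub>0)\<^sup>2" using br by (intro mult_nonneg_nonneg) auto
    then show ?thesis unfolding G_def by (simp add: mult_left_le)
  qed
  have bdd: "bdd_above (G ` V)" using order_trans[OF Gval norm_val_le] by (auto intro!: bdd_aboveI)
  have Gm: "G x \<le> m" if "x \<in> V" for x unfolding m_def using that bdd by (auto intro: cSup_upper)
  assume "\<not> ?thesis"
  then have "G x > max (2 * M * exp (- b * r)) (2 * \<epsilon>)" unfolding G_def by linarith
  then have m: "m > 2 * M * exp (- b * r)" "m > 2 * \<epsilon>" using Gm[OF x] by auto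
  have m0: "m > 0" using m(2) \<epsilon> by simp
  have "0.9 * m < m" using m0 by simp
  \<comment> \<open>The supremum need not be attained, hence the margin 0.9.\<close>
  then obtain x1 where x1: "x1 \<in> V" "G x1 > 0.9 * m"
    using less_cSup_iff[OF _ bdd, of "0.9 * m"] x by (auto simp: m_def)
  define w where "w = L2_dist B x1 x\<^sub>0"
  \<comment> \<open>Outside the ball, where no net is given, the weight alone keeps \<open>G\<close>
    below \<open>m / 2\<close>.\<close>
  have "w \<le> r"
  proof (rule ccontr)
    assume "\<not> w \<le> r"
    then have "r\<^sup>2 \<le> w\<^sup>2" using r by (intro power_mono) auto
    then have "b / r * r\<^sup>2 \<le> b / r * w\<^sup>2" using br by (intro mult_left_mono) auto
    then have "- (b / r) * w\<^sup>2 \<le> - b * r" using r by (simp add: power2_eq_square)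
    then have "G x1 \<le> M * exp (- b * r)"
      unfolding G_def w_def[symmetric] using norm_val_le M0 by (intro mult_mono) auto
    then show False using m m0 x1(2) by linarith
  qed
  then obtain p where p: "p \<in> V" "L2_dist B p x1 \<le> \<rho>" "cmod (val p) \<le> \<epsilon>"
    using net[OF x1(1)] by (auto simp: w_def \<rho>_def)
  define u where "u = (\<lambda>b. p b - x1 b)"
  define q0 where "q0 = (\<Sum>b\<in>B. (x1 b - x\<^sub>0 b)\<^sup>2)"
  define q1 where "q1 = (\<Sum>b\<in>B. (x1 b - x\<^sub>0 b) * u b)"
  define q2 where "q2 = (\<Sum>b\<in>B. (u b)\<^sup>2)"
  have uB: "L2_set u B \<le> \<rho>" "L2_set u B \<ge> 0" using p by (auto simp: u_def)
  have q2: "q2 = (L2_set u B)\<^sup>2" by (simp add: q2_def L2_set_def sum_nonneg)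
  have q: "q0 + 2 * t * q1 + t\<^sup>2 * q2 = (L2_set (\<lambda>b. (x1 b + t * u b) - x\<^sub>0 b) B)\<^sup>2" for t
  proof -
    have "(L2_set (\<lambda>b. (x1 b + t * u b) - x\<^sub>0 b) B)\<^sup>2 = (\<Sum>b\<in>B. ((x1 b + t * u b) - x\<^sub>0 b)\<^sup>2)"
      by (simp add: L2_set_def sum_nonneg)
    then show ?thesis
      unfolding q0_def q1_def q2_def
      by (simp add: sum_distrib_left sum.distrib[symmetric] power2_eq_square algebra_simps)
  qed
  \<comment> \<open>The squared distance is a real quadratic polynomial along the line through
    \<open>x1\<close> and \<open>p\<close>. Inserting a complex variable gives an entire function
    with modulus \<open>G\<close> on the real axis, \<open>x1\<close> at 0 and \<open>p\<close> at
    1.\<close>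
  define g where "g = (\<lambda>z. line x1 u z * exp (- of_real (b / r) * (of_real q0 + 2 * z * of_real q1 + z\<^sup>2 * of_real q2)))"
  have ghol: "g holomorphic_on A" for A unfolding g_def by (intro holomorphic_intros line_holomorphic)
  have greal: "cmod (g (of_real t)) = G (\<lambda>b. x1 b + t * u b)" for t
  proof -
    have "of_real q0 + 2 * of_real t * of_real q1 + (of_real t)\<^sup>2 * of_real q2 = complex_of_real (q0 + 2 * t * q1 + t\<^sup>2 * q2)"
      by simp
    then have "g (of_real t) = val (\<lambda>b. x1 b + t * u b) * exp (of_real (- (b / r) * (q0 + 2 * t * q1 + t\<^sup>2 * q2)))"
      unfolding g_def line_of_real by simp
    then show ?thesis unfolding G_def q[symmetric] by (simp only: norm_mult norm_exp_eq_Re Re_complex_of_real)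
  qed
  \<comment> \<open>Up to height \<open>Y\<close> the imaginary displacement has length at most
    \<open>r\<close>, so sum and weight grow by at most \<open>exp ((\<sigma> + b) * r)\<close>. As
    \<open>M \<le> m * exp (b * r)\<close>, the bound on the strip is
    \<open>m * exp ((\<sigma> + 2 * b) * r)\<close>, that is \<open>m * exp (k * Y)\<close>.\<close>
  define Y where "Y = r / \<rho>"
  have Y: "Y > 0" using r \<rho> by (simp add: Y_def)
  define k where "k = (\<sigma> + 2 * b) * \<rho>"
  have k: "k = 1 / 16" unfolding k_def \<rho>_def using \<sigma>0 b by (simp add: field_simps)
  have uY: "L2_set u B * Y \<le> r" using uB \<rho> r by (simp add: Y_def field_simps)
  have strip: "cmod (g z) \<le> m * exp (k * Y)" if "\<bar>Im z\<bar> \<le> Y" for z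
  proof -
    have "cmod (line x1 u z) \<le> M * exp (\<sigma> * r)"
    proof -
      have "L2_set u B * \<bar>Im z\<bar> \<le> L2_set u B * Y" using that by (intro mult_left_mono) auto
      then have "\<sigma> * (L2_set u B * \<bar>Im z\<bar>) \<le> \<sigma> * r" using uY \<sigma>0 by (intro mult_left_mono) auto
      then have "M * exp (\<sigma> * L2_set u B * \<bar>Im z\<bar>) \<le> M * exp (\<sigma> * r)" using M0 by (simp add: mult.assoc)
      then show ?thesis using norm_line_le[of x1 u z] by linarith
    qed
    moreover have "cmod (exp (- of_real (b / r) * (of_real q0 + 2 * z * of_real q1 + z\<^sup>2 * of_real q2))) \<le> exp (b * r)"
    proof -
      have "q0 + 2 * Re z * q1 + ((Re z)\<^sup>2 - (Im z)\<^sup>2) * q2 \<ge> - (Im z)\<^sup>2 * q2"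
        using q[of "Re z"] zero_le_power2[of "L2_set (\<lambda>b. (x1 b + Re z * u b) - x\<^sub>0 b) B"]
        by (simp add: algebra_simps)
      moreover have "(Im z)\<^sup>2 * q2 \<le> r\<^sup>2"
      proof -
        have "\<bar>Im z\<bar> * L2_set u B \<le> Y * L2_set u B" using that by (intro mult_right_mono) auto
        then have "(\<bar>Im z\<bar> * L2_set u B)\<^sup>2 \<le> r\<^sup>2" using uY by (intro power_mono) (auto simp: mult.commute)
        then show ?thesis by (simp add: q2 power_mult_distrib)
      qed
      ultimately have "- (q0 + 2 * Re z * q1 + ((Re z)\<^sup>2 - (Im z)\<^sup>2) * q2) \<le> r\<^sup>2" by simp
      then have "b / r * - (q0 + 2 * Re z * q1 + ((Re z)\<^sup>2 - (Im z)\<^sup>2) * q2) \<le> b / r * r\<^sup>2"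
        using br by (intro mult_left_mono) auto
      also have "b / r * r\<^sup>2 = b * r" using r by (simp add: power2_eq_square)
      finally have "Re (- of_real (b / r) * (of_real q0 + 2 * z * of_real q1 + z\<^sup>2 * of_real q2)) \<le> b * r"
        by (simp add: power2_eq_square algebra_simps diff_divide_distrib)
      then show ?thesis by (simp only: norm_exp_eq_Re exp_le_cancel_iff)
    qed
    ultimately have "cmod (g z) \<le> (M * exp (\<sigma> * r)) * exp (b * r)"
      unfolding g_def norm_mult using M0 by (intro mult_mono) auto
    also have "\<dots> = M * exp (- b * r) * exp ((\<sigma> + 2 * b) * r)"
      by (simp add: mult.assoc exp_add[symmetric] algebra_simps)
    also have "\<dots> \<le> m * exp ((\<sigma> + 2 * b) * r)" using m m0 M0
      by (intro mult_right_mono) (auto intro: order_trans[OF _ less_imp_le[OF m(1)]])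
    also have "(\<sigma> + 2 * b) * r = k * Y" using \<rho> by (simp add: k_def Y_def)
    finally show ?thesis .
  qed
  have Y8: "Y \<ge> 8"
  proof -
    have "1 \<le> \<sigma> * r + 2 * (b * r)" using b \<sigma>0 r by (smt (verit) mult_pos_pos)
    moreover have "Y = 16 * (\<sigma> * r + 2 * (b * r))" by (simp add: Y_def \<rho>_def algebra_simps)
    ultimately show ?thesis using mult_left_mono[of 1 "\<sigma> * r + 2 * (b * r)" 16] by simp
  qed
  \<comment> \<open>With \<open>k = 1 / 16\<close> the three lines theorem costs only
    \<open>exp (1 / 2)\<close> at height 8, the radius of the discs for Cauchy's inequality.\<close>
  have gm: "cmod (g z) \<le> m * 1.8" if "\<bar>Im z\<bar> \<le> 8" for z
  proof -
    have "cmod (g z) \<le> m * exp (k * \<bar>Im z\<bar>)"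
    proof (rule three_lines[OF ghol Y])
      show "cmod (g (of_real x)) \<le> m" for x
        unfolding greal using affine[OF x1(1) p(1)] by (intro Gm) (simp add: u_def)
    qed (use strip that Y8 m0 in auto)
    also have "\<dots> \<le> m * exp (1/2)" using that m0 by (simp add: k)
    also have "\<dots> \<le> m * 1.8"
    proof -
      have "(exp (1/2))\<^sup>2 \<le> (1.8::real)\<^sup>2"
        using exp_le by (simp add: power2_eq_square exp_add[symmetric])
      then have "exp (1/2) \<le> (1.8::real)" by (rule power2_le_imp_le) simp
      then show ?thesis using m0 by (intro mult_left_mono) auto
    qed
    finally show ?thesis .
  qed
  have deriv: "cmod (deriv g z) \<le> m * 1.8 / 8" if "Im z = 0" for z
  proof -
    have "cmod ((deriv ^^ 1) g z) \<le> fact 1 * (m * 1.8) / 8 ^ 1"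
    proof (rule Cauchy_inequality[OF ghol])
      show "continuous_on (cball z 8) g" using ghol by (rule holomorphic_on_imp_continuous_on)
      fix x assume "cmod (z - x) = 8"
      then have "\<bar>Im x\<bar> \<le> 8" using abs_Im_le_cmod[of "z - x"] that by simp
      then show "cmod (g x) \<le> m * 1.8" by (rule gm)
    qed simp
    then show ?thesis by simp
  qed
  \<comment> \<open>On the way from \<open>x1\<close> to \<open>p\<close> the modulus drops by at
    most \<open>0.225 * m\<close>, yet it starts above \<open>0.9 * m\<close> and ends at most at
    \<open>\<epsilon> < 0.5 * m\<close>.\<close>
  have "cmod (g 0 - g 1) \<le> m * 1.8 / 8 * cmod (0 - 1)"
  proof (rule field_differentiable_bound[where S = "{z. Im z = 0}" and f' = "deriv g"])
    show "convex {z. Im z = 0}" by (simp add: convex_def)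
    show "(g has_field_derivative deriv g z) (at z within {z. Im z = 0})" if "z \<in> {z. Im z = 0}" for z
      using holomorphic_derivI[OF ghol[of UNIV]] by (auto intro: has_field_derivative_at_within)
  qed (use deriv in auto)
  then have "cmod (g 0 - g 1) \<le> m * 1.8 / 8" by simp
  moreover have "cmod (g 0) = G x1" using greal[of 0] by simp
  moreover have "cmod (g 1) \<le> \<epsilon>"
  proof -
    have "cmod (g 1) = G p" using greal[of 1] by (simp add: u_def)
    then show ?thesis using Gval[of p] p(3) by simp
  qed
  ultimately have "G x1 \<le> \<epsilon> + m * 1.8 / 8" using norm_triangle_ineq2[of "g 0" "g 1"] by linarith
  then show False using x1(2) m(2) m0 by simp
qed

text \<open>On the real line through \<open>x\<^sub>0\<close> the weighted sum is at most
  \<open>2 * M * exp (- b * r)\<close> by the net bound. Three lines allow growth at the rate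
  \<open>\<sigma> + 2 * b \<le> 3 * b\<close>, so at height \<open>r / 4\<close> a quarter of the
  decay remains. The weight can then be dropped, as its modulus at imaginary points is at least
  1.\<close>

lemma gaussian_net_bound_cone:
  fixes V :: "('b \<Rightarrow> real) set" and x\<^sub>0 :: "'b \<Rightarrow> real" and b r \<epsilon> :: real
  assumes affine: "\<And>x x' t. \<lbrakk>x \<in> V; x' \<in> V\<rbrakk> \<Longrightarrow> (\<lambda>b. x b + t * (x' b - x b)) \<in> V"
    and x\<^sub>0: "x\<^sub>0 \<in> V" and r: "r > 0" and b: "b \<ge> \<sigma>" "b * r \<ge> 1" and \<epsilon>: "\<epsilon> \<ge> 0" "\<epsilon> \<le> M * exp (- b * r)"
    and net: "\<And>x. \<lbrakk>x \<in> V; L2_dist B x x\<^sub>0 \<le> r\<rbrakk> \<Longrightarrow>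
      \<exists>p\<in>V. L2_dist B p x \<le> 1 / (16 * (\<sigma> + 2 * b)) \<and> cmod (val p) \<le> \<epsilon>"
    and v: "L2_set v B = 1" "\<And>t. (\<lambda>b. x\<^sub>0 b + t * v b) \<in> V"
    and \<eta>: "\<bar>\<eta>\<bar> \<le> r / 4"
  shows "cmod (line x\<^sub>0 v (\<i> * of_real \<eta>)) \<le> 2 * M * exp (- b * r / 4)"
proof -
  define g where "g = (\<lambda>z. line x\<^sub>0 v z * exp (- of_real (b / r) * z\<^sup>2))"
  have b0: "b > 0" using b \<sigma>0 by linarith
  have br: "b / r > 0" using b0 r by simp
  have ghol: "g holomorphic_on UNIV" unfolding g_def by (intro holomorphic_intros line_holomorphic)
  define m where "m = 2 * M * exp (- b * r)"
  have g: "cmod (g (\<i> * of_real \<eta>)) \<le> m * exp ((\<sigma> + 2 * b) * \<bar>Im (\<i> * of_real \<eta>)\<bar>)"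
  proof (rule three_lines[OF ghol r])
    show "m \<ge> 0" using M0 by (simp add: m_def)
    show "\<bar>Im (\<i> * of_real \<eta>)\<bar> \<le> r" using \<eta> r by simp
    show "cmod (g (of_real t)) \<le> m" for t
    proof -
      have n: "(L2_set (\<lambda>b. x\<^sub>0 b + t * v b - x\<^sub>0 b) B)\<^sup>2 = t\<^sup>2"
        using v(1) by (simp add: L2_set_def power_mult_distrib sum_distrib_left[symmetric])
      have e: "cmod (exp (- of_real (b / r) * (of_real t)\<^sup>2)) = exp (- (b / r) * t\<^sup>2)"
        by (simp add: power2_eq_square)
      have "cmod (g (of_real t)) = cmod (val (\<lambda>b. x\<^sub>0 b + t * v b)) * exp (- (b / r) * (L2_set (\<lambda>b. x\<^sub>0 b + t * v b - x\<^sub>0 b) B)\<^sup>2)"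
        unfolding n g_def line_of_real norm_mult e ..
      also have "\<dots> \<le> max (2 * M * exp (- b * r)) (2 * \<epsilon>)"
        by (rule gaussian_net_bound[OF affine x\<^sub>0 r b0 b(2) \<epsilon>(1) net v(2)])
      also have "\<dots> = m" using \<epsilon> by (simp add: m_def)
      finally show ?thesis .
    qed
    show "cmod (g z) \<le> m * exp ((\<sigma> + 2 * b) * r)" if "\<bar>Im z\<bar> \<le> r" for z
    proof -
      have "\<sigma> * \<bar>Im z\<bar> \<le> \<sigma> * r" using that \<sigma>0 by (intro mult_left_mono) auto
      then have "M * exp (\<sigma> * L2_set v B * \<bar>Im z\<bar>) \<le> M * exp (\<sigma> * r)" using M0 v by simp
      then have "cmod (line x\<^sub>0 v z) \<le> M * exp (\<sigma> * r)" using norm_line_le[of x\<^sub>0 v z] by linarith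
      moreover have "cmod (exp (- of_real (b / r) * z\<^sup>2)) \<le> exp (b * r)"
      proof -
        have "\<bar>Im z\<bar>\<^sup>2 \<le> r\<^sup>2" using that by (intro power_mono) auto
        then have "- ((Re z)\<^sup>2 - (Im z)\<^sup>2) \<le> r\<^sup>2" using zero_le_power2[of "Re z"] unfolding power2_abs by linarith
        then have "b / r * - ((Re z)\<^sup>2 - (Im z)\<^sup>2) \<le> b / r * r\<^sup>2" using br by (intro mult_left_mono) auto
        also have "b / r * r\<^sup>2 = b * r" using r by (simp add: power2_eq_square)
        finally have "Re (- of_real (b / r) * z\<^sup>2) \<le> b * r"
          by (simp only: minus_mult_left[symmetric] uminus_complex.sel Re_complex_of_real
            Im_complex_of_real times_complex.sel power2_eq_square)
        then show ?thesis by (simp only: norm_exp_eq_Re exp_le_cancel_iff)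
      qed
      ultimately have "cmod (g z) \<le> (M * exp (\<sigma> * r)) * exp (b * r)"
        unfolding g_def norm_mult using M0 by (intro mult_mono) auto
      also have "\<dots> = M * exp (- b * r) * exp ((\<sigma> + 2 * b) * r)"
        by (simp add: mult.assoc exp_add[symmetric] algebra_simps)
      also have "\<dots> \<le> m * exp ((\<sigma> + 2 * b) * r)" using M0
        by (intro mult_right_mono) (auto simp: m_def)
      finally show ?thesis .
    qed
  qed
  have "cmod (line x\<^sub>0 v (\<i> * of_real \<eta>)) \<le> cmod (g (\<i> * of_real \<eta>))"
  proof -
    have "0 \<le> (b / r) * \<eta>\<^sup>2" using br by (intro mult_nonneg_nonneg) auto
    then have "1 \<le> cmod (exp (- of_real (b / r) * (\<i> * of_real \<eta>)\<^sup>2))"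
      by (simp add: power2_eq_square mult.assoc)
    then have "cmod (line x\<^sub>0 v (\<i> * of_real \<eta>)) * 1 \<le> cmod (g (\<i> * of_real \<eta>))"
      unfolding g_def norm_mult by (intro mult_left_mono) auto
    then show ?thesis by simp
  qed
  also have "\<dots> \<le> m * exp ((\<sigma> + 2 * b) * \<bar>\<eta>\<bar>)" using g by simp
  also have "\<dots> = 2 * M * exp (- b * r + (\<sigma> + 2 * b) * \<bar>\<eta>\<bar>)"
    by (simp only: m_def exp_add mult.assoc)
  also have "\<dots> \<le> 2 * M * exp (- b * r / 4)"
  proof -
    have "(\<sigma> + 2 * b) * \<bar>\<eta>\<bar> \<le> (3 * b) * (r / 4)" using b b0 \<eta> \<sigma>0 by (intro mult_mono) auto
    then show ?thesis using M0 by simp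
  qed
  finally show ?thesis .
qed

end

section \<open>Coordinates of Meyer sets\<close>

lemma finite_uniform_discrete_bounded:
  fixes A :: "'a::euclidean_space set"
  assumes "uniform_discrete A" "bounded T"
  shows "finite (A \<inter> T)"
proof (rule ccontr)
  assume inf: "infinite (A \<inter> T)"
  have ud: "uniform_discrete (A \<inter> T)" using assms(1) unfolding uniform_discrete_def by blast
  have "compact (A \<inter> T)"
    using uniform_discrete_imp_closed[OF ud] assms(2) by (simp add: compact_eq_bounded_closed bounded_Int)
  then obtain x where x: "x \<in> A \<inter> T" "x islimpt (A \<inter> T)"
    using inf unfolding compact_eq_Bolzano_Weierstrass by blast
  then have "\<forall>\<^sub>F y in at x. y \<notin> A \<inter> T"
    using uniform_discrete_imp_discrete[OF ud] unfolding discrete_altdef by blast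
  then show False using x(2) unfolding islimpt_iff_eventually by blast
qed

section \<open>Integer combinations of independent vectors\<close>

definition int_comb :: "'a::real_vector set \<Rightarrow> ('a \<Rightarrow> int) \<Rightarrow> 'a" where
  "int_comb B k = (\<Sum>b\<in>B. of_int (k b) *\<^sub>R b)"

definition int_independent :: "'a::real_vector set \<Rightarrow> bool" where
  "int_independent B \<longleftrightarrow> (\<forall>k. int_comb B k = 0 \<longrightarrow> (\<forall>b\<in>B. k b = 0))"

lemma int_comb_add: "int_comb B (\<lambda>b. k b + l b) = int_comb B k + int_comb B l"
  by (simp add: int_comb_def scaleR_add_left sum.distrib)

lemma int_comb_diff: "int_comb B (\<lambda>b. k b - l b) = int_comb B k - int_comb B l"
  by (simp add: int_comb_def scaleR_diff_left sum_subtractf)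

lemma int_comb_mult: "int_comb B (\<lambda>b. q * k b) = of_int q *\<^sub>R int_comb B k"
  by (simp add: int_comb_def scaleR_sum_right)

lemma int_comb_unique:
  assumes "int_independent B" "int_comb B k = int_comb B l" "b \<in> B"
  shows "k b = l b"
proof -
  have "int_comb B (\<lambda>b. k b - l b) = 0" using assms(2) by (simp add: int_comb_diff)
  then have "k b - l b = 0" using assms(1,3) unfolding int_independent_def by (metis (no_types, lifting))
  then show ?thesis by simp
qed

text \<open>Induction on \<open>X\<close>. A new vector with a nonzero multiple \<open>q\<close>
  times itself in the span is reached by dividing all generators by \<open>q\<close>; any other
  vector is itself a new independent generator. Dividing is allowed because the span may be larger
  than the group generated by \<open>X\<close>.\<close>

lemma ex_int_independent_generators:
  fixes X :: "'a::real_vector set"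
  assumes "finite X"
  shows "\<exists>B. finite B \<and> int_independent B \<and> X \<subseteq> range (int_comb B)"
  using assms
proof induction
  case empty
  show ?case by (intro exI[of _ "{}"]) (simp add: int_independent_def)
next
  case (insert x X)
  then obtain B where B: "finite B" "int_independent B" "X \<subseteq> range (int_comb B)" by blast
  show ?case
  proof (cases "\<exists>q k. q \<noteq> (0::int) \<and> of_int q *\<^sub>R x = int_comb B k")
    case True
    then obtain q k where q: "q \<noteq> 0" "of_int q *\<^sub>R x = int_comb B k" by blast
    define s where "s = (\<lambda>b::'a. (1 / of_int q :: real) *\<^sub>R b)"
    have inj: "inj_on s B" using q by (auto simp: s_def inj_on_def)
    have comb: "int_comb (s ` B) k' = (1 / of_int q) *\<^sub>R int_comb B (\<lambda>b. k' (s b))" for k'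
      unfolding int_comb_def by (simp add: sum.reindex[OF inj] scaleR_sum_right) (simp add: s_def)
    have rng: "(1 / of_int q :: real) *\<^sub>R int_comb B k' \<in> range (int_comb (s ` B))" for k'
    proof -
      have "int_comb (s ` B) (k' \<circ> the_inv_into B s) = (1 / of_int q) *\<^sub>R int_comb B k'"
        unfolding comb unfolding int_comb_def by (simp add: the_inv_into_f_f[OF inj])
      then show ?thesis by (metis rangeI)
    qed
    show ?thesis
    proof (intro exI conjI)
      show "finite (s ` B)" using B by simp
      show "int_independent (s ` B)"
        unfolding int_independent_def comb
      proof (intro allI impI ballI)
        fix k' b assume "(1 / real_of_int q) *\<^sub>R int_comb B (\<lambda>b. k' (s b)) = 0" and b: "b \<in> s ` B"
        then have "int_comb B (\<lambda>b. k' (s b)) = 0" using q by simp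
        then show "k' b = 0" using B(2) b unfolding int_independent_def by blast
      qed
      show "insert x X \<subseteq> range (int_comb (s ` B))"
      proof
        fix y assume "y \<in> insert x X"
        then obtain k' where "y = (1 / of_int q :: real) *\<^sub>R int_comb B k'"
        proof
          assume "y = x"
          then have "y = (1 / of_int q :: real) *\<^sub>R int_comb B k" using q by (simp flip: q(2))
          then show thesis by (rule that)
        next
          assume "y \<in> X"
          then obtain k' where "y = int_comb B k'" using B(3) by blast
          then have "y = (1 / of_int q :: real) *\<^sub>R int_comb B (\<lambda>b. q * k' b)" using q by (simp add: int_comb_mult)
          then show thesis by (rule that)
        qed
        then show "y \<in> range (int_comb (s ` B))" using rng by simp
      qed
    qed
  next
    case False
    have xB: "x \<notin> B"
    proof
      assume "x \<in> B"
      then have "int_comb B (\<lambda>b. if b = x then 1 else 0) = x"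
        using B(1) by (simp add: int_comb_def if_distrib[of "\<lambda>z. of_int z *\<^sub>R _"] cong: if_cong)
      then have "of_int 1 *\<^sub>R x = int_comb B (\<lambda>b. if b = x then 1 else 0)" by simp
      then show False using False zero_neq_one by metis
    qed
    have comb: "int_comb (insert x B) k = of_int (k x) *\<^sub>R x + int_comb B k" for k
      using B xB by (simp add: int_comb_def)
    show ?thesis
    proof (intro exI conjI)
      show "finite (insert x B)" using B by simp
      show "int_independent (insert x B)"
        unfolding int_independent_def comb
      proof (intro allI impI ballI)
        fix k b assume 0: "real_of_int (k x) *\<^sub>R x + int_comb B k = 0" and b: "b \<in> insert x B"
        then have "real_of_int (k x) *\<^sub>R x = int_comb B (\<lambda>b. (-1) * k b)"
          unfolding int_comb_mult by (simp add: eq_neg_iff_add_eq_0)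
        then have kx: "k x = 0" using False by blast
        then have "int_comb B k = 0" using 0 by simp
        then show "k b = 0" using b kx B(2) unfolding int_independent_def by blast
      qed
      show "insert x X \<subseteq> range (int_comb (insert x B))"
      proof
        fix y assume "y \<in> insert x X"
        then show "y \<in> range (int_comb (insert x B))"
        proof
          assume "y = x"
          have "int_comb B (\<lambda>b. if b = x then 1 else 0) = 0"
            unfolding int_comb_def using xB by (intro sum.neutral) auto
          then have "int_comb (insert x B) (\<lambda>b. if b = x then 1 else 0) = y"
            unfolding comb by (simp add: \<open>y = x\<close>)
          then show ?thesis by (metis rangeI)
        next
          assume "y \<in> X"
          then obtain k where k: "y = int_comb B k" using B(3) by blast
          have "int_comb B (k(x := 0)) = int_comb B k"
            unfolding int_comb_def using xB by (intro sum.cong) auto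
          then have "int_comb (insert x B) (k(x := 0)) = y" unfolding comb by (simp add: k)
          then show ?thesis by (metis rangeI)
        qed
      qed
    qed
  qed
qed

text \<open>Hyers: the linear map is the limit of \<open>f (2\<^sup>k x) / 2\<^sup>k\<close>.\<close>
lemma approximately_additive_near_linear:
  fixes f :: "'a::euclidean_space \<Rightarrow> real"
  assumes add: "\<And>x y. \<bar>f x + f y - f (x + y)\<bar> \<le> C"
    and bdd: "\<And>r. \<exists>K. \<forall>x. norm x \<le> r \<longrightarrow> \<bar>f x\<bar> \<le> K"
  obtains \<alpha> where "\<And>x. \<bar>f x - \<alpha> \<bullet> x\<bar> \<le> C"
proof -
  define g where "g = (\<lambda>k::nat. \<lambda>x. f (2 ^ k *\<^sub>R x) / 2 ^ k)"
  have C0: "C \<ge> 0" using add[of 0 0] abs_ge_zero order_trans by blast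
  have step: "\<bar>g (Suc k) x - g k x\<bar> \<le> C * (1 / 2) ^ Suc k" for k x
  proof -
    have "\<bar>2 * f (2 ^ k *\<^sub>R x) - f (2 ^ Suc k *\<^sub>R x)\<bar> \<le> C"
      using add[of "2 ^ k *\<^sub>R x" "2 ^ k *\<^sub>R x"] by (simp add: scaleR_add_left[symmetric])
    moreover have "g (Suc k) x - g k x = (f (2 ^ Suc k *\<^sub>R x) - 2 * f (2 ^ k *\<^sub>R x)) * (1 / 2) ^ Suc k"
      by (simp add: g_def field_simps)
    ultimately show ?thesis
      by (simp only: abs_mult) (simp add: abs_minus_commute)
  qed
  have geo: "summable (\<lambda>k. C * (1 / 2) ^ Suc k)" "(\<Sum>k. C * (1 / 2) ^ Suc k) = C"
    using sums_mult[OF power_half_series, of C] by (auto simp: sums_iff)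
  have sm: "summable (\<lambda>k. \<bar>g (Suc k) x - g k x\<bar>)" for x
    using step by (intro summable_comparison_test'[OF geo(1)]) auto
  define A where "A = (\<lambda>x. f x + (\<Sum>k. g (Suc k) x - g k x))"
  have gA: "(\<lambda>k. g k x) \<longlonglongrightarrow> A x" for x
  proof -
    have "(\<lambda>n. g n x - g 0 x) \<longlonglongrightarrow> (\<Sum>k. g (Suc k) x - g k x)"
      using summable_LIMSEQ[OF summable_rabs_cancel[OF sm, of x]]
      by (simp only: sum_lessThan_telescope[of "\<lambda>k. g k x"])
    then have "(\<lambda>n. f x + (g n x - g 0 x)) \<longlonglongrightarrow> A x"
      unfolding A_def by (intro tendsto_intros)
    then show ?thesis by (simp add: g_def)
  qed
  have near: "\<bar>f x - A x\<bar> \<le> C" for x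
  proof -
    have "\<bar>\<Sum>k. g (Suc k) x - g k x\<bar> \<le> (\<Sum>k. \<bar>g (Suc k) x - g k x\<bar>)" by (rule summable_rabs[OF sm])
    also have "\<dots> \<le> (\<Sum>k. C * (1 / 2) ^ Suc k)" by (rule suminf_le[OF step sm geo(1)])
    finally have "\<bar>\<Sum>k. g (Suc k) x - g k x\<bar> \<le> C" unfolding geo(2) .
    then show ?thesis by (simp add: A_def)
  qed
  have A_add: "A (x + y) = A x + A y" for x y
  proof -
    have "(\<lambda>k. g k x + g k y - g k (x + y)) \<longlonglongrightarrow> A x + A y - A (x + y)"
      by (intro tendsto_intros gA)
    moreover have "(\<lambda>k. g k x + g k y - g k (x + y)) \<longlonglongrightarrow> 0"
    proof (rule Lim_null_comparison)
      show "\<forall>\<^sub>F k in sequentially. norm (g k x + g k y - g k (x + y)) \<le> C * (1 / 2) ^ k"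
      proof (rule always_eventually, rule allI)
        fix k
        have "g k x + g k y - g k (x + y) = (f (2 ^ k *\<^sub>R x) + f (2 ^ k *\<^sub>R y) - f (2 ^ k *\<^sub>R x + 2 ^ k *\<^sub>R y)) * (1 / 2) ^ k"
          by (simp add: g_def field_simps scaleR_add_right)
        then show "norm (g k x + g k y - g k (x + y)) \<le> C * (1 / 2) ^ k"
          using add[of "2 ^ k *\<^sub>R x" "2 ^ k *\<^sub>R y"] by (simp only: real_norm_def abs_mult) (simp add: divide_right_mono)
      qed
      show "(\<lambda>k. C * (1 / 2) ^ k) \<longlonglongrightarrow> 0" by (intro tendsto_mult_right_zero LIMSEQ_power_zero) auto
    qed
    ultimately show ?thesis using LIMSEQ_unique by fastforce
  qed
  have A0: "A 0 = 0" using A_add[of 0 0] by simp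
  have Anat: "A (real n *\<^sub>R x) = real n * A x" for n x
    by (induction n) (auto simp: A0 A_add scaleR_add_left algebra_simps)
  have Aneg: "A (- x) = - A x" for x using A_add[of x "- x"] A0 by simp
  have Aint: "A (of_int m *\<^sub>R x) = of_int m * A x" for m x
  proof (cases "m \<ge> 0")
    case True
    then show ?thesis using Anat[of "nat m" x] by simp
  next
    case False
    then have "A (- (real (nat (- m)) *\<^sub>R x)) = - (real (nat (- m)) * A x)" by (simp only: Aneg Anat)
    then show ?thesis using False by simp
  qed
  \<comment> \<open>Additivity alone gives homogeneity over the integers. For real \<open>r\<close>
    the fractional part of \<open>n * r\<close> contributes a bounded amount, as \<open>A\<close> is
    bounded on the segment from 0 to \<open>x\<close>; so \<open>n\<close> times the defect stays
    bounded and the defect is 0.\<close>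
  have Areal: "A (r *\<^sub>R x) = r * A x" for r x
  proof -
    obtain K where K: "\<And>y. norm y \<le> norm x \<Longrightarrow> \<bar>f y\<bar> \<le> K" using bdd by blast
    have KA: "\<bar>A (t *\<^sub>R x)\<bar> \<le> K + C" if "0 \<le> t" "t \<le> 1" for t
    proof -
      have "norm (t *\<^sub>R x) \<le> norm x" using that by (simp add: mult_left_le_one_le)
      then show ?thesis using K near[of "t *\<^sub>R x"] by fastforce
    qed
    have "real n * \<bar>A (r *\<^sub>R x) - r * A x\<bar> \<le> 2 * (K + C)" for n
    proof -
      define m where "m = \<lfloor>real n * r\<rfloor>"
      define t where "t = real n * r - of_int m"
      have t: "0 \<le> t" "t \<le> 1" by (auto simp: t_def m_def) linarith
      have "real n * A (r *\<^sub>R x) = A ((of_int m + t) *\<^sub>R x)" unfolding Anat[symmetric] by (simp add: t_def)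
      also have "\<dots> = of_int m * A x + A (t *\<^sub>R x)" by (simp add: scaleR_add_left A_add Aint)
      finally have eq: "real n * (A (r *\<^sub>R x) - r * A x) = A (t *\<^sub>R x) - t * A x"
        by (simp add: t_def algebra_simps)
      have "\<bar>t * A x\<bar> \<le> K + C"
      proof -
        have "t * \<bar>A x\<bar> \<le> 1 * \<bar>A x\<bar>" using t by (intro mult_right_mono) auto
        then show ?thesis using KA[of 1] t by (simp add: abs_mult)
      qed
      then have "\<bar>real n * (A (r *\<^sub>R x) - r * A x)\<bar> \<le> (K + C) + (K + C)"
        unfolding eq using KA[OF t] by (intro order_trans[OF abs_triangle_ineq4] add_mono)
      then show ?thesis by (simp add: abs_mult)
    qed
    note le = this
    have "\<bar>A (r *\<^sub>R x) - r * A x\<bar> = 0"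
      by (rule real_archimedian_rdiv_eq_0[where c = "2 * (K + C)"]) (use le le[of 0] in auto)
    then show ?thesis by simp
  qed
  interpret A: linear A by (rule linearI) (auto simp: A_add Areal)
  define \<alpha> where "\<alpha> = (\<Sum>i\<in>Basis. A i *\<^sub>R i)"
  have "A x = \<alpha> \<bullet> x" for x
  proof -
    have "A x = A (\<Sum>i\<in>Basis. (x \<bullet> i) *\<^sub>R i)" by (simp add: euclidean_representation)
    also have "\<dots> = (\<Sum>i\<in>Basis. (x \<bullet> i) * A i)" by (simp add: A.sum A.scale)
    also have "\<dots> = \<alpha> \<bullet> x" by (simp add: \<alpha>_def inner_sum_left inner_commute[of x] mult.commute)
    finally show ?thesis .
  qed
  then show ?thesis using near by (intro that[of \<alpha>]) simp
qed

text \<open>Short differences are finite in number and generate everything by chaining, so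
  coordinates exist. Moving each vector to a nearby point of \<open>\<Lambda>\<close> makes its
  coordinates approximately additive with finitely many defects, hence close to linear
  functionals.\<close>

lemma approximately_linear_coordinates:
  fixes \<Lambda> :: "'a::euclidean_space set"
  assumes "meyer_set \<Lambda>"
  obtains B :: "'a set" and \<phi> :: "'a \<Rightarrow> 'a \<Rightarrow> int" and \<alpha> :: "'a \<Rightarrow> 'a" and C :: real
  where "finite B" "int_independent B"
    "\<And>l. l \<in> \<Lambda> \<Longrightarrow> int_comb B (\<phi> l) = l"
    "\<And>l b. \<lbrakk>l \<in> \<Lambda>; b \<in> B\<rbrakk> \<Longrightarrow> \<bar>of_int (\<phi> l b) - \<alpha> b \<bullet> l\<bar> \<le> C"
    "\<And>x. (\<Sum>b\<in>B. (\<alpha> b \<bullet> x) *\<^sub>R b) = x"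
proof -
  have ud: "uniform_discrete \<Lambda>" and "relatively_dense \<Lambda>" using assms by (auto simp: meyer_set_def delone_def)
  then obtain R where R: "R > 0" "\<And>x. ball x R \<inter> \<Lambda> \<noteq> {}" unfolding relatively_dense_def by blast
  obtain F where F: "finite F" "{x - y |x y. x \<in> \<Lambda> \<and> y \<in> \<Lambda>} \<subseteq> {z + f |z f. z \<in> \<Lambda> \<and> f \<in> F}"
    using assms by (auto simp: meyer_set_def)
  have diff: "\<exists>z f. z \<in> \<Lambda> \<and> f \<in> F \<and> x - y = z + f" if "x \<in> \<Lambda>" "y \<in> \<Lambda>" for x y
    using F(2) that by blast
  have fin: "finite ({z + f |z f. z \<in> \<Lambda> \<and> f \<in> F'} \<inter> ball 0 r)" if F': "finite F'" for F' r
  proof -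
    have "bounded F'" using F' by (rule finite_imp_bounded)
    then obtain K where K: "\<And>f. f \<in> F' \<Longrightarrow> norm f \<le> K" unfolding bounded_iff by blast
    have "{z + f |z f. z \<in> \<Lambda> \<and> f \<in> F'} \<inter> ball 0 r \<subseteq> (\<lambda>(z, f). z + f) ` ((\<Lambda> \<inter> ball 0 (r + K)) \<times> F')"
    proof (clarsimp)
      fix z f assume zf: "z \<in> \<Lambda>" "f \<in> F'" "norm (z + f) < r"
      have "norm z < r + K" using zf K[of f] norm_triangle_ineq4[of "z + f" f] by simp
      then show "z + f \<in> (\<lambda>(z, f). z + f) ` ((\<Lambda> \<inter> ball 0 (r + K)) \<times> F')" using zf by force
    qed
    moreover have "finite (\<Lambda> \<inter> ball 0 (r + K))" by (rule finite_uniform_discrete_bounded[OF ud]) simp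
    ultimately show ?thesis using F' by (meson finite_SigmaI finite_imageI finite_subset)
  qed
  obtain l0 where l0: "l0 \<in> \<Lambda>" using R(2)[of 0] by blast
  \<comment> \<open>The radius suits the chain below: \<open>y\<close> is at distance
    \<open>R + 1\<close> from \<open>l\<close> towards \<open>l0\<close>, and \<open>l'\<close> lies
    within \<open>R\<close> of \<open>y\<close>. So \<open>l - l'\<close> is in \<open>D\<close>,
    and \<open>l'\<close> is closer to \<open>l0\<close> by at least 1.\<close>
  define D where "D = {z + f |z f. z \<in> \<Lambda> \<and> f \<in> F} \<inter> ball 0 (2 * R + 1)"
  have Ddiff: "x - y \<in> D" if "x \<in> \<Lambda>" "y \<in> \<Lambda>" "norm (x - y) < 2 * R + 1" for x y
    using diff[OF that(1,2)] that(3) by (auto simp: D_def)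
  obtain B where B: "finite B" "int_independent B" "insert l0 D \<subseteq> range (int_comb B)"
    using ex_int_independent_generators[of "insert l0 D"] fin[OF F(1)] by (auto simp: D_def)
  have range_add: "x + y \<in> range (int_comb B)" if "x \<in> range (int_comb B)" "y \<in> range (int_comb B)" for x y
    using that by (auto simp flip: int_comb_add)
  have \<Lambda>B: "l \<in> range (int_comb B)" if "l \<in> \<Lambda>" for l
  proof -
    have "\<forall>l\<in>\<Lambda>. norm (l - l0) < R + 1 + real n \<longrightarrow> l \<in> range (int_comb B)" for n
    proof (induction n)
      case 0
      show ?case
      proof (intro ballI impI)
        fix l assume l: "l \<in> \<Lambda>" "norm (l - l0) < R + 1 + real 0"
        then have "l - l0 \<in> D" using Ddiff[OF l(1) l0] R by simp
        then have "(l - l0) + l0 \<in> range (int_comb B)" using B by (intro range_add) auto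
        then show "l \<in> range (int_comb B)" by simp
      qed
    next
      case (Suc n)
      show ?case
      proof (intro ballI impI)
        fix l assume l: "l \<in> \<Lambda>" "norm (l - l0) < R + 1 + real (Suc n)"
        show "l \<in> range (int_comb B)"
        proof (cases "norm (l - l0) < R + 1")
          case True
          then show ?thesis using Suc.IH l by auto
        next
          case False
          define t where "t = (R + 1) / norm (l - l0)"
          have n: "norm (l - l0) > 0" using False R by linarith
          then have t: "0 \<le> t" "t \<le> 1" using False R by (auto simp: t_def divide_le_eq)
          define y where "y = l + t *\<^sub>R (l0 - l)"
          obtain l' where l': "l' \<in> \<Lambda>" "norm (y - l') < R" using R(2)[of y] by (auto simp: dist_norm)
          have "norm (l - y) = t * norm (l - l0)" using t by (simp add: y_def norm_minus_commute)
          then have ly: "norm (l - y) = R + 1" using n by (simp add: t_def)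
          have "y - l0 = (1 - t) *\<^sub>R (l - l0)" by (simp add: y_def algebra_simps)
          then have "norm (y - l0) = (1 - t) * norm (l - l0)" using t by simp
          then have yl0: "norm (y - l0) = norm (l - l0) - (R + 1)"
            using n by (simp only: left_diff_distrib) (simp add: t_def)
          have "norm (l - l') < 2 * R + 1" using norm_triangle_ineq[of "l - y" "y - l'"] ly l' by simp
          then have "l - l' \<in> D" using Ddiff l l' by blast
          moreover have "l' \<in> range (int_comb B)"
          proof -
            have "norm (l' - l0) \<le> norm (y - l0) + norm (y - l')"
              using norm_triangle_ineq[of "y - l0" "l' - y"] by (simp add: norm_minus_commute)
            then have "norm (l' - l0) < R + 1 + real n" using yl0 l' l by simp
            then show ?thesis using Suc.IH l' by blast
          qed
          ultimately have "(l - l') + l' \<in> range (int_comb B)" using B by (intro range_add) auto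
          then show ?thesis by simp
        qed
      qed
    qed
    moreover obtain n where "norm (l - l0) < real n" using reals_Archimedean2 by blast
    then have "norm (l - l0) < R + 1 + real n" using R(1) by simp
    ultimately show ?thesis using that by blast
  qed
  define \<phi> where "\<phi> = (\<lambda>x. SOME k. int_comb B k = x)"
  have \<phi>: "int_comb B (\<phi> x) = x" if x: "x \<in> range (int_comb B)" for x
  proof -
    obtain k where "int_comb B k = x" using x by blast
    then show ?thesis unfolding \<phi>_def by (rule someI[where P = "\<lambda>k. int_comb B k = x"])
  qed
  have \<phi>_eq: "\<phi> x b = k b" if "x = int_comb B k" "b \<in> B" for x k b
    using int_comb_unique[OF B(2) _ that(2)] \<phi>[of x] that(1) by blast
  have nz: "\<exists>l. l \<in> \<Lambda> \<and> norm (x - l) < R \<and> (x \<in> \<Lambda> \<longrightarrow> l = x)" for x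
  proof (cases "x \<in> \<Lambda>")
    case True then show ?thesis using R(1) by (intro exI[of _ x]) auto
  next
    case False then show ?thesis using R(2)[of x] by (auto simp: dist_norm)
  qed
  \<comment> \<open>Fixing the points of \<open>\<Lambda>\<close> lets the estimate for
    \<open>\<phi> (N x)\<close> apply to \<open>\<phi> l\<close> itself.\<close>
  define N where "N = (\<lambda>x. SOME l. l \<in> \<Lambda> \<and> norm (x - l) < R \<and> (x \<in> \<Lambda> \<longrightarrow> l = x))"
  have N: "N x \<in> \<Lambda>" "norm (x - N x) < R" "x \<in> \<Lambda> \<Longrightarrow> N x = x" for x
    using someI_ex[OF nz[of x]] by (auto simp: N_def)
  \<comment> \<open>Three uses of the Meyer property express \<open>x + y - z\<close> by a point of
    \<open>\<Lambda>\<close> and a translation from a finite set. Since the property concerns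
    differences only, the sum \<open>x + w\<close> is turned into a difference through
    \<open>l0 - w\<close>.\<close>
  define F' where "F' = (\<lambda>(h, f, g). h + l0 - g + f) ` (F \<times> F \<times> F)"
  \<comment> \<open>The additive defect of \<open>N\<close> has norm below \<open>3 * R\<close>, so
    it takes finitely many values and its coordinates are bounded.\<close>
  define E where "E = {z + f |z f. z \<in> \<Lambda> \<and> f \<in> F'} \<inter> ball 0 (3 * R)"
  have finE: "finite E" unfolding E_def F'_def using F by (intro fin) auto
  have triple: "x + y - z \<in> {z + f |z f. z \<in> \<Lambda> \<and> f \<in> F'}" if xyz: "x \<in> \<Lambda>" "y \<in> \<Lambda>" "z \<in> \<Lambda>" for x y z
  proof -
    obtain w f where w: "w \<in> \<Lambda>" "f \<in> F" "y - z = w + f" using diff[OF xyz(2,3)] by blast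
    obtain u g where u: "u \<in> \<Lambda>" "g \<in> F" "l0 - w = u + g" using diff[OF l0 w(1)] by blast
    obtain v h where v: "v \<in> \<Lambda>" "h \<in> F" "x - u = v + h" using diff[OF xyz(1) u(1)] by blast
    have "x + y - z = x + (y - z)" by simp
    also have "\<dots> = x + (l0 - (l0 - w)) + f" using w by simp
    also have "\<dots> = (x - u) + l0 - g + f" using u by (simp add: algebra_simps)
    also have "\<dots> = v + (h + l0 - g + f)" using v by (simp add: algebra_simps)
    finally have "x + y - z = v + (h + l0 - g + f)" .
    moreover have "h + l0 - g + f \<in> F'"
      unfolding F'_def by (rule image_eqI[of _ _ "(h, f, g)"]) (use v w u in auto)
    ultimately show ?thesis using v by blast
  qed
  define C where "C = (\<Sum>e\<in>E. \<Sum>b\<in>B. \<bar>real_of_int (\<phi> e b)\<bar>)"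
  have C: "\<bar>real_of_int (\<phi> e b)\<bar> \<le> C" if "e \<in> E" "b \<in> B" for e b
  proof -
    have "\<bar>real_of_int (\<phi> e b)\<bar> \<le> (\<Sum>b\<in>B. \<bar>real_of_int (\<phi> e b)\<bar>)" using that B by (intro member_le_sum) auto
    also have "\<dots> \<le> C" unfolding C_def using that finE
      by (intro member_le_sum[of e E "\<lambda>e. \<Sum>b\<in>B. \<bar>real_of_int (\<phi> e b)\<bar>"]) (auto intro: sum_nonneg)
    finally show ?thesis .
  qed
  have "\<exists>\<alpha>. \<forall>x. \<bar>real_of_int (\<phi> (N x) b) - \<alpha> \<bullet> x\<bar> \<le> C" if b: "b \<in> B" for b
  proof -
    have "\<bar>real_of_int (\<phi> (N x) b) + real_of_int (\<phi> (N y) b) - real_of_int (\<phi> (N (x + y)) b)\<bar> \<le> C" for x y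
    proof -
      define e where "e = N x + N y - N (x + y)"
      have "norm e \<le> norm (x + y - N (x + y)) + norm (x - N x) + norm (y - N y)"
      proof -
        have eq: "e = (x + y - N (x + y)) - (x - N x) - (y - N y)" by (simp add: e_def)
        show ?thesis
          unfolding eq using norm_triangle_ineq4[of "(x + y - N (x + y)) - (x - N x)" "y - N y"]
            norm_triangle_ineq4[of "x + y - N (x + y)" "x - N x"] by linarith
      qed
      also have "\<dots> < 3 * R" using N(2)[of x] N(2)[of y] N(2)[of "x + y"] by linarith
      finally have "e \<in> E" using triple[OF N(1) N(1) N(1), of x y "x + y"] by (simp add: E_def e_def)
      moreover have "\<phi> e b = \<phi> (N x) b + \<phi> (N y) b - \<phi> (N (x + y)) b"
      proof (rule \<phi>_eq[OF _ b])
        show "e = int_comb B (\<lambda>b. \<phi> (N x) b + \<phi> (N y) b - \<phi> (N (x + y)) b)"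
          unfolding int_comb_diff int_comb_add e_def using \<phi>[OF \<Lambda>B[OF N(1)]] by simp
      qed
      ultimately show ?thesis using C[of e b] b by simp
    qed
    moreover have "\<exists>K. \<forall>x. norm x \<le> r \<longrightarrow> \<bar>real_of_int (\<phi> (N x) b)\<bar> \<le> K" for r
    proof (intro exI allI impI)
      fix x :: 'a assume "norm x \<le> r"
      moreover have "norm (N x) \<le> norm x + norm (x - N x)"
        using norm_triangle_ineq[of x "N x - x"] by (simp add: norm_minus_commute)
      ultimately have "N x \<in> \<Lambda> \<inter> ball 0 (r + R)" using N[of x] by simp
      moreover have "finite (\<Lambda> \<inter> ball 0 (r + R))" by (rule finite_uniform_discrete_bounded[OF ud]) simp
      ultimately show "\<bar>real_of_int (\<phi> (N x) b)\<bar> \<le> (\<Sum>l\<in>\<Lambda> \<inter> ball 0 (r + R). \<bar>real_of_int (\<phi> l b)\<bar>)"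
        by (intro member_le_sum[where f = "\<lambda>l. \<bar>real_of_int (\<phi> l b)\<bar>"]) auto
    qed
    ultimately show ?thesis
      using approximately_additive_near_linear[of "\<lambda>x. real_of_int (\<phi> (N x) b)" C] by blast
  qed
  then obtain \<alpha> where \<alpha>: "\<And>b x. b \<in> B \<Longrightarrow> \<bar>real_of_int (\<phi> (N x) b) - \<alpha> b \<bullet> x\<bar> \<le> C" by metis
  have \<phi>\<alpha>: "\<bar>real_of_int (\<phi> l b) - \<alpha> b \<bullet> l\<bar> \<le> C" if "l \<in> \<Lambda>" "b \<in> B" for l b
    using \<alpha>[OF that(2), of l] N(3)[OF that(1)] by simp
  \<comment> \<open>\<open>P\<close> is linear, and bounded on \<open>\<Lambda>\<close> because both
    expansions of a point have nearly the same coefficients. As \<open>\<Lambda>\<close> is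
    relatively dense, \<open>P\<close> is bounded everywhere, hence 0.\<close>
  define P where "P = (\<lambda>x. (\<Sum>b\<in>B. (\<alpha> b \<bullet> x) *\<^sub>R b) - x)"
  have P: "linear P" unfolding P_def
    by (rule linearI) (auto simp: inner_add_right scaleR_add_left sum.distrib scaleR_sum_right algebra_simps)
  define K where "K = (\<Sum>b\<in>B. C * norm b)"
  have PK: "norm (P l) \<le> K" if l: "l \<in> \<Lambda>" for l
  proof -
    have "l = int_comb B (\<phi> l)" using \<phi>[OF \<Lambda>B[OF l]] by simp
    then have "P l = (\<Sum>b\<in>B. (\<alpha> b \<bullet> l) *\<^sub>R b) - int_comb B (\<phi> l)" unfolding P_def by simp
    also have "\<dots> = (\<Sum>b\<in>B. (\<alpha> b \<bullet> l - of_int (\<phi> l b)) *\<^sub>R b)"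
      by (simp add: int_comb_def sum_subtractf scaleR_diff_left)
    also have "norm \<dots> \<le> K" unfolding K_def
      using \<phi>\<alpha>[OF l] by (intro sum_norm_le) (auto simp: abs_minus_commute intro!: mult_right_mono)
    finally show ?thesis .
  qed
  obtain K2 where K2: "\<And>x. norm (P x) \<le> K2 * norm x" "K2 > 0"
    using linear_bounded_pos[OF P] by blast
  have Pbdd: "norm (P y) \<le> K + K2 * R" for y
  proof -
    have "P y = P (N y) + P (y - N y)" using linear_add[OF P, of "N y" "y - N y"] by simp
    then have "norm (P y) \<le> norm (P (N y)) + norm (P (y - N y))" by (metis norm_triangle_ineq)
    also have "norm (P (y - N y)) \<le> K2 * R"
      using K2(1)[of "y - N y"] mult_left_mono[of "norm (y - N y)" R K2] N(2)[of y] K2(2) by linarith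
    finally show ?thesis using PK[OF N(1)[of y]] by simp
  qed
  have "P y = 0" for y
  proof (rule ccontr)
    assume "P y \<noteq> 0"
    then obtain n where n: "real n * norm (P y) > K + K2 * R" using ex_less_of_nat_mult[of "norm (P y)"] by auto
    have "norm (P (real n *\<^sub>R y)) = real n * norm (P y)" by (simp add: linear_scale[OF P])
    then show False using n Pbdd[of "real n *\<^sub>R y"] by simp
  qed
  then have "(\<Sum>b\<in>B. (\<alpha> b \<bullet> x) *\<^sub>R b) = x" for x by (simp add: P_def)
  from that[OF B(1,2) \<phi>[OF \<Lambda>B] \<phi>\<alpha> this] show ?thesis .
qed

section \<open>The internal space\<close>

text \<open>Each nonzero combination excludes a hyperplane of directions, and countably many
  hyperplanes form a null set.\<close>

lemma ex_independent_direction: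
  fixes B :: "'a::euclidean_space set"
  assumes "finite B"
  obtains t\<^sub>0 where "\<And>k. int_comb B k \<bullet> t\<^sub>0 = 0 \<Longrightarrow> int_comb B k = 0"
proof -
  have "range (int_comb B) \<subseteq> int_comb B ` (B \<rightarrow>\<^sub>E UNIV)"
  proof
    fix x assume "x \<in> range (int_comb B)"
    then obtain k where "x = int_comb B k" by blast
    then have "x = int_comb B (restrict k B)" by (simp add: int_comb_def)
    moreover have "restrict k B \<in> B \<rightarrow>\<^sub>E UNIV" by simp
    ultimately show "x \<in> int_comb B ` (B \<rightarrow>\<^sub>E UNIV)" by (simp only: imageI)
  qed
  moreover have "countable (int_comb B ` (B \<rightarrow>\<^sub>E UNIV))" using assms by (intro countable_image countable_PiE) auto
  ultimately have cnt: "countable (range (int_comb B) - {0})" by (intro countable_Diff) (rule countable_subset)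
  have "negligible (\<Union>a\<in>range (int_comb B) - {0}. {t. a \<bullet> t = 0})"
  proof (rule negligible_countable_Union)
    show "countable ((\<lambda>a. {t. a \<bullet> t = 0}) ` (range (int_comb B) - {0}))" using cnt by (rule countable_image)
    fix H assume "H \<in> (\<lambda>a. {t. a \<bullet> t = 0}) ` (range (int_comb B) - {0})"
    then obtain a where "H = {t. a \<bullet> t = 0}" "a \<noteq> 0" by blast
    then show "negligible H" using negligible_hyperplane[of a 0] by simp
  qed
  then have "(\<Union>a\<in>range (int_comb B) - {0}. {t. a \<bullet> t = 0}) \<noteq> UNIV"
    by (rule contrapos_pn) (simp add: non_negligible_UNIV)
  then obtain t\<^sub>0 where "t\<^sub>0 \<notin> (\<Union>a\<in>range (int_comb B) - {0}. {t. a \<bullet> t = 0})" by blast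
  then show ?thesis by (intro that[of t\<^sub>0]) blast
qed

text \<open>Multiples of the direction \<open>t\<^sub>0\<close> suffice for \<open>\<tau>\<close>:
  the reals \<open>b \<bullet> t\<^sub>0\<close> inherit integral independence, so Kronecker's
  theorem for a real parameter applies.\<close>

lemma kronecker_int_independent:
  fixes B :: "'a::euclidean_space set" and x :: "'a \<Rightarrow> real"
  assumes B: "finite B" "int_independent B" and \<epsilon>: "\<epsilon> > 0"
  obtains \<tau> h where "\<And>b. b \<in> B \<Longrightarrow> \<bar>b \<bullet> \<tau> - of_int (h b) - x b\<bar> < \<epsilon>"
proof -
  obtain t\<^sub>0 where t\<^sub>0: "\<And>k. int_comb B k \<bullet> t\<^sub>0 = 0 \<Longrightarrow> int_comb B k = 0"
    using ex_independent_direction[OF B(1)] by blast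
  have ind: "k b = 0" if "(\<Sum>b\<in>B. of_int (k b) * (b \<bullet> t\<^sub>0)) = 0" "b \<in> B" for k b
  proof -
    have "int_comb B k \<bullet> t\<^sub>0 = 0" using that(1) by (simp add: int_comb_def inner_sum_left)
    then show ?thesis using t\<^sub>0 B(2) that(2) unfolding int_independent_def by blast
  qed
  have inj: "inj_on (\<lambda>b. b \<bullet> t\<^sub>0) B"
  proof (rule inj_onI, rule ccontr)
    fix b c assume bc: "b \<in> B" "c \<in> B" "b \<bullet> t\<^sub>0 = c \<bullet> t\<^sub>0" "b \<noteq> c"
    define k where "k = (\<lambda>d. (if d = b then 1 else 0) - (if d = c then 1 else 0 :: int))"
    have "(\<Sum>d\<in>B. of_int (k d) * (d \<bullet> t\<^sub>0)) = (\<Sum>d\<in>B. (if d = b then d \<bullet> t\<^sub>0 else 0)) - (\<Sum>d\<in>B. (if d = c then d \<bullet> t\<^sub>0 else 0))"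
      unfolding sum_subtractf[symmetric] by (intro sum.cong) (auto simp: k_def)
    also have "\<dots> = 0" using bc B(1) by simp
    finally have "k b = 0" using ind bc by blast
    then show False using bc by (simp add: k_def)
  qed
  obtain e where e: "bij_betw e {..<card B} B" using ex_bij_betw_nat_finite[OF B(1)] by (auto simp: atLeast0LessThan)
  define \<theta> where "\<theta> = (\<lambda>i. e i \<bullet> t\<^sub>0)"
  have inj\<theta>: "inj_on \<theta> {..<card B}"
    unfolding \<theta>_def using comp_inj_on[of e "{..<card B}" "\<lambda>b. b \<bullet> t\<^sub>0"] e inj
    by (simp add: bij_betw_def o_def)
  have \<theta>B: "\<theta> ` {..<card B} = (\<lambda>b. b \<bullet> t\<^sub>0) ` B"
    using e by (simp add: \<theta>_def bij_betw_def image_image[symmetric, of "\<lambda>b. b \<bullet> t\<^sub>0" e])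
  interpret M: Modules.module "(\<lambda>r. (*) (real_of_int r))"
    by (simp add: Modules.module.intro distrib_left mult.commute)
  have "M.independent (\<theta> ` {..<card B})"
    unfolding \<theta>B M.dependent_explicit
  proof clarify
    fix T u v assume T: "finite T" "T \<subseteq> (\<lambda>b. b \<bullet> t\<^sub>0) ` B" "(\<Sum>v\<in>T. real_of_int (u v) * v) = 0" "v \<in> T" "u v \<noteq> 0"
    define k where "k = (\<lambda>b. if b \<bullet> t\<^sub>0 \<in> T then u (b \<bullet> t\<^sub>0) else 0)"
    have "(\<Sum>b\<in>B. of_int (k b) * (b \<bullet> t\<^sub>0)) = (\<Sum>w\<in>(\<lambda>b. b \<bullet> t\<^sub>0) ` B. of_int (if w \<in> T then u w else 0) * w)"
      by (simp add: sum.reindex[OF inj] k_def)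
    also have "\<dots> = (\<Sum>w\<in>T. of_int (u w) * w)"
      using T B by (intro sum.mono_neutral_cong_right) auto
    finally have k0: "k b = 0" if "b \<in> B" for b using T(3) ind that by simp
    obtain b where b: "b \<in> B" "v = b \<bullet> t\<^sub>0" using T by blast
    then have "k b = u v" using T(4) by (simp add: k_def)
    then show False using T(5) k0[OF b(1)] by simp
  qed
  from Kronecker_thm_1[OF this inj\<theta> \<epsilon>, of "\<lambda>i. x (e i)"] obtain t h
    where th: "\<And>i. i < card B \<Longrightarrow> \<bar>t * \<theta> i - of_int (h i) - x (e i)\<bar> < \<epsilon>" by blast
  show ?thesis
  proof
    fix b assume "b \<in> B"
    then obtain i where i: "i < card B" "b = e i" using e by (auto simp: bij_betw_def)
    have inv: "the_inv_into {..<card B} e (e i) = i"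
      by (rule the_inv_into_f_f[OF bij_betw_imp_inj_on[OF e]]) (use i in simp)
    have "e i \<bullet> (t *\<^sub>R t\<^sub>0) = t * \<theta> i" by (simp add: \<theta>_def)
    then show "\<bar>b \<bullet> (t *\<^sub>R t\<^sub>0) - of_int ((h \<circ> the_inv_into {..<card B} e) b) - x b\<bar> < \<epsilon>"
      using th[OF i(1)] by (simp only: i(2) o_apply inv)
  qed
qed

text \<open>Kronecker's theorem bounds no \<open>\<tau>\<close>. Modulo integers, however, only the
  finitely many targets of a grid of mesh \<open>1 / N\<close> have to be reached.\<close>

lemma kronecker_uniform:
  fixes B :: "'a::euclidean_space set"
  assumes B: "finite B" "int_independent B" and \<epsilon>: "\<epsilon> > 0"
  obtains R where "\<And>x. \<exists>\<tau> h. norm \<tau> \<le> R \<and> (\<forall>b\<in>B. \<bar>of_int (h b) - b \<bullet> \<tau> - x b\<bar> < \<epsilon>)"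
proof -
  obtain N :: nat where N: "1 / real N < \<epsilon> / 2" "N > 0"
    using real_arch_inverse[of "\<epsilon> / 2"] \<epsilon> by (auto simp: inverse_eq_divide)
  define J where "J = B \<rightarrow>\<^sub>E {..<N}"
  have J: "finite J" using B(1) by (simp add: J_def finite_PiE)
  define P where "P = (\<lambda>(j :: 'a \<Rightarrow> nat) \<tau> h. \<forall>b\<in>B. \<bar>b \<bullet> \<tau> - of_int (h b) - real (j b) / real N\<bar> < \<epsilon> / 2)"
  have "\<exists>\<tau> h. P j \<tau> h" for j
  proof -
    have "\<epsilon> / 2 > 0" using \<epsilon> by simp
    from kronecker_int_independent[OF B this, of "\<lambda>b. real (j b) / real N"]
    obtain \<tau> h where "\<And>b. b \<in> B \<Longrightarrow> \<bar>b \<bullet> \<tau> - of_int (h b) - real (j b) / real N\<bar> < \<epsilon> / 2" by blast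
    then show ?thesis unfolding P_def by blast
  qed
  then obtain \<tau> h where "\<forall>j. P j (\<tau> j) (h j)" by metis
  then have \<tau>: "\<bar>b \<bullet> \<tau> j - of_int (h j b) - real (j b) / real N\<bar> < \<epsilon> / 2" if "b \<in> B" for j b
    using that unfolding P_def by blast
  show ?thesis
  proof
    fix x :: "'a \<Rightarrow> real"
    \<comment> \<open>The target is \<open>- x\<close> because the conclusion approximates
      \<open>x\<close> by \<open>h b - b \<bullet> \<tau>\<close>, with the sign opposite to
      Kronecker's theorem.\<close>
    define j where "j = (\<lambda>b\<in>B. nat \<lfloor>frac (- x b) * real N\<rfloor>)"
    have jb: "real (j b) \<le> frac (- x b) * real N" "frac (- x b) * real N < real (j b) + 1" if "b \<in> B" for b
    proof -
      have "frac (- x b) * real N \<ge> 0" by simp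
      then show "real (j b) \<le> frac (- x b) * real N" "frac (- x b) * real N < real (j b) + 1"
        using that by (auto simp: j_def)
    qed
    have "j b < N" if "b \<in> B" for b
    proof -
      have "frac (- x b) * real N < 1 * real N" using N frac_lt_1 by (intro mult_strict_right_mono) auto
      then show ?thesis using jb(1)[OF that] by simp
    qed
    then have jJ: "j \<in> J" by (auto simp: J_def j_def)
    have near: "\<bar>of_int (h j b - \<lfloor>- x b\<rfloor>) - b \<bullet> \<tau> j - x b\<bar> < \<epsilon>" if b: "b \<in> B" for b
    proof -
      have "\<bar>frac (- x b) - real (j b) / real N\<bar> \<le> 1 / real N"
      proof -
        have "real (j b) / real N \<le> frac (- x b)" using jb(1)[OF b] N by (simp add: divide_le_eq)
        moreover have "frac (- x b) \<le> (real (j b) + 1) / real N" using jb(2)[OF b] N by (simp add: le_divide_eq)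
        ultimately show ?thesis by (simp add: add_divide_distrib)
      qed
      then have "\<bar>(h' - of_int \<lfloor>- x b\<rfloor>) - p - x b\<bar> < \<epsilon>"
        if "\<bar>p - h' - real (j b) / real N\<bar> < \<epsilon> / 2" for h' p
        using that N(1) frac_def[of "- x b"] unfolding abs_less_iff abs_le_iff by linarith
      from this[OF \<tau>[OF b, of j]] show ?thesis by (simp only: of_int_diff)
    qed
    have "norm (\<tau> j) \<le> (\<Sum>j\<in>J. norm (\<tau> j))" by (rule member_le_sum[OF jJ norm_ge_zero J])
    then show "\<exists>\<tau>' h. norm \<tau>' \<le> (\<Sum>j\<in>J. norm (\<tau> j)) \<and> (\<forall>b\<in>B. \<bar>of_int (h b) - b \<bullet> \<tau>' - x b\<bar> < \<epsilon>)"
      using near by (intro exI[of _ "\<tau> j"] exI[of _ "\<lambda>b. h j b - \<lfloor>- x b\<rfloor>"]) simp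
  qed
qed

lemma bounded_functions_convergent_subsequence:
  fixes f :: "nat \<Rightarrow> 'b \<Rightarrow> real"
  assumes "finite A" "\<And>n b. b \<in> A \<Longrightarrow> \<bar>f n b\<bar> \<le> K"
  shows "\<exists>r l. strict_mono (r :: nat \<Rightarrow> nat) \<and> (\<forall>b\<in>A. (\<lambda>n. f (r n) b) \<longlonglongrightarrow> l b)"
  using assms
proof (induction A)
  case empty
  show ?case by (intro exI[of _ "\<lambda>n. n"]) (auto simp: strict_mono_def)
next
  case (insert a A)
  have "\<exists>r l. strict_mono (r :: nat \<Rightarrow> nat) \<and> (\<forall>b\<in>A. (\<lambda>n. f (r n) b) \<longlonglongrightarrow> l b)"
    by (rule insert.IH) (use insert.prems in auto)
  then obtain r l where r: "strict_mono (r :: nat \<Rightarrow> nat)" "\<forall>b\<in>A. (\<lambda>n. f (r n) b) \<longlonglongrightarrow> l b" by blast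
  have "seq_compact {- K .. K}" using compact_Icc compact_imp_seq_compact by blast
  moreover have "\<forall>n. f (r n) a \<in> {- K .. K}" using insert.prems[of a] by (auto simp: abs_le_iff minus_le_iff)
  ultimately obtain x q where q: "strict_mono (q :: nat \<Rightarrow> nat)" "((\<lambda>n. f (r n) a) \<circ> q) \<longlonglongrightarrow> x"
    using seq_compactE[of "{- K .. K}" "\<lambda>n. f (r n) a"] by blast
  have "(\<lambda>n. f ((r \<circ> q) n) b) \<longlonglongrightarrow> (l(a := x)) b" if "b \<in> insert a A" for b
    using q(2) LIMSEQ_subseq_LIMSEQ[OF r(2)[rule_format, of b] q(1)] that insert.hyps(2) by (auto simp: o_def)
  then show ?case using strict_mono_o[OF r(1) q(1)] by (intro exI[of _ "r \<circ> q"] exI[of _ "l(a := x)"]) blast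
qed

text \<open>A cut and project scheme: real functions on \<open>B\<close> split into the physical
  space, embedded by sending \<open>t\<close> to the function \<open>b \<bullet> t\<close> of
  \<open>b\<close>, and the internal space, the kernel of \<open>phys\<close>. The assumption on
  \<open>\<alpha>\<close> makes \<open>phys\<close> a left inverse of the embedding;
  \<open>internal\<close> is the complementary projection.\<close>

locale internal_space =
  fixes B :: "'a::euclidean_space set" and \<alpha> :: "'a \<Rightarrow> 'a"
  assumes finB: "finite B" and indB: "int_independent B"
    and \<alpha>: "\<And>x. (\<Sum>b\<in>B. (\<alpha> b \<bullet> x) *\<^sub>R b) = x"
begin

definition phys :: "('a \<Rightarrow> real) \<Rightarrow> 'a" where
  "phys x = (\<Sum>b\<in>B. x b *\<^sub>R \<alpha> b)"

definition internal :: "('a \<Rightarrow> real) \<Rightarrow> 'a \<Rightarrow> real" where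
  "internal x = (\<lambda>b. x b - b \<bullet> phys x)"

abbreviation lattice :: "('a \<Rightarrow> real) set" where
  "lattice \<equiv> range (\<lambda>k b. of_int (k b))"

lemma phys_add: "phys (\<lambda>b. x b + y b) = phys x + phys y"
  by (simp add: phys_def scaleR_add_left sum.distrib)

lemma phys_diff: "phys (\<lambda>b. x b - y b) = phys x - phys y"
  by (simp add: phys_def scaleR_diff_left sum_subtractf)

lemma phys_scale: "phys (\<lambda>b. t * x b) = t *\<^sub>R phys x"
  by (simp add: phys_def scaleR_sum_right)

lemma phys_cong: "(\<And>b. b \<in> B \<Longrightarrow> x b = y b) \<Longrightarrow> phys x = phys y"
  by (simp add: phys_def)

text \<open>The adjoint form of the assumption on \<open>\<alpha>\<close>.\<close>

lemma phys_inner: "phys (\<lambda>b. b \<bullet> t) = t"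
proof -
  have "phys (\<lambda>b. b \<bullet> t) \<bullet> y = t \<bullet> y" for y
  proof -
    have "phys (\<lambda>b. b \<bullet> t) \<bullet> y = t \<bullet> (\<Sum>b\<in>B. (\<alpha> b \<bullet> y) *\<^sub>R b)"
      by (simp add: phys_def inner_sum_left inner_sum_right inner_commute mult.commute)
    then show ?thesis by (simp add: \<alpha>)
  qed
  then show ?thesis using vector_eq_rdot by blast
qed

lemma phys_internal: "phys (internal x) = 0"
  unfolding internal_def phys_diff phys_inner by simp

lemma internal_diff: "internal (\<lambda>b. x b - y b) = (\<lambda>b. internal x b - internal y b)"
  by (simp add: internal_def phys_diff inner_diff_right fun_eq_iff)

lemma internal_of_phys_0: "phys x = 0 \<Longrightarrow> internal x = x"
  by (simp add: internal_def)

lemma phys_affine: "\<lbrakk>phys x = 0; phys y = 0\<rbrakk> \<Longrightarrow> phys (\<lambda>b. x b + t * (y b - x b)) = 0"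
  by (simp add: phys_add phys_scale phys_diff)

lemma lattice_diff: "\<lbrakk>\<theta> \<in> lattice; \<theta>' \<in> lattice\<rbrakk> \<Longrightarrow> (\<lambda>b. \<theta> b - \<theta>' b) \<in> lattice"
  by (auto simp flip: of_int_diff intro!: rangeI)

text \<open>The target given to Kronecker's theorem, \<open>x b + b \<bullet> \<xi>\<close>, already
  contains the translation; hence \<open>R\<close> depends on neither \<open>x\<close> nor
  \<open>\<xi>\<close>.\<close>

lemma lattice_near_internal:
  assumes \<rho>: "\<rho> > 0"
  obtains R where "\<And>x \<xi>. phys x = 0 \<Longrightarrow>
    \<exists>\<theta>\<in>lattice. norm (phys \<theta> - \<xi>) \<le> R \<and> L2_dist B (internal \<theta>) x \<le> \<rho>"
proof -
  define a where "a = (\<Sum>b\<in>B. norm (\<alpha> b))"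
  define \<beta> where "\<beta> = (\<Sum>b\<in>B. norm b)"
  have ab: "a \<ge> 0" "\<beta> \<ge> 0" by (auto simp: a_def \<beta>_def sum_nonneg)
  \<comment> \<open>The internal error consists of the coordinate errors and of the error that they
    cause in the physical part, together at most \<open>\<epsilon> * (card B + \<beta> * a)\<close>.
    The summand 1 keeps the denominator positive.\<close>
  define \<epsilon> where "\<epsilon> = \<rho> / (1 + real (card B) + \<beta> * a)"
  have den: "1 + real (card B) + \<beta> * a > 0" using ab by (simp add: add_pos_nonneg)
  then have \<epsilon>: "\<epsilon> > 0" using \<rho> by (simp add: \<epsilon>_def)
  have "\<epsilon> * (1 + real (card B) + \<beta> * a) = \<rho>" using den by (simp add: \<epsilon>_def)
  then have \<epsilon>\<rho>: "\<epsilon> * (real (card B) + \<beta> * a) \<le> \<rho>" using \<epsilon> by (simp add: algebra_simps)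
  obtain R where R: "\<And>x. \<exists>\<tau> h. norm \<tau> \<le> R \<and> (\<forall>b\<in>B. \<bar>of_int (h b) - b \<bullet> \<tau> - x b\<bar> < \<epsilon>)"
    using kronecker_uniform[OF finB indB \<epsilon>] by blast
  show ?thesis
  proof
    fix x \<xi> assume x: "phys x = 0"
    obtain \<tau> and h :: "'a \<Rightarrow> int" where \<tau>: "norm \<tau> \<le> R" "\<And>b. b \<in> B \<Longrightarrow> \<bar>of_int (h b) - b \<bullet> \<tau> - (x b + b \<bullet> \<xi>)\<bar> < \<epsilon>"
      using R[of "\<lambda>b. x b + b \<bullet> \<xi>"] by blast
    define \<theta> where "\<theta> = (\<lambda>b. real_of_int (h b))"
    define e where "e = (\<lambda>b. \<theta> b - b \<bullet> \<tau> - (x b + b \<bullet> \<xi>))"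
    have e: "\<bar>e b\<bar> \<le> \<epsilon>" if "b \<in> B" for b using less_imp_le[OF \<tau>(2)[OF that]] by (simp add: e_def \<theta>_def)
    have "norm (phys e) \<le> (\<Sum>b\<in>B. \<epsilon> * norm (\<alpha> b))"
      unfolding phys_def using e by (intro sum_norm_le) (simp add: mult_right_mono)
    then have E: "norm (phys e) \<le> \<epsilon> * a" by (simp add: a_def sum_distrib_left)
    have \<theta>e: "\<theta> = (\<lambda>b. b \<bullet> (\<tau> + \<xi>) + (x b + e b))" by (simp add: e_def inner_add_right fun_eq_iff)
    have phys\<theta>: "phys \<theta> = \<tau> + \<xi> + phys e" unfolding \<theta>e phys_add phys_inner x by simp
    have "\<bar>internal \<theta> b - x b\<bar> \<le> \<bar>e b\<bar> + norm b * norm (phys e)" for b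
    proof -
      have "internal \<theta> b - x b = e b - b \<bullet> phys e"
        unfolding internal_def phys\<theta> by (simp add: e_def inner_add_right)
      then show ?thesis using Cauchy_Schwarz_ineq2[of b "phys e"] by simp
    qed
    then have "L2_dist B (internal \<theta>) x \<le> (\<Sum>b\<in>B. \<bar>e b\<bar> + norm b * norm (phys e))"
      by (intro order_trans[OF L2_set_le_sum_abs] sum_mono)
    also have "\<dots> \<le> (\<Sum>b\<in>B. \<epsilon> + norm b * (\<epsilon> * a))" using e E by (intro sum_mono add_mono mult_left_mono) auto
    also have "\<dots> = \<epsilon> * (real (card B) + \<beta> * a)"
      by (simp add: sum.distrib \<beta>_def sum_distrib_right sum_distrib_left algebra_simps)
    finally have "L2_dist B (internal \<theta>) x \<le> \<rho>" using \<epsilon>\<rho> by linarith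
    moreover have "norm (phys \<theta> - \<xi>) \<le> R + \<epsilon> * a"
      unfolding phys\<theta> using norm_triangle_ineq[of \<tau> "phys e"] \<tau>(1) E by simp
    ultimately show "\<exists>\<theta>\<in>lattice. norm (phys \<theta> - \<xi>) \<le> R + \<epsilon> * a \<and> L2_dist B (internal \<theta>) x \<le> \<rho>"
      by (intro bexI[of _ \<theta>]) (auto simp: \<theta>_def)
  qed
qed

text \<open>Lattice points are functions on the whole type, so a box is finite only up to agreement
  on \<open>B\<close>.\<close>

lemma finite_lattice_box:
  obtains T where "finite T" "T \<subseteq> lattice" "\<And>\<theta>. \<lbrakk>\<theta> \<in> lattice; \<And>b. b \<in> B \<Longrightarrow> \<bar>\<theta> b\<bar> \<le> K\<rbrakk> \<Longrightarrow> \<exists>\<theta>'\<in>T. \<forall>b\<in>B. \<theta>' b = \<theta> b"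
proof -
  define T0 where "T0 = B \<rightarrow>\<^sub>E {- \<lceil>K\<rceil> .. \<lceil>K\<rceil>}"
  have T0: "finite T0" using finB by (simp add: T0_def finite_PiE)
  show ?thesis
  proof
    show "finite ((\<lambda>k b. real_of_int (k b)) ` T0)" using T0 by simp
    show "(\<lambda>k b. real_of_int (k b)) ` T0 \<subseteq> lattice" by blast
    fix \<theta> assume \<theta>: "\<theta> \<in> lattice" "\<And>b. b \<in> B \<Longrightarrow> \<bar>\<theta> b\<bar> \<le> K"
    then obtain k where k: "\<theta> = (\<lambda>b. real_of_int (k b))" by blast
    have "k b \<in> {- \<lceil>K\<rceil> .. \<lceil>K\<rceil>}" if "b \<in> B" for b
      using \<theta>(2)[OF that] unfolding k atLeastAtMost_iff by linarith
    then have "restrict k B \<in> T0" by (auto simp: T0_def)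
    then show "\<exists>\<theta>'\<in>(\<lambda>k b. real_of_int (k b)) ` T0. \<forall>b\<in>B. \<theta>' b = \<theta> b"
      by (intro rev_bexI[OF imageI]) (auto simp: k)
  qed
qed

lemma abs_le_L2_set: "b \<in> B \<Longrightarrow> \<bar>x b\<bar> \<le> L2_set x B"
  using member_le_L2_set[OF finB, of b "\<lambda>b. \<bar>x b\<bar>"] by (simp add: L2_set_def)

lemma lattice_bound:
  assumes "\<bar>internal \<theta> b\<bar> \<le> X" "norm (phys \<theta>) \<le> Y" "b \<in> B"
  shows "\<bar>\<theta> b\<bar> \<le> X + (\<Sum>b\<in>B. norm b) * Y"
proof -
  have "\<bar>b \<bullet> phys \<theta>\<bar> \<le> norm b * norm (phys \<theta>)" by (rule Cauchy_Schwarz_ineq2)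
  moreover have "norm b * norm (phys \<theta>) \<le> (\<Sum>b\<in>B. norm b) * Y"
    using assms(2,3) finB by (intro mult_mono member_le_sum) (auto intro: sum_nonneg)
  ultimately show ?thesis using assms(1) unfolding internal_def by linarith
qed

text \<open>A limit of directions of internal parts that are almost shortest modulo the lattice points with
  physical part \<open>0\<close>, hence asymptotically orthogonal to these.\<close>
lemma ex_orthogonal_direction:
  assumes dense: "\<And>\<delta>. \<delta> > 0 \<Longrightarrow> \<exists>\<theta>\<in>lattice. phys \<theta> \<noteq> 0 \<and> norm (phys \<theta>) < \<delta>"
  obtains v where "phys v = 0" "L2_set v B = 1"
    "\<And>k. \<lbrakk>k \<in> lattice; phys k = 0\<rbrakk> \<Longrightarrow> (\<Sum>b\<in>B. k b * v b) = 0"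
proof -
  define q where "q = (\<lambda>x. (L2_set (internal x) B)\<^sup>2)"
  have "\<exists>\<theta>\<in>lattice. L2_set (internal \<theta>) B > real n \<and> (\<forall>\<theta>'\<in>lattice. phys \<theta>' = phys \<theta> \<longrightarrow> q \<theta> \<le> q \<theta>' + 1)" for n
  proof -
    obtain T where T: "finite T" "\<And>\<theta>. \<lbrakk>\<theta> \<in> lattice; \<And>b. b \<in> B \<Longrightarrow> \<bar>\<theta> b\<bar> \<le> real n + (\<Sum>b\<in>B. norm b) * 1\<rbrakk> \<Longrightarrow> \<exists>\<theta>'\<in>T. \<forall>b\<in>B. \<theta>' b = \<theta> b"
      using finite_lattice_box[of "real n + (\<Sum>b\<in>B. norm b) * 1"] by metis
    \<comment> \<open>\<open>T\<close> represents all lattice points with internal part of length at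
      most \<open>n\<close> and physical part of length at most 1. A nonzero physical part shorter
      than all nonzero ones in \<open>T\<close> thus has no lattice point in this box above it. The
      inserted 1 ensures the second length condition.\<close>
    define Z where "Z = insert 1 ((\<lambda>\<theta>. norm (phys \<theta>)) ` T - {0})"
    have Z: "finite Z" "Z \<noteq> {}" "\<And>z. z \<in> Z \<Longrightarrow> z > 0" using T by (auto simp: Z_def)
    have "Min Z > 0" using Z by (simp add: Min_gr_iff)
    then obtain \<theta>0 where \<theta>0: "\<theta>0 \<in> lattice" "phys \<theta>0 \<noteq> 0" "norm (phys \<theta>0) < Min Z" using dense by blast
    define P where "P = (\<lambda>\<theta>. \<theta> \<in> lattice \<and> phys \<theta> = phys \<theta>0)"
    \<comment> \<open>A least real value need not exist, so the rounded squared length is minimised.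
      This costs a summand 1 that vanishes in the limit.\<close>
    obtain \<theta> where \<theta>: "P \<theta>" "\<And>\<theta>'. P \<theta>' \<Longrightarrow> nat \<lfloor>q \<theta>\<rfloor> \<le> nat \<lfloor>q \<theta>'\<rfloor>"
      using ex_has_least_nat[of P \<theta>0 "\<lambda>\<theta>. nat \<lfloor>q \<theta>\<rfloor>"] \<theta>0 by (auto simp: P_def)
    have min: "q \<theta> \<le> q \<theta>' + 1" if "P \<theta>'" for \<theta>'
    proof -
      have "q \<theta> \<ge> 0" "q \<theta>' \<ge> 0" by (auto simp: q_def)
      then show ?thesis using \<theta>(2)[OF that] by linarith
    qed
    have "L2_set (internal \<theta>) B > real n"
    proof (rule ccontr)
      assume "\<not> ?thesis"
      then have le: "L2_set (internal \<theta>) B \<le> real n" by simp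
      have "norm (phys \<theta>) < 1" using \<theta>(1) \<theta>0(3) Min_le[OF Z(1), of 1] by (auto simp: P_def Z_def)
      then have "\<exists>\<theta>'\<in>T. \<forall>b\<in>B. \<theta>' b = \<theta> b"
        using \<theta>(1) lattice_bound[OF order_trans[OF abs_le_L2_set le], of _ 1] by (intro T(2)) (auto simp: P_def)
      then obtain \<theta>' where "\<theta>' \<in> T" "\<And>b. b \<in> B \<Longrightarrow> \<theta>' b = \<theta> b" by blast
      then have "\<theta>' \<in> T" "phys \<theta>' = phys \<theta>0" using phys_cong[of \<theta>' \<theta>] \<theta>(1) by (auto simp: P_def)
      then have "norm (phys \<theta>0) \<in> Z" using \<theta>0(2) by (auto simp: Z_def intro!: image_eqI[of _ _ \<theta>'])
      then show False using \<theta>0(3) Min_le[OF Z(1), of "norm (phys \<theta>0)"] by simp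
    qed
    then show ?thesis using \<theta>(1) min by (intro bexI[of _ \<theta>]) (auto simp: P_def)
  qed
  then obtain \<theta> where \<theta>: "\<And>n. \<theta> n \<in> lattice" "\<And>n. L2_set (internal (\<theta> n)) B > real n"
    "\<And>n \<theta>'. \<lbrakk>\<theta>' \<in> lattice; phys \<theta>' = phys (\<theta> n)\<rbrakk> \<Longrightarrow> q (\<theta> n) \<le> q \<theta>' + 1" by metis
  define N where "N = (\<lambda>n. L2_set (internal (\<theta> n)) B)"
  have N: "N n > real n" for n using \<theta>(2) by (simp add: N_def)
  have N0: "N n > 0" for n using N[of n] by (meson of_nat_0_le_iff order_le_less_trans)
  define f where "f = (\<lambda>n b. (1 / N n) * internal (\<theta> n) b)"
  have f1: "L2_set (f n) B = 1" for n
    using N0[of n] L2_set_right_distrib[of "1 / N n" "internal (\<theta> n)" B] by (simp add: f_def N_def)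
  have "\<bar>f n b\<bar> \<le> 1" if "b \<in> B" for n b
    using abs_le_L2_set[OF that, of "f n"] by (simp add: f1)
  then have "\<exists>r v. strict_mono (r :: nat \<Rightarrow> nat) \<and> (\<forall>b\<in>B. (\<lambda>n. f (r n) b) \<longlonglongrightarrow> v b)"
    by (rule bounded_functions_convergent_subsequence[OF finB])
  then obtain r v where r: "strict_mono (r :: nat \<Rightarrow> nat)" and v': "\<forall>b\<in>B. (\<lambda>n. f (r n) b) \<longlonglongrightarrow> v b"
    by blast
  have v: "b \<in> B \<Longrightarrow> (\<lambda>n. f (r n) b) \<longlonglongrightarrow> v b" for b using v' by blast
  have Nr: "filterlim (\<lambda>n. N (r n)) at_top sequentially"
  proof (rule filterlim_at_top_mono[OF filterlim_real_sequentially])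
    show "\<forall>\<^sub>F n in sequentially. real n \<le> N (r n)"
      using N seq_suble[OF r] by (intro always_eventually allI) (meson less_imp_le of_nat_le_iff order_trans)
  qed
  show ?thesis
  proof
    have "(\<lambda>n. phys (f (r n))) \<longlonglongrightarrow> phys v" unfolding phys_def by (intro tendsto_intros v)
    moreover have "phys (f (r n)) = 0" for n unfolding f_def phys_scale phys_internal by simp
    ultimately show "phys v = 0" by (simp add: LIMSEQ_const_iff)
    have "(\<lambda>n. L2_set (f (r n)) B) \<longlonglongrightarrow> L2_set v B" unfolding L2_set_def by (intro tendsto_intros v)
    then show "L2_set v B = 1" by (simp add: f1 LIMSEQ_const_iff)
    have le: "(\<Sum>b\<in>B. k b * v b) \<le> 0" if k: "k \<in> lattice" "phys k = 0" for k
    proof -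
      define K where "K = (\<Sum>b\<in>B. (k b)\<^sup>2)"
      \<comment> \<open>Translation by \<open>k\<close> preserves the physical part and so cannot
        shorten the internal part much; expanding the square bounds the inner product by a constant,
        which is then divided by the growing length \<open>N\<close>.\<close>
      have bound: "(\<Sum>b\<in>B. k b * f (r n) b) \<le> (K + 1) / 2 * inverse (N (r n))" for n
      proof -
        let ?t = "\<theta> (r n)"
        have "q ?t \<le> q (\<lambda>b. ?t b - k b) + 1"
          by (rule \<theta>(3)) (use lattice_diff[OF \<theta>(1) k(1)] k(2) in \<open>auto simp: phys_diff\<close>)
        also have "q (\<lambda>b. ?t b - k b) = q ?t - 2 * (\<Sum>b\<in>B. k b * internal ?t b) + K"
        proof -
          have L2: "(L2_set x B)\<^sup>2 = (\<Sum>b\<in>B. (x b)\<^sup>2)" for x by (simp add: L2_set_def sum_nonneg)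
          show ?thesis
            unfolding q_def internal_diff internal_of_phys_0[OF k(2)] L2 K_def
            by (simp add: power2_diff sum.distrib sum_subtractf sum_distrib_left mult_ac)
        qed
        finally have "(\<Sum>b\<in>B. k b * internal ?t b) \<le> (K + 1) / 2" by simp
        then have "(\<Sum>b\<in>B. k b * internal ?t b) * inverse (N (r n)) \<le> (K + 1) / 2 * inverse (N (r n))"
          using N0[of "r n"] by (intro mult_right_mono) auto
        then show ?thesis by (simp add: f_def sum_distrib_left sum_distrib_right field_simps)
      qed
      have "(\<lambda>n. \<Sum>b\<in>B. k b * f (r n) b) \<longlonglongrightarrow> (\<Sum>b\<in>B. k b * v b)" by (intro tendsto_intros v)
      moreover have "(\<lambda>n. (K + 1) / 2 * inverse (N (r n))) \<longlonglongrightarrow> (K + 1) / 2 * 0"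
        by (intro tendsto_intros tendsto_inverse_0_at_top Nr)
      ultimately have "(\<Sum>b\<in>B. k b * v b) \<le> (K + 1) / 2 * 0"
        by (rule LIMSEQ_le) (use bound in blast)
      then show ?thesis by simp
    qed
    fix k assume k: "k \<in> lattice" "phys k = 0"
    have "(\<lambda>b. 0 - k b) \<in> lattice" by (rule lattice_diff[OF _ k(1)]) (auto intro: range_eqI[of _ _ "\<lambda>_. 0"])
    moreover have "phys (\<lambda>b. 0 - k b) = 0" using k(2) phys_diff[of "\<lambda>_. 0" k] by (simp add: phys_def)
    ultimately have "(\<Sum>b\<in>B. (0 - k b) * v b) \<le> 0" by (rule le)
    then show "(\<Sum>b\<in>B. k b * v b) = 0" using le[OF k] by (simp add: sum_negf)
  qed
qed

end

text \<open>The values of \<open>\<nu>\<close> along a lattice orbit of \<open>s\<close> behave like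
  a bounded function of exponential type on the internal space. Coefficients may depend on
  \<open>s\<close>, \<open>\<Theta>\<close> and \<open>\<epsilon>\<close>, but \<open>y\<close>,
  \<open>M\<close> and \<open>\<sigma>\<close> do not.\<close>

locale lattice_spectrum = internal_space B \<alpha>
  for B :: "'a::euclidean_space set" and \<alpha> :: "'a \<Rightarrow> 'a" +
  fixes \<nu> :: "'a \<Rightarrow> complex" and y :: "'i \<Rightarrow> 'a \<Rightarrow> real" and M \<sigma> :: real
  assumes M0: "M > 0" and \<sigma>0: "\<sigma> > 0"
    and approx: "\<And>s \<Theta> \<epsilon>. \<lbrakk>finite \<Theta>; \<Theta> \<subseteq> lattice; \<epsilon> > 0\<rbrakk> \<Longrightarrow> \<exists>F c. exponential_sum F B c y M \<sigma> \<and>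
      (\<forall>\<theta>\<in>\<Theta>. cmod (exponential_sum.val F B c y (internal \<theta>) - \<nu> (s - phys \<theta>)) \<le> \<epsilon>)"
begin

lemma
  shows zero_lattice: "(\<lambda>_. 0) \<in> lattice" and zero_phys: "phys (\<lambda>_. 0) = 0" and zero_internal: "internal (\<lambda>_. 0) = (\<lambda>_. 0)"
  by (auto simp: phys_def internal_def intro: range_eqI[of _ _ "\<lambda>_. 0"])

text \<open>The net consists of internal parts of lattice points with physical part near \<open>\<xi>\<close>.\<close>
definition approximates :: "'i set \<Rightarrow> ('i \<Rightarrow> complex) \<Rightarrow> real \<Rightarrow> real \<Rightarrow> 'a \<Rightarrow> 'a \<Rightarrow> real \<Rightarrow> real \<Rightarrow> bool" where
  "approximates F c R \<rho> s \<xi> X \<epsilon> \<longleftrightarrow> exponential_sum F B c y M \<sigma> \<and>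
    cmod (exponential_sum.val F B c y (\<lambda>_. 0) - \<nu> s) \<le> \<epsilon> \<and>
    (\<forall>x. phys x = 0 \<longrightarrow> (\<forall>b\<in>B. \<bar>x b\<bar> \<le> X) \<longrightarrow>
      (\<exists>\<theta>\<in>lattice. norm (phys \<theta> - \<xi>) \<le> R \<and> L2_dist B (internal \<theta>) x \<le> \<rho> \<and>
        cmod (exponential_sum.val F B c y (internal \<theta>) - \<nu> (s - phys \<theta>)) \<le> \<epsilon>))"

text \<open>The locale allows approximation at finitely many lattice points only. Those needed for
  bounded \<open>x\<close> and physical part near \<open>\<xi>\<close> lie in a box, so finitely
  many representatives, together with 0, suffice.\<close>

lemma approx_on_net:
  assumes \<rho>: "\<rho> > 0"
  obtains R where "\<And>s \<xi> X \<epsilon>. \<epsilon> > 0 \<Longrightarrow> \<exists>F c. approximates F c R \<rho> s \<xi> X \<epsilon>"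
proof -
  obtain R where R: "\<And>x \<xi>. phys x = 0 \<Longrightarrow>
    \<exists>\<theta>\<in>lattice. norm (phys \<theta> - \<xi>) \<le> R \<and> L2_dist B (internal \<theta>) x \<le> \<rho>"
    using lattice_near_internal[OF \<rho>] by blast
  show ?thesis
  proof (rule that)
    fix s \<xi> :: 'a and X \<epsilon> :: real assume \<epsilon>: "\<epsilon> > 0"
    define K where "K = (X + \<rho>) + (\<Sum>b\<in>B. norm b) * (R + norm \<xi>)"
    obtain T where T: "finite T" "T \<subseteq> lattice"
      "\<And>\<theta>. \<lbrakk>\<theta> \<in> lattice; \<And>b. b \<in> B \<Longrightarrow> \<bar>\<theta> b\<bar> \<le> K\<rbrakk> \<Longrightarrow> \<exists>\<theta>'\<in>T. \<forall>b\<in>B. \<theta>' b = \<theta> b"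
      using finite_lattice_box[of K] by blast
    have "finite (insert (\<lambda>_. 0) T)" "insert (\<lambda>_. 0) T \<subseteq> lattice" using T zero_lattice by auto
    from approx[OF this \<epsilon>, of s] obtain F c where F: "exponential_sum F B c y M \<sigma>"
      and Fval: "\<And>\<theta>. \<theta> \<in> insert (\<lambda>_. 0) T \<Longrightarrow> cmod (exponential_sum.val F B c y (internal \<theta>) - \<nu> (s - phys \<theta>)) \<le> \<epsilon>"
      by blast
    show "\<exists>F c. approximates F c R \<rho> s \<xi> X \<epsilon>"
      unfolding approximates_def
    proof (intro exI conjI allI impI)
      show "exponential_sum F B c y M \<sigma>" by (rule F)
      show "cmod (exponential_sum.val F B c y (\<lambda>_. 0) - \<nu> s) \<le> \<epsilon>"
        using Fval[of "\<lambda>_. 0"] by (simp add: zero_internal zero_phys)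
      fix x assume x: "phys x = 0" "\<forall>b\<in>B. \<bar>x b\<bar> \<le> X"
      obtain \<theta> where \<theta>: "\<theta> \<in> lattice" "norm (phys \<theta> - \<xi>) \<le> R" "L2_dist B (internal \<theta>) x \<le> \<rho>"
        using R[OF x(1), of \<xi>] by blast
      have "\<bar>\<theta> b\<bar> \<le> K" if b: "b \<in> B" for b
        unfolding K_def
      proof (rule lattice_bound[OF _ _ b])
        show "\<bar>internal \<theta> b\<bar> \<le> X + \<rho>"
          using abs_le_L2_set[OF b, of "\<lambda>b. internal \<theta> b - x b"] \<theta>(3) bspec[OF x(2) b] by linarith
        show "norm (phys \<theta>) \<le> R + norm \<xi>" using norm_triangle_ineq[of "phys \<theta> - \<xi>" \<xi>] \<theta>(2) by simp
      qed
      then obtain \<theta>' where \<theta>': "\<theta>' \<in> T" "\<And>b. b \<in> B \<Longrightarrow> \<theta>' b = \<theta> b" using T(3)[OF \<theta>(1)] by blast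
      have eq: "phys \<theta>' = phys \<theta>" using \<theta>'(2) by (rule phys_cong)
      then have "L2_dist B (internal \<theta>') x = L2_dist B (internal \<theta>) x"
        using \<theta>'(2) by (intro L2_set_cong) (auto simp: internal_def)
      then show "\<exists>\<theta>\<in>lattice. norm (phys \<theta> - \<xi>) \<le> R \<and> L2_dist B (internal \<theta>) x \<le> \<rho> \<and>
          cmod (exponential_sum.val F B c y (internal \<theta>) - \<nu> (s - phys \<theta>)) \<le> \<epsilon>"
        using \<theta>(2,3) eq \<theta>'(1) T(2) Fval[of \<theta>'] by (intro bexI[of _ \<theta>']) auto
    qed
  qed
qed

text \<open>If \<open>\<nu> s\<close> were nonzero, an approximating sum would be bounded away from
  0 at the origin but tiny on the net. The whole net contradicts the Gaussian bound for large
  \<open>r\<close>; a half space gives decay on a cone, which the rotated copies turn into a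
  contradiction at the origin.\<close>

lemma vanishing_radius:
  obtains R where "\<And>s \<xi>. (\<And>\<theta>. \<lbrakk>\<theta> \<in> lattice; norm (phys \<theta> - \<xi>) \<le> R\<rbrakk> \<Longrightarrow> \<nu> (s - phys \<theta>) = 0) \<Longrightarrow> \<nu> s = 0"
    "\<And>s \<xi> v X. \<lbrakk>phys v = 0; L2_set v B = 1;
      \<And>\<theta>. \<lbrakk>\<theta> \<in> lattice; norm (phys \<theta> - \<xi>) \<le> R; (\<Sum>b\<in>B. internal \<theta> b * v b) > X\<rbrakk> \<Longrightarrow> \<nu> (s - phys \<theta>) = 0\<rbrakk> \<Longrightarrow> \<nu> s = 0"
proof -
  \<comment> \<open>Large enough for the decay of one of the 64 rotated copies below to outweigh the growth of the others.\<close>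
  define \<beta> where "\<beta> = 1280 * \<sigma>"
  have \<beta>: "\<beta> > 0" "\<beta> \<ge> \<sigma>" using \<sigma>0 by (auto simp: \<beta>_def)
  define \<rho> where "\<rho> = 1 / (16 * (\<sigma> + 2 * \<beta>))"
  have \<rho>: "\<rho> > 0" using \<beta> \<sigma>0 by (simp add: \<rho>_def)
  obtain R where R: "\<And>s \<xi> X \<epsilon>. \<epsilon> > 0 \<Longrightarrow> \<exists>F c. approximates F c R \<rho> s \<xi> X \<epsilon>"
    using approx_on_net[OF \<rho>] by blast
  show ?thesis
  proof (rule that)
    fix s \<xi> assume van: "\<And>\<theta>. \<lbrakk>\<theta> \<in> lattice; norm (phys \<theta> - \<xi>) \<le> R\<rbrakk> \<Longrightarrow> \<nu> (s - phys \<theta>) = 0"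
    show "\<nu> s = 0"
    proof (rule ccontr)
      assume "\<nu> s \<noteq> 0"
      define \<eta> where "\<eta> = cmod (\<nu> s)"
      have \<eta>: "\<eta> > 0" using \<open>\<nu> s \<noteq> 0\<close> by (simp add: \<eta>_def)
      have "((\<lambda>r. 2 * M * exp (- \<beta> * r)) \<longlongrightarrow> 0) at_top" using \<beta> by real_asymp
      then have "\<forall>\<^sub>F r in at_top. 2 * M * exp (- \<beta> * r) < \<eta> / 2" using \<eta> by (intro order_tendstoD) auto
      from eventually_conj[OF this eventually_ge_at_top]
      obtain r where r: "2 * M * exp (- \<beta> * r) < \<eta> / 2" "r \<ge> 1 / \<beta>"
        by (blast dest: eventually_happens'[OF trivial_limit_at_top_linorder])
      have r0: "r > 0" using r(2) \<beta> by (meson less_le_trans zero_less_divide_1_iff)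
      have br: "\<beta> * r \<ge> 1" using r(2) \<beta> by (simp add: field_simps)
      \<comment> \<open>The net bound pushes the sum at the origin down to
        \<open>\<eta> / 2\<close>, while the approximation keeps it at least
        \<open>3 / 4 * \<eta>\<close>.\<close>
      define \<epsilon> where "\<epsilon> = \<eta> / 4"
      have \<epsilon>: "\<epsilon> > 0" using \<eta> by (simp add: \<epsilon>_def)
      obtain F c where ap: "approximates F c R \<rho> s \<xi> r \<epsilon>" using R[OF \<epsilon>] by blast
      note F = ap[unfolded approximates_def, THEN conjunct1] ap[unfolded approximates_def, THEN conjunct2, THEN conjunct1]
      note net = ap[unfolded approximates_def, THEN conjunct2, THEN conjunct2, rule_format]
      interpret E: exponential_sum F B c y M \<sigma> by (rule F)
      have "cmod (E.val (\<lambda>_. 0)) * exp (- (\<beta> / r) * (L2_set (\<lambda>b. (\<lambda>_. 0) b - (\<lambda>_. 0) b) B)\<^sup>2) \<le> max (2 * M * exp (- \<beta> * r)) (2 * \<epsilon>)"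
      proof (rule E.gaussian_net_bound[where V = "{x. phys x = 0}"])
        fix x assume x: "x \<in> {x. phys x = 0}" "L2_set (\<lambda>b. x b - 0) B \<le> r"
        have "\<forall>b\<in>B. \<bar>x b\<bar> \<le> r" using x(2) abs_le_L2_set[of _ x] by fastforce
        then obtain \<theta> where \<theta>: "\<theta> \<in> lattice" "norm (phys \<theta> - \<xi>) \<le> R" "L2_dist B (internal \<theta>) x \<le> \<rho>"
          "cmod (E.val (internal \<theta>) - \<nu> (s - phys \<theta>)) \<le> \<epsilon>" using net x(1) by blast
        then show "\<exists>p\<in>{x. phys x = 0}. L2_dist B p x \<le> 1 / (16 * (\<sigma> + 2 * \<beta>)) \<and> cmod (E.val p) \<le> \<epsilon>"
          using van[OF \<theta>(1,2)] phys_internal by (intro bexI[of _ "internal \<theta>"]) (auto simp: \<rho>_def)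
      qed (use r0 br \<beta> \<epsilon> zero_phys phys_affine in auto)
      then have "cmod (E.val (\<lambda>_. 0)) \<le> \<eta> / 2" using r(1) by (simp add: \<epsilon>_def L2_set_0')
      moreover have "\<eta> \<le> cmod (E.val (\<lambda>_. 0)) + \<epsilon>"
        using F(2) norm_triangle_ineq2[of "\<nu> s" "E.val (\<lambda>_. 0)"] by (simp add: \<eta>_def norm_minus_commute)
      ultimately show False using \<eta> by (simp add: \<epsilon>_def)
    qed
  next
    fix s \<xi> v X assume v: "phys v = 0" "L2_set v B = 1"
      and van: "\<And>\<theta>. \<lbrakk>\<theta> \<in> lattice; norm (phys \<theta> - \<xi>) \<le> R; (\<Sum>b\<in>B. internal \<theta> b * v b) > X\<rbrakk> \<Longrightarrow> \<nu> (s - phys \<theta>) = 0"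
    show "\<nu> s = 0"
    proof (rule ccontr)
      assume "\<nu> s \<noteq> 0"
      define \<eta> where "\<eta> = cmod (\<nu> s)"
      have \<eta>: "\<eta> > 0" using \<open>\<nu> s \<noteq> 0\<close> by (simp add: \<eta>_def)
      have "((\<lambda>r. 2 * M ^ 64 * exp (- \<sigma> * r)) \<longlongrightarrow> 0) at_top" using \<sigma>0 by real_asymp
      then have "\<forall>\<^sub>F r in at_top. 2 * M ^ 64 * exp (- \<sigma> * r) < (\<eta> / 2) ^ 64" using \<eta> by (intro order_tendstoD) auto
      from eventually_conj[OF this eventually_ge_at_top]
      obtain r where r: "2 * M ^ 64 * exp (- \<sigma> * r) < (\<eta> / 2) ^ 64" "r \<ge> max (1 / \<sigma>) ((\<bar>X\<bar> + \<rho> + 1) / (9 / 20))"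
        by (blast dest: eventually_happens'[OF trivial_limit_at_top_linorder])
      \<comment> \<open>Net points for the ball of radius \<open>t / 2\<close> around
        \<open>t * v\<close> have component at least \<open>t / 2 - \<rho>\<close> along
        \<open>v\<close>, with \<open>t \<ge> 9 / 10 * r\<close> on the cone; this has to exceed
        \<open>X\<close>.\<close>
      have rX: "(9 / 20) * r \<ge> \<bar>X\<bar> + \<rho> + 1" and r\<sigma>: "\<sigma> * r \<ge> 1" using r(2) \<sigma>0 by (auto simp: field_simps)
      have r0: "r > 0" using rX \<rho> by linarith
      \<comment> \<open>The first bound serves for the comparison with \<open>\<nu> s\<close> at the
        origin, the second is demanded by \<open>gaussian_net_bound_cone\<close>.\<close>
      define \<epsilon> where "\<epsilon> = min (\<eta> / 2) (M * exp (- \<beta> * r))"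
      have \<epsilon>: "\<epsilon> > 0" using \<eta> M0 by (simp add: \<epsilon>_def)
      obtain F c where ap: "approximates F c R \<rho> s \<xi> (2 * r) \<epsilon>" using R[OF \<epsilon>] by blast
      note F = ap[unfolded approximates_def, THEN conjunct1] ap[unfolded approximates_def, THEN conjunct2, THEN conjunct1]
      note net = ap[unfolded approximates_def, THEN conjunct2, THEN conjunct2, rule_format]
      interpret E: exponential_sum F B c y M \<sigma> by (rule F)
      have cone: "cmod (E.line (\<lambda>_. 0) v z) \<le> 2 * M * exp (- 128 * \<sigma> * r)"
        if z: "cmod z = r" "8 * \<bar>Im z\<bar> \<le> Re z" for z
      proof -
        define t where "t = Re z"
        have t: "9 / 10 * r \<le> t" "t \<le> r" "t > 0"
        proof -
          show "t \<le> r" using abs_Re_le_cmod[of z] z by (simp add: t_def)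
          have t0: "t \<ge> 0" using z(2) by (simp add: t_def)
          have "\<bar>Im z\<bar> \<le> t / 8" using z(2) by (simp add: t_def)
          then have "\<bar>Im z\<bar>\<^sup>2 \<le> (t / 8)\<^sup>2" by (intro power_mono) auto
          then have "r\<^sup>2 \<le> t\<^sup>2 + (t / 8)\<^sup>2" using cmod_power2[of z] z(1) by (simp add: t_def)
          moreover have "(t / 8)\<^sup>2 = t\<^sup>2 / 64" "(9 / 10 * r)\<^sup>2 = 81 / 100 * r\<^sup>2"
            by (simp_all add: power_mult_distrib power_divide)
          ultimately have "(9 / 10 * r)\<^sup>2 \<le> t\<^sup>2" using zero_le_power2[of t] by linarith
          then show "9 / 10 * r \<le> t" using t0 by (rule power2_le_imp_le)
          then show "t > 0" using r0 by simp
        qed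
        \<comment> \<open>The decay lemma with centre \<open>t * v\<close> and radius
          \<open>t / 2\<close> reaches the height \<open>t / 8\<close>: this is the opening of the
          cone.\<close>
        define w where "w = (\<lambda>b. 0 + t * v b)"
        have w: "phys w = 0" unfolding w_def using v(1) by (simp add: phys_scale)
        have "E.line (\<lambda>_. 0) v z = E.line w v (\<i> * of_real (Im z))"
          unfolding w_def E.line_shift by (simp only: t_def complex_eq[symmetric])
        moreover have "cmod (E.line w v (\<i> * of_real (Im z))) \<le> 2 * M * exp (- \<beta> * (t / 2) / 4)"
        proof (rule E.gaussian_net_bound_cone[where V = "{x. phys x = 0}"])
          show "w \<in> {x. phys x = 0}" using w by simp
          show "t / 2 > 0" "\<bar>Im z\<bar> \<le> t / 2 / 4" using t z by (auto simp: t_def)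
          show "1 \<le> \<beta> * (t / 2)"
          proof -
            have "\<sigma> * (9 / 10 * r) \<le> \<sigma> * t" using t \<sigma>0 by (intro mult_left_mono) auto
            then show ?thesis using r\<sigma> by (simp add: \<beta>_def)
          qed
          show "\<epsilon> \<le> M * exp (- \<beta> * (t / 2))"
          proof -
            have "\<beta> * (t / 2) \<le> \<beta> * r" using t \<beta> by (intro mult_left_mono) auto
            then have "M * exp (- \<beta> * r) \<le> M * exp (- \<beta> * (t / 2))" using M0 by simp
            then show ?thesis by (simp add: \<epsilon>_def)
          qed
          show "(\<lambda>b. w b + t' * v b) \<in> {x. phys x = 0}" for t' using w v(1) by (simp add: phys_add phys_scale)
          fix x assume x: "x \<in> {x. phys x = 0}" "L2_dist B x w \<le> t / 2"
          have "\<bar>x b\<bar> \<le> 2 * r" if b: "b \<in> B" for b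
          proof -
            have "\<bar>x b - w b\<bar> \<le> t / 2" using abs_le_L2_set[OF b, of "\<lambda>b. x b - w b"] x(2) by linarith
            moreover have "\<bar>w b\<bar> \<le> t * 1"
              using abs_le_L2_set[OF b, of v] v(2) t(3) unfolding w_def by (simp add: abs_mult)
            ultimately show ?thesis using t by linarith
          qed
          then obtain \<theta> where \<theta>: "\<theta> \<in> lattice" "norm (phys \<theta> - \<xi>) \<le> R" "L2_dist B (internal \<theta>) x \<le> \<rho>"
            "cmod (E.val (internal \<theta>) - \<nu> (s - phys \<theta>)) \<le> \<epsilon>" using net[of x] x(1) by blast
          have ip: "\<bar>\<Sum>b\<in>B. u b * v b\<bar> \<le> L2_set u B" for u
            using order_trans[OF sum_abs L2_set_mult_ineq[of u v B, folded abs_mult]] by (simp add: v(2))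
          have "(\<Sum>b\<in>B. internal \<theta> b * v b) = (\<Sum>b\<in>B. (internal \<theta> b - x b) * v b) + (\<Sum>b\<in>B. (x b - w b) * v b) + (\<Sum>b\<in>B. w b * v b)"
            by (simp add: sum.distrib[symmetric] algebra_simps)
          moreover have "(\<Sum>b\<in>B. w b * v b) = t"
          proof -
            have "(L2_set v B)\<^sup>2 = (\<Sum>b\<in>B. (v b)\<^sup>2)" by (simp add: L2_set_def sum_nonneg)
            then have "t * (\<Sum>b\<in>B. (v b)\<^sup>2) = t" by (simp add: v(2))
            then show ?thesis by (simp add: w_def sum_distrib_left power2_eq_square mult.assoc)
          qed
          ultimately have "(\<Sum>b\<in>B. internal \<theta> b * v b) \<ge> t - t / 2 - \<rho>"
            using ip[of "\<lambda>b. internal \<theta> b - x b"] ip[of "\<lambda>b. x b - w b"] \<theta>(3) x(2) by linarith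
          then have "(\<Sum>b\<in>B. internal \<theta> b * v b) > X" using rX t(1) by linarith
          then have "\<nu> (s - phys \<theta>) = 0" using van \<theta> by blast
          then show "\<exists>p\<in>{x. phys x = 0}. L2_dist B p x \<le> 1 / (16 * (\<sigma> + 2 * \<beta>)) \<and> cmod (E.val p) \<le> \<epsilon>"
            using \<theta> phys_internal by (intro bexI[of _ "internal \<theta>"]) (auto simp: \<rho>_def)
        qed (use \<beta> \<epsilon> v phys_affine in auto)
        \<comment> \<open>The exponent is
          \<open>160 * \<sigma> * t \<ge> 144 * \<sigma> * r\<close>. The other 63 copies grow by
          \<open>63 * \<sigma> * r\<close> together, so a decay of \<open>128 * \<sigma> * r\<close>
          wins.\<close>
        moreover have "2 * M * exp (- \<beta> * (t / 2) / 4) \<le> 2 * M * exp (- 128 * \<sigma> * r)"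
        proof -
          have "\<sigma> * (9 / 10 * r) \<le> \<sigma> * t" using t \<sigma>0 by (intro mult_left_mono) auto
          then have "- \<beta> * (t / 2) / 4 \<le> - 128 * \<sigma> * r" using r\<sigma> by (simp add: \<beta>_def)
          then show ?thesis using M0 by (intro mult_left_mono) auto
        qed
        ultimately show ?thesis by simp
      qed
      have "cmod (E.line (\<lambda>_. 0) v 0) ^ 64 \<le> 2 * M * exp (- 128 * \<sigma> * r) * (M * exp (\<sigma> * r)) ^ (64 - 1)"
      proof (rule power_at_0_le_rotated_sector_bound[OF E.line_holomorphic r0])
        show "cmod (E.line (\<lambda>_. 0) v z) \<le> M * exp (\<sigma> * r)" if "cmod z = r" for z
        proof -
          have "\<sigma> * \<bar>Im z\<bar> \<le> \<sigma> * r" using abs_Im_le_cmod[of z] that \<sigma>0 by (intro mult_left_mono) auto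
          then have "M * exp (\<sigma> * L2_set v B * \<bar>Im z\<bar>) \<le> M * exp (\<sigma> * r)" using M0 v(2) by simp
          then show ?thesis using E.norm_line_le[of "\<lambda>_. 0" v z] by linarith
        qed
      qed (use cone M0 in auto)
      also have "\<dots> = 2 * M ^ 64 * exp (- 65 * (\<sigma> * r))"
      proof -
        have "(exp (\<sigma> * r)) ^ 63 = exp (63 * (\<sigma> * r))" using exp_of_nat_mult[of 63 "\<sigma> * r"] by simp
        then have "exp (- 128 * \<sigma> * r) * (exp (\<sigma> * r)) ^ 63 = exp (- 65 * (\<sigma> * r))"
          by (simp add: exp_add[symmetric])
        moreover have "M * M ^ 63 = M ^ 64" using power_Suc[of M 63] by simp
        ultimately show ?thesis by (simp add: power_mult_distrib mult_ac)
      qed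
      also have "\<dots> \<le> 2 * M ^ 64 * exp (- \<sigma> * r)"
        using r\<sigma> M0 by (intro mult_left_mono) auto
      also have "\<dots> < (\<eta> / 2) ^ 64" by (rule r(1))
      finally have "cmod (E.line (\<lambda>_. 0) v 0) < \<eta> / 2"
        by (rule power_less_imp_less_base) (use \<eta> in simp)
      moreover have "E.line (\<lambda>_. 0) v 0 = E.val (\<lambda>_. 0)" using E.line_of_real[of "\<lambda>_. 0" v 0] by simp
      moreover have "\<eta> \<le> cmod (E.val (\<lambda>_. 0)) + \<epsilon>"
        using F(2) norm_triangle_ineq2[of "\<nu> s" "E.val (\<lambda>_. 0)"] by (simp add: \<eta>_def norm_minus_commute)
      ultimately show False by (simp add: \<epsilon>_def)
    qed
  qed
qed

end

section \<open>Spectra of measures on Meyer sets\<close>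

text \<open>In the coset of \<open>u\<close> at most one point lies within
  \<open>\<delta> / 2\<close> of 0, as two would differ by a short element of \<open>W\<close>. So
  each coset has a gap at 0, and only the finitely many cosets of differences \<open>t - t'\<close>
  occur.\<close>

lemma uniform_discrete_finite_cosets:
  fixes S T W :: "'a::real_normed_vector set"
  assumes T: "finite T" and W: "\<And>w w'. \<lbrakk>w \<in> W; w' \<in> W\<rbrakk> \<Longrightarrow> w - w' \<in> W"
    and sep: "\<delta> > 0" "\<And>w. \<lbrakk>w \<in> W; norm w < \<delta>\<rbrakk> \<Longrightarrow> w = 0"
    and S: "\<And>s. s \<in> S \<Longrightarrow> \<exists>t\<in>T. \<exists>w\<in>W. s = t + w"
  shows "uniform_discrete S"
proof -
  have "\<exists>e>0. \<forall>w\<in>W. norm (u + w) < e \<longrightarrow> u + w = 0" for u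
  proof (cases "\<exists>w\<^sub>1\<in>W. u + w\<^sub>1 \<noteq> 0 \<and> norm (u + w\<^sub>1) < \<delta> / 2")
    case True
    then obtain w\<^sub>1 where w\<^sub>1: "w\<^sub>1 \<in> W" "u + w\<^sub>1 \<noteq> 0" "norm (u + w\<^sub>1) < \<delta> / 2" by blast
    have "u + w = 0" if w: "w \<in> W" "norm (u + w) < norm (u + w\<^sub>1)" for w
    proof -
      have "norm (w - w\<^sub>1) \<le> norm (u + w) + norm (u + w\<^sub>1)"
        using norm_triangle_ineq4[of "u + w" "u + w\<^sub>1"] by simp
      then have "norm (w - w\<^sub>1) < \<delta>" using w w\<^sub>1 by simp
      then have "w - w\<^sub>1 = 0" using sep(2) W w(1) w\<^sub>1(1) by blast
      then show ?thesis using w(2) by simp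
    qed
    then show ?thesis using w\<^sub>1(2) by (intro exI[of _ "norm (u + w\<^sub>1)"]) auto
  next
    case False
    then show ?thesis using sep(1) by (intro exI[of _ "\<delta> / 2"]) auto
  qed
  then obtain e where e: "\<And>u. e u > 0" "\<And>u w. \<lbrakk>w \<in> W; norm (u + w) < e u\<rbrakk> \<Longrightarrow> u + w = 0" by metis
  define E where "E = insert 1 ((\<lambda>(t, t'). e (t - t')) ` (T \<times> T))"
  have E: "finite E" "E \<noteq> {}" "\<And>x. x \<in> E \<Longrightarrow> x > 0" using T e(1) by (auto simp: E_def)
  show ?thesis
    unfolding uniform_discrete_def
  proof (intro exI conjI ballI impI)
    show "Min E > 0" using E by (simp add: Min_gr_iff)
    fix x y assume "x \<in> S" "y \<in> S" and d: "dist x y < Min E"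
    then obtain t w t' w' where *: "t \<in> T" "w \<in> W" "x = t + w" "t' \<in> T" "w' \<in> W" "y = t' + w'"
      using S by metis
    have "e (t - t') \<in> E" using * by (auto simp: E_def)
    then have "norm ((t - t') + (w - w')) < e (t - t')"
      using d Min_le[OF E(1)] * by (fastforce simp: dist_norm algebra_simps)
    then have "(t - t') + (w - w') = 0" using e(2) W * by blast
    then show "x = y" using * by (simp add: algebra_simps)
  qed
qed

theorem theorem7p1:
  fixes \<mu> \<nu> :: "(real ^ 'n) set \<Rightarrow> complex"
    and \<Lambda> S :: "(real ^ 'n) set"
  assumes "slowly_increasing_measure \<mu>"
    and "meyer_set \<Lambda>"
    and "atomic_on \<mu> \<Lambda>"
    and "\<forall>x\<in>\<Lambda>. \<mu> {x} \<noteq> 0"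
    and "slowly_increasing_measure \<nu>"
    and "has_fourier_transform \<mu> \<nu>"
    and "countable S"
    and "atomic_on \<nu> S"
    and "\<forall>s\<in>S. \<nu> {s} \<noteq> 0"
  shows "uniform_discrete S \<or> relatively_dense {x. x islimpt S}"
proof (rule disjCI)
  assume sparse: "\<not> relatively_dense {x. x islimpt S}"
  have si: "slowly_increasing \<mu>" "slowly_increasing \<nu>"
    using assms(1,5) by (auto simp: slowly_increasing_measure_def)
  have ud: "uniform_discrete \<Lambda>" using assms(2) by (simp add: meyer_set_def delone_def)
  then obtain d where d: "d > 0" "\<And>x y. \<lbrakk>x \<in> \<Lambda>; y \<in> \<Lambda>; x \<noteq> y\<rbrakk> \<Longrightarrow> dist x y \<ge> d"
    unfolding uniform_discrete_def by (metis not_less)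
  have cnt: "countable \<Lambda>"
  proof -
    have "\<Lambda> = (\<Union>n::nat. \<Lambda> \<inter> ball 0 (real n))"
      using reals_Archimedean2 by (fastforce simp: dist_norm)
    moreover have "finite (\<Lambda> \<inter> ball 0 (real n))" for n
      by (rule finite_uniform_discrete_bounded[OF ud]) simp
    ultimately show ?thesis by (metis countable_UN countable_finite countableI_type)
  qed
  interpret atomic_fourier_pair \<mu> \<nu> \<Lambda> S d
    by unfold_locales (rule si cnt assms d; assumption?)+
  obtain M where M: "M > 0"
    "\<And>X \<epsilon>. \<lbrakk>finite X; \<epsilon> > 0\<rbrakk> \<Longrightarrow> \<exists>F c. finite F \<and> F \<subseteq> \<Lambda> \<and> (\<Sum>l\<in>F. cmod (c l)) \<le> M \<and>
      (\<forall>x\<in>X. cmod ((\<Sum>l\<in>F. c l * wave x l) - \<nu> {x}) \<le> \<epsilon>)"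
    using atoms_approx_exponential_sums by blast
  obtain B :: "(real ^ 'n) set" and \<phi> :: "real ^ 'n \<Rightarrow> real ^ 'n \<Rightarrow> int" and \<alpha> :: "real ^ 'n \<Rightarrow> real ^ 'n" and C :: real
    where B: "finite B" "int_independent B"
    and \<phi>: "\<And>l. l \<in> \<Lambda> \<Longrightarrow> int_comb B (\<phi> l) = l"
      "\<And>l b. \<lbrakk>l \<in> \<Lambda>; b \<in> B\<rbrakk> \<Longrightarrow> \<bar>of_int (\<phi> l b) - \<alpha> b \<bullet> l\<bar> \<le> C"
    and \<alpha>: "\<And>x. (\<Sum>b\<in>B. (\<alpha> b \<bullet> x) *\<^sub>R b) = x"
    using approximately_linear_coordinates[OF assms(2)] by blast
  interpret internal_space B \<alpha> by unfold_locales (rule B \<alpha>)+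
  define y where "y = (\<lambda>l b. - 2 * pi * (of_int (\<phi> l b) - \<alpha> b \<bullet> l))"
  define \<sigma> where "\<sigma> = 1 + real (card B) * (2 * pi * \<bar>C\<bar>)"
  have \<sigma>: "\<sigma> > 0" by (simp add: \<sigma>_def add_pos_nonneg)
  have y\<sigma>: "L2_set (y l) B \<le> \<sigma>" if "l \<in> \<Lambda>" for l
  proof -
    have "L2_set (y l) B \<le> (\<Sum>b\<in>B. \<bar>y l b\<bar>)" by (rule L2_set_le_sum_abs)
    also have "\<dots> \<le> (\<Sum>b\<in>B. 2 * pi * \<bar>C\<bar>)"
    proof (rule sum_mono)
      fix b assume "b \<in> B"
      then have "\<bar>of_int (\<phi> l b) - \<alpha> b \<bullet> l\<bar> \<le> \<bar>C\<bar>" using \<phi>(2)[OF that] by force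
      then show "\<bar>y l b\<bar> \<le> 2 * pi * \<bar>C\<bar>" by (simp add: y_def abs_mult)
    qed
    finally show ?thesis by (simp add: \<sigma>_def)
  qed
  \<comment> \<open>Modulo \<open>2 * pi\<close> the phase
    \<open>2 * pi * (phys \<theta> \<bullet> l)\<close> is the pairing of \<open>\<theta>\<close>
    with \<open>y l\<close>, because \<open>\<theta>\<close> and the coordinates
    \<open>\<phi> l\<close> pair to an integer. The two expansions of \<open>l\<close> make
    \<open>y l\<close> orthogonal to the embedded physical space, so \<open>\<theta>\<close> may be
    replaced by its internal part.\<close>
  have character: "wave (s - phys \<theta>) l =
      wave s l * exp (\<i> * of_real (\<Sum>b\<in>B. internal \<theta> b * y l b))"
    if l: "l \<in> \<Lambda>" and \<theta>: "\<theta> \<in> lattice" for s \<theta> l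
  proof -
    obtain k :: "real ^ 'n \<Rightarrow> int" where k: "\<theta> = (\<lambda>b. of_int (k b))" using \<theta> by blast
    define n where "n = (\<Sum>b\<in>B. k b * \<phi> l b)"
    have "(\<Sum>b\<in>B. y l b *\<^sub>R b) = (- 2 * pi) *\<^sub>R (int_comb B (\<phi> l) - (\<Sum>b\<in>B. (\<alpha> b \<bullet> l) *\<^sub>R b))"
      by (simp add: y_def int_comb_def sum_subtractf[symmetric] scaleR_sum_right scaleR_diff_left algebra_simps)
    then have "(\<Sum>b\<in>B. y l b *\<^sub>R b) = 0" by (simp only: \<phi>(1)[OF l] \<alpha>) simp
    then have "(\<Sum>b\<in>B. (b \<bullet> phys \<theta>) * y l b) = 0"
      using inner_sum_left[of "\<lambda>b. y l b *\<^sub>R b" B "phys \<theta>"] by (simp add: mult.commute)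
    then have "(\<Sum>b\<in>B. internal \<theta> b * y l b) = (\<Sum>b\<in>B. \<theta> b * y l b)"
      by (simp add: internal_def left_diff_distrib sum_subtractf)
    also have "\<dots> = 2 * pi * (phys \<theta> \<bullet> l) - 2 * pi * of_int n"
      by (simp add: y_def k n_def phys_def inner_sum_left sum_distrib_left sum_subtractf algebra_simps)
    finally have eq: "2 * pi * (phys \<theta> \<bullet> l) = (\<Sum>b\<in>B. internal \<theta> b * y l b) + 2 * pi * of_int n" by simp
    have "- 2 * of_real pi * \<i> * of_real ((s - phys \<theta>) \<bullet> l) =
      - 2 * of_real pi * \<i> * of_real (s \<bullet> l) + \<i> * complex_of_real (2 * pi * (phys \<theta> \<bullet> l))"
      by (simp add: inner_diff_left algebra_simps)
    also have "\<dots> = (- 2 * of_real pi * \<i> * of_real (s \<bullet> l) + \<i> * of_real (\<Sum>b\<in>B. internal \<theta> b * y l b)) + 2 * of_int n * of_real pi * \<i>"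
      unfolding eq by (simp add: algebra_simps)
    finally have exponent: "- 2 * of_real pi * \<i> * of_real ((s - phys \<theta>) \<bullet> l) =
      (- 2 * of_real pi * \<i> * of_real (s \<bullet> l) + \<i> * of_real (\<Sum>b\<in>B. internal \<theta> b * y l b)) + 2 * of_int n * of_real pi * \<i>" .
    have "exp (2 * of_int n * of_real pi * \<i>) = (1 :: complex)"
      using exp_integer_2pi[of "of_int n"] by (simp add: mult_ac)
    then show ?thesis unfolding wave_def exponent exp_add by (simp only: mult_1_right)
  qed
  interpret lattice_spectrum B \<alpha> "\<lambda>x. \<nu> {x}" y M \<sigma>
  proof
    fix s and \<Theta> :: "(real ^ 'n \<Rightarrow> real) set" and \<epsilon> :: real
    assume \<Theta>: "finite \<Theta>" "\<Theta> \<subseteq> lattice" and \<epsilon>: "\<epsilon> > 0"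
    have "finite ((\<lambda>\<theta>. s - phys \<theta>) ` \<Theta>)" using \<Theta> by simp
    from M(2)[OF this \<epsilon>] obtain F c where F: "finite F" "F \<subseteq> \<Lambda>" "(\<Sum>l\<in>F. cmod (c l)) \<le> M"
      and approx: "\<And>\<theta>. \<theta> \<in> \<Theta> \<Longrightarrow> cmod ((\<Sum>l\<in>F. c l * wave (s - phys \<theta>) l) - \<nu> {s - phys \<theta>}) \<le> \<epsilon>"
      by blast
    \<comment> \<open>The factor \<open>wave s l\<close> has modulus 1, so absorbing it keeps the
      mass bound.\<close>
    define c' where "c' = (\<lambda>l. c l * wave s l)"
    have "cmod (c' l) = cmod (c l)" for l by (simp add: c'_def wave_def norm_mult)
    then interpret E: exponential_sum F B c' y M \<sigma>
      using F B M y\<sigma> \<sigma> by unfold_locales auto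
    have "E.val (internal \<theta>) = (\<Sum>l\<in>F. c l * wave (s - phys \<theta>) l)" if "\<theta> \<in> \<Theta>" for \<theta>
      unfolding E.val_def
    proof (rule sum.cong[OF refl])
      fix l assume "l \<in> F"
      then have "l \<in> \<Lambda>" "\<theta> \<in> lattice" using F(2) \<Theta>(2) that by auto
      from character[OF this, of s]
      show "c' l * exp (\<i> * of_real (\<Sum>b\<in>B. internal \<theta> b * y l b)) = c l * wave (s - phys \<theta>) l"
        by (simp only: c'_def mult.assoc)
    qed
    then show "\<exists>F c. exponential_sum F B c y M \<sigma> \<and>
      (\<forall>\<theta>\<in>\<Theta>. cmod (exponential_sum.val F B c y (internal \<theta>) - \<nu> {s - phys \<theta>}) \<le> \<epsilon>)"
      using approx E.exponential_sum_axioms by (intro exI[of _ F] exI[of _ c']) simp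
  qed (use M \<sigma> in auto)
  obtain R where R: "\<And>s \<xi>. (\<And>\<theta>. \<lbrakk>\<theta> \<in> lattice; norm (phys \<theta> - \<xi>) \<le> R\<rbrakk> \<Longrightarrow> \<nu> {s - phys \<theta>} = 0) \<Longrightarrow> \<nu> {s} = 0"
    "\<And>s \<xi> v X. \<lbrakk>phys v = 0; L2_set v B = 1;
      \<And>\<theta>. \<lbrakk>\<theta> \<in> lattice; norm (phys \<theta> - \<xi>) \<le> R; (\<Sum>b\<in>B. internal \<theta> b * v b) > X\<rbrakk> \<Longrightarrow> \<nu> {s - phys \<theta>} = 0\<rbrakk> \<Longrightarrow> \<nu> {s} = 0"
    using vanishing_radius by blast
  \<comment> \<open>The radius \<open>\<bar>R\<bar> + 1\<close> is positive, and the open ball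
    contains the closed ball of radius \<open>R\<close> used for \<open>T\<close>.\<close>
  obtain \<xi> where \<xi>: "ball \<xi> (\<bar>R\<bar> + 1) \<inter> {x. x islimpt S} = {}"
    using sparse unfolding relatively_dense_def by (meson abs_ge_zero add_nonneg_pos zero_less_one)
  define T where "T = S \<inter> cball \<xi> R"
  have T: "finite T"
  proof (rule ccontr)
    assume "infinite T"
    then obtain x where x: "x \<in> cball \<xi> R" "x islimpt T"
      using compact_cball[of \<xi> R] unfolding compact_eq_Bolzano_Weierstrass T_def by (metis inf_le2)
    then have "x islimpt S" unfolding T_def using islimpt_subset by blast
    moreover have "x \<in> ball \<xi> (\<bar>R\<bar> + 1)" using x(1) by simp
    ultimately show False using \<xi> by blast
  qed
  \<comment> \<open>Lattice points with physical part near \<open>s - \<xi>\<close> carry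
    \<open>s\<close> into the ball around \<open>\<xi>\<close>. This is why
    \<open>vanishing_radius\<close> has to allow every centre.\<close>
  have inT: "s - phys \<theta> \<in> T" if "norm (phys \<theta> - (s - \<xi>)) \<le> R" "\<nu> {s - phys \<theta>} \<noteq> 0" for s \<theta>
  proof -
    have "dist \<xi> (s - phys \<theta>) = norm (phys \<theta> - (s - \<xi>))"
      unfolding dist_norm by (rule arg_cong[where f = norm]) simp
    then show ?thesis using that atomic_on_outside[OF assms(8), of "s - phys \<theta>"] by (auto simp: T_def)
  qed
  show "uniform_discrete S"
  proof (cases "\<exists>\<delta>>0. \<forall>\<theta>\<in>lattice. norm (phys \<theta>) < \<delta> \<longrightarrow> phys \<theta> = 0")
    case True
    then obtain \<delta> where \<delta>: "\<delta> > 0" "\<And>\<theta>. \<lbrakk>\<theta> \<in> lattice; norm (phys \<theta>) < \<delta>\<rbrakk> \<Longrightarrow> phys \<theta> = 0" by blast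
    show ?thesis
    proof (rule uniform_discrete_finite_cosets[OF T _ \<delta>(1), of "phys ` lattice"])
      fix w w' assume "w \<in> phys ` lattice" "w' \<in> phys ` lattice"
      then obtain \<theta> \<theta>' where "\<theta> \<in> lattice" "\<theta>' \<in> lattice" "w = phys \<theta>" "w' = phys \<theta>'" by blast
      then show "w - w' \<in> phys ` lattice"
        using lattice_diff[of \<theta> \<theta>'] by (intro image_eqI[of _ _ "\<lambda>b. \<theta> b - \<theta>' b"]) (simp_all add: phys_diff)
    next
      fix w assume "w \<in> phys ` lattice" "norm w < \<delta>"
      then show "w = 0" using \<delta>(2) by blast
    next
      fix s assume "s \<in> S"
      then have "\<nu> {s} \<noteq> 0" using assms(9) by blast
      then obtain \<theta> where \<theta>: "\<theta> \<in> lattice" "norm (phys \<theta> - (s - \<xi>)) \<le> R" "\<nu> {s - phys \<theta>} \<noteq> 0"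
        using R(1)[of "s - \<xi>" s] by blast
      show "\<exists>t\<in>T. \<exists>w\<in>phys ` lattice. s = t + w"
        using inT[OF \<theta>(2,3)] \<theta>(1) by (intro bexI[of _ "s - phys \<theta>"] bexI[of _ "phys \<theta>"]) auto
    qed
  next
    case False
    then have "\<exists>\<theta>\<in>lattice. phys \<theta> \<noteq> 0 \<and> norm (phys \<theta>) < \<delta>" if "\<delta> > 0" for \<delta> using that by blast
    then obtain v where v: "phys v = 0" "L2_set v B = 1"
      and orth: "\<And>k. \<lbrakk>k \<in> lattice; phys k = 0\<rbrakk> \<Longrightarrow> (\<Sum>b\<in>B. k b * v b) = 0"
      using ex_orthogonal_direction by blast
    have "\<nu> {s} = 0" for s
    proof -
      \<comment> \<open>Lattice points carrying \<open>s\<close> to the same \<open>t\<close> differ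
        by one with physical part 0, so the component of their internal parts along \<open>v\<close>
        depends on \<open>t\<close> only and any representative serves. Finiteness of
        \<open>T\<close> then bounds it by \<open>X\<close>.\<close>
      define rep where "rep = (\<lambda>t. SOME \<theta>. \<theta> \<in> lattice \<and> s - phys \<theta> = t)"
      define X where "X = (\<Sum>t\<in>T. \<bar>\<Sum>b\<in>B. internal (rep t) b * v b\<bar>)"
      show ?thesis
      proof (rule R(2)[OF v, of "s - \<xi>" X])
        fix \<theta> assume \<theta>: "\<theta> \<in> lattice" "norm (phys \<theta> - (s - \<xi>)) \<le> R" "(\<Sum>b\<in>B. internal \<theta> b * v b) > X"
        show "\<nu> {s - phys \<theta>} = 0"
        proof (rule ccontr)
          assume "\<nu> {s - phys \<theta>} \<noteq> 0"
          define t where "t = s - phys \<theta>"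
          have t: "t \<in> T" unfolding t_def by (rule inT) fact+
          have "\<exists>\<theta>. \<theta> \<in> lattice \<and> s - phys \<theta> = t" using \<theta>(1) by (auto simp: t_def)
          then have rep: "rep t \<in> lattice \<and> s - phys (rep t) = t" unfolding rep_def by (rule someI_ex)
          define k where "k = (\<lambda>b. \<theta> b - rep t b)"
          have "phys (rep t) = phys \<theta>" using rep by (simp add: t_def algebra_simps)
          then have k: "k \<in> lattice" "phys k = 0" unfolding k_def
            using lattice_diff[OF \<theta>(1)] rep by (auto simp: phys_diff)
          have "(\<lambda>b. internal \<theta> b - internal (rep t) b) = k"
            using internal_of_phys_0[OF k(2)] unfolding k_def internal_diff by simp
          then have "internal \<theta> b = internal (rep t) b + k b" for b by (metis add.commute diff_add_cancel)
          then have "(\<Sum>b\<in>B. internal \<theta> b * v b) = (\<Sum>b\<in>B. internal (rep t) b * v b)"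
            using orth[OF k] by (simp add: distrib_right sum.distrib)
          also have "\<dots> \<le> \<bar>\<Sum>b\<in>B. internal (rep t) b * v b\<bar>" by simp
          also have "\<dots> \<le> X" unfolding X_def using T t by (intro member_le_sum[where f = "\<lambda>t. \<bar>\<Sum>b\<in>B. internal (rep t) b * v b\<bar>"]) auto
          finally show False using \<theta>(3) by simp
        qed
      qed
    qed
    \<comment> \<open>The non-discrete case leaves an empty spectrum, which counts as uniformly
      discrete.\<close>
    then have "S = {}" using assms(9) by blast
    then show ?thesis by simp
  qed
qed

end
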